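(* Let $B$ be the split Brown algebra over $\mathbb{C}$, let $j=\mathrm{diag}(1,-1)\in B^-$, and let $\mathbf{G}=\mathbf{Aut}(L(B))$. Then the fppf-torsor $\mathbf{G}\to\mathbf{Y}^{L(B)}$, $\phi\mapsto(\phi(1_+),\phi(1_-))$, under $\mathbf{Inv}(Q(B,j))$ is non-trivial.
   Context: Conventions (over a ring $R$ with $6\in R^*$; here $R=\mathbb{C}$). An $R$-ring is a commutative associative unital $R$-algebra; for an $R$-module $M$ and an $R$-ring $S$, $M_S=M\otimes_RS$. For an $R$-algebra $C$ (not necessarily associative), $\mathbf{Aut}(C)$ is the affine $R$-group scheme $S\mapsto\mathrm{Aut}(C_S)$ (ungraded automorphisms). A torsor over a scheme $\mathbf{Y}$ is trivial if it admits a section over $\mathbf{Y}$. Split Brown algebra. The split Albert algebra $A$ over $R$ is the module of tuples $(\alpha_1,\alpha_2,\alpha_3;c_1,c_2,c_3)$ with $\alpha_i\in R$ and $c_i$ in the split octonion algebra (norm $n$, polar form $n(c,d)=n(c+d)-n(c)-n(d)$, conjugation $c\mapsto\bar c$), with adjoint $x^\#=(\alpha_j\alpha_l-n(c_i);\ \overline{c_jc_l}-\alpha_ic_i)_{i}$ for $(i,j,l)$ running over the cyclic permutations of $(1,2,3)$, cross product $x\times y=(x+y)^\#-x^\#-y^\#$ and bilinear trace $T(x,y)=\sum_i\alpha_i\beta_i+\sum_i n(c_i,d_i)$ for $y=(\beta_i;d_i)$. The split Brown algebra is $B=\begin{pmatrix}R&A\\ A&R\end{pmatrix}$ with product $\begin{pmatrix}r_1&a_1\\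 a_2&r_2\end{pmatrix}\begin{pmatrix}r_1'&a_1'\\ a_2'&r_2'\end{pmatrix}=\begin{pmatrix}r_1r_1'+T(a_1,a_2')&r_1a_1'+r_2'a_1+a_2\times a_2'\\ r_2a_2'+r_1'a_2+a_1\times a_1'&r_2r_2'+T(a_2,a_1')\end{pmatrix}$ and involution $\begin{pmatrix}r_1&a_1\\ a_2&r_2\end{pmatrix}^*=\begin{pmatrix}r_2&a_1\\ a_2&r_1\end{pmatrix}$. Put $V_{x,y}z=(xy^* )z+(zy^* )x-(zx^* )y$ and $B^-=\{x\in B: x^*=-x\}=Rj$ with $j=\mathrm{diag}(1,-1)$, $j^2=1$. Products of two elements of $B^-$ lie in $R1_B$, identified with $R$. TKK-construction. $L(B)=\bigoplus_{i=-2}^{2}L_i$ with $L_{\pm2}$ copies of $B^-$, $L_{\pm1}$ copies of $B$, and $L_0$ the $R$-span of all $V_{x,y}$, $x,y\in B$ (a Lie algebra under the commutator). The bracket is the antisymmetric bilinear map extending the commutator on $L_0$ with ($x_\pm,y_\pm,z_\pm\in L_{\pm1}$, $s_\pm,t_\pm\in L_{\pm2}$): $[V_{x,y},z_+]=V_{x,y}z_+$, $[V_{x,y},z_-]=-V_{y,x}z_-$, $[V_{x,y},s_+]=(s_+y)x^*+x(y^*s_+)$, $[V_{x,y},s_-]=-(s_-x)y^*-y(x^*s_-)$, $[x_\pm,y_\pm]=x_\pm y_\pm^*-y_\pm x_\pm^*\in L_{\pm2}$, $[x_+,y_-]=V_{x_+,y_-}$, $[s_+,t_-]=V_{s_+t_-,1}$,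 $[s_+,x_-]=s_+x_-\in L_1$, $[s_-,x_+]=s_-x_+\in L_{-1}$; brackets landing in degrees of absolute value $>2$ are $0$. Write $1_+$ (resp. $1_-$) for $j$ viewed in $L_2$ (resp. $L_{-2}$). Triple system. $b_j(x,y)=(xy^*-yx^* )j\in R$ and $t_j(x,y,z)=2V_{x,jy}z-b_j(y,z)x-b_j(y,x)z-b_j(x,z)y$; $Q(B,j)=(B,b_j,t_j)$. $\mathbf{Inv}(Q)(S)$ is the group of $\phi\in\mathrm{GL}(B_S)$ with $b_j(\phi x,\phi y)=b_j(x,y)$ and $\phi t_j(x,y,z)=t_j(\phi x,\phi y,\phi z)$ for all $x,y,z\in B_S$. It is regarded as a subgroup of $\mathbf{G}$: each $\phi\in\mathbf{Inv}(Q)(S)$ is the restriction to $(L_1)_S=B_S$ of a unique graded automorphism of $L(B)_S$, with which it is identified. Extremal elements. For $L=L(B)$, $x\in L_S$ is unimodular if $\alpha(x)=1$ for some linear form $\alpha$ on $L_S$; it is extremal if it is unimodular and $[x,[x,y]]\in Sx$ for all $y\in L_S$; then $r_x(y)\in S$ is the unique scalar with $[x,[x,y]]=r_x(y)x$. $\mathbf{Y}^L(S)$ is the set of pairs $(x,y)$ of extremal elements of $L_S$ with $r_x(y)=-2$. It is known that $\mathbf{Y}^L$ is an affine scheme and that the map $\phi\mapsto(\phi(1_+),\phi(1_-))$ makes $\mathbf{G}$ an fppf-torsor over $\mathbf{Y}^L$ under $\mathbf{Inv}(Q(B,j))$. *)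

theory Defs
  imports Complex_Main "HOL-Library.FuncSet" "HOL-Algebra.Module"
    "HOL-Algebra.Algebraic_Closure_Type"
begin

section \<open>Rings over the complex numbers\<close>

text \<open>A \<open>\<complex>\<close>-ring is a record \<open>S\<close> satisfying the library locale \<^locale>\<open>algebra\<close> over the field
  of complex numbers; its carrier is a subset of the type \<open>'u\<close>, which serves as a universe.
  The zero ring is included.\<close>

type_synonym 'u calg = "(complex, 'u) module"

abbreviation complexes :: "complex ring" where
  "complexes \<equiv> ring_of_type_algebra"

definition C_ring :: "'u calg \<Rightarrow> bool" where
  "C_ring S \<longleftrightarrow> algebra complexes S"

definition C_hom :: "'u calg \<Rightarrow> 'u calg \<Rightarrow> ('u \<Rightarrow> 'u) set" where
  "C_hom S T = {f \<in> ring_hom S T. \<forall>c. \<forall>s\<in>carrier S. f (c \<odot>\<^bsub>S\<^esub> s) = c \<odot>\<^bsub>T\<^esub> f s}"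


section \<open>Modules and not necessarily associative algebras\<close>

text \<open>Nonassociative algebras over \<open>S\<close> are represented by \<^type>\<open>module\<close> records as well: the
  field \<^const>\<open>monoid.mult\<close> is the product, of which no ring axioms are required.\<close>

definition linear_map ::
  "('a, 'k) ring_scheme \<Rightarrow> ('a, 'b, 'm) module_scheme \<Rightarrow> ('a, 'c, 'n) module_scheme
    \<Rightarrow> ('b \<Rightarrow> 'c) \<Rightarrow> bool" where
  "linear_map S M N \<phi> \<longleftrightarrow> \<phi> \<in> carrier M \<rightarrow> carrier N \<and>
     (\<forall>x\<in>carrier M. \<forall>y\<in>carrier M. \<phi> (x \<oplus>\<^bsub>M\<^esub> y) = \<phi> x \<oplus>\<^bsub>N\<^esub> \<phi> y) \<and>
     (\<forall>s\<in>carrier S. \<forall>x\<in>carrier M. \<phi> (s \<odot>\<^bsub>M\<^esub> x) = s \<odot>\<^bsub>N\<^esub> \<phi> x)"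

definition linear_form ::
  "('a, 'k) ring_scheme \<Rightarrow> ('a, 'b, 'm) module_scheme \<Rightarrow> ('b \<Rightarrow> 'a) \<Rightarrow> bool" where
  "linear_form S M \<alpha> \<longleftrightarrow> \<alpha> \<in> carrier M \<rightarrow> carrier S \<and>
     (\<forall>x\<in>carrier M. \<forall>y\<in>carrier M. \<alpha> (x \<oplus>\<^bsub>M\<^esub> y) = \<alpha> x \<oplus>\<^bsub>S\<^esub> \<alpha> y) \<and>
     (\<forall>s\<in>carrier S. \<forall>x\<in>carrier M. \<alpha> (s \<odot>\<^bsub>M\<^esub> x) = s \<otimes>\<^bsub>S\<^esub> \<alpha> x)"

definition Endo ::
  "('a, 'k) ring_scheme \<Rightarrow> ('a, 'b, 'm) module_scheme \<Rightarrow> ('a, 'b \<Rightarrow> 'b) module" where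
  "Endo S M = \<lparr>carrier = {\<phi> \<in> extensional (carrier M). linear_map S M M \<phi>},
     monoid.mult = compose (carrier M),
     monoid.one = (\<lambda>x\<in>carrier M. x),
     ring.zero = (\<lambda>x\<in>carrier M. \<zero>\<^bsub>M\<^esub>),
     ring.add = (\<lambda>\<phi> \<psi>. \<lambda>x\<in>carrier M. \<phi> x \<oplus>\<^bsub>M\<^esub> \<psi> x),
     module.smult = (\<lambda>s \<phi>. \<lambda>x\<in>carrier M. s \<odot>\<^bsub>M\<^esub> \<phi> x)\<rparr>"

definition GL ::
  "('a, 'k) ring_scheme \<Rightarrow> ('a, 'b, 'm) module_scheme \<Rightarrow> ('b \<Rightarrow> 'b) set" where
  "GL S M = {\<phi> \<in> carrier (Endo S M). bij_betw \<phi> (carrier M) (carrier M)}"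

definition alg_Aut ::
  "('a, 'k) ring_scheme \<Rightarrow> ('a, 'b, 'm) module_scheme \<Rightarrow> ('b \<Rightarrow> 'b) set" where
  "alg_Aut S C = {\<phi> \<in> GL S C. \<forall>x\<in>carrier C. \<forall>y\<in>carrier C. \<phi> (x \<otimes>\<^bsub>C\<^esub> y) = \<phi> x \<otimes>\<^bsub>C\<^esub> \<phi> y}"

definition span_of ::
  "('a, 'k) ring_scheme \<Rightarrow> ('a, 'b, 'm) module_scheme \<Rightarrow> 'b set \<Rightarrow> 'b set" where
  "span_of S M U = \<Inter>{N. submodule N S M \<and> U \<subseteq> N}"

text \<open>If \<open>N = M \<otimes>\<^sub>S T\<close> with canonical map \<open>m : M \<rightarrow> N\<close>, this is the endomorphism \<open>\<phi> \<otimes> T\<close> of \<open>N\<close>.\<close>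

definition endo_base_change ::
  "('a, 'b, 'm) module_scheme \<Rightarrow> ('c, 'k) ring_scheme \<Rightarrow> ('c, 'd, 'n) module_scheme
    \<Rightarrow> ('b \<Rightarrow> 'd) \<Rightarrow> ('b \<Rightarrow> 'b) \<Rightarrow> ('d \<Rightarrow> 'd)" where
  "endo_base_change M T N m \<phi> =
     (THE \<psi>. \<psi> \<in> carrier (Endo T N) \<and> (\<forall>x\<in>carrier M. \<psi> (m x) = m (\<phi> x)))"

definition free_module :: "('a, 'k) ring_scheme \<Rightarrow> ('a, 'i \<Rightarrow> 'a) module" where
  "free_module S = \<lparr>carrier = UNIV \<rightarrow> carrier S,
     monoid.mult = undefined, monoid.one = undefined,
     ring.zero = (\<lambda>i. \<zero>\<^bsub>S\<^esub>),
     ring.add = (\<lambda>x y i. x i \<oplus>\<^bsub>S\<^esub> y i),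
     module.smult = (\<lambda>s x i. s \<otimes>\<^bsub>S\<^esub> x i)\<rparr>"


section \<open>The split octonion algebra\<close>

text \<open>Index set with cyclic successor: \<open>(i, nxt i, nxt (nxt i))\<close> runs over the cyclic permutations
  of \<open>(1,2,3)\<close>.\<close>

datatype three = I1 | I2 | I3

instance three :: finite
proof
  have "(UNIV :: three set) = {I1, I2, I3}" using three.exhaust by auto
  then show "finite (UNIV :: three set)" by (metis finite.emptyI finite_insert)
qed

fun nxt :: "three \<Rightarrow> three" where
  "nxt I1 = I2" | "nxt I2 = I3" | "nxt I3 = I1"

text \<open>Zorn's vector matrices: \<open>c\<close> stands for the matrix with diagonal \<open>c OE, c OF\<close> and
  off-diagonal vectors \<open>u = c \<circ> OU\<close> (upper right) and \<open>v = c \<circ> OV\<close> (lower left). The product of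
  \<open>(a,b,u,v)\<close> and \<open>(a',b',u',v')\<close> is
  \<open>(aa' + u\<cdot>v', bb' + v\<cdot>u', au' + b'u + v\<times>v', a'v + bv' - u\<times>u')\<close> and the norm is \<open>ab - u\<cdot>v\<close>.\<close>

datatype oct_ix = OE | OF | OU three | OV three

type_synonym 'a oct = "oct_ix \<Rightarrow> 'a"

definition vcross :: "('a, 'k) ring_scheme \<Rightarrow> (three \<Rightarrow> 'a) \<Rightarrow> (three \<Rightarrow> 'a) \<Rightarrow> three \<Rightarrow> 'a" where
  "vcross S u v k = u (nxt k) \<otimes>\<^bsub>S\<^esub> v (nxt (nxt k)) \<ominus>\<^bsub>S\<^esub> u (nxt (nxt k)) \<otimes>\<^bsub>S\<^esub> v (nxt k)"

definition vdot :: "('a, 'k) ring_scheme \<Rightarrow> (three \<Rightarrow> 'a) \<Rightarrow> (three \<Rightarrow> 'a) \<Rightarrow> 'a" where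
  "vdot S u v = (\<Oplus>\<^bsub>S\<^esub>k\<in>UNIV. u k \<otimes>\<^bsub>S\<^esub> v k)"

definition oct_mult :: "('a, 'k) ring_scheme \<Rightarrow> 'a oct \<Rightarrow> 'a oct \<Rightarrow> 'a oct" where
  "oct_mult S c d = (\<lambda>i. case i of
      OE \<Rightarrow> c OE \<otimes>\<^bsub>S\<^esub> d OE \<oplus>\<^bsub>S\<^esub> vdot S (c \<circ> OU) (d \<circ> OV)
    | OF \<Rightarrow> c OF \<otimes>\<^bsub>S\<^esub> d OF \<oplus>\<^bsub>S\<^esub> vdot S (c \<circ> OV) (d \<circ> OU)
    | OU k \<Rightarrow> c OE \<otimes>\<^bsub>S\<^esub> d (OU k) \<oplus>\<^bsub>S\<^esub> d OF \<otimes>\<^bsub>S\<^esub> c (OU k) \<oplus>\<^bsub>S\<^esub> vcross S (c \<circ> OV) (d \<circ> OV) k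
    | OV k \<Rightarrow> d OE \<otimes>\<^bsub>S\<^esub> c (OV k) \<oplus>\<^bsub>S\<^esub> c OF \<otimes>\<^bsub>S\<^esub> d (OV k) \<ominus>\<^bsub>S\<^esub> vcross S (c \<circ> OU) (d \<circ> OU) k)"

definition oct_norm :: "('a, 'k) ring_scheme \<Rightarrow> 'a oct \<Rightarrow> 'a" where
  "oct_norm S c = c OE \<otimes>\<^bsub>S\<^esub> c OF \<ominus>\<^bsub>S\<^esub> vdot S (c \<circ> OU) (c \<circ> OV)"

definition oct_polar :: "('a, 'k) ring_scheme \<Rightarrow> 'a oct \<Rightarrow> 'a oct \<Rightarrow> 'a" where
  "oct_polar S c d =
     oct_norm S (c \<oplus>\<^bsub>free_module S\<^esub> d) \<ominus>\<^bsub>S\<^esub> oct_norm S c \<ominus>\<^bsub>S\<^esub> oct_norm S d"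

definition oct_conj :: "('a, 'k) ring_scheme \<Rightarrow> 'a oct \<Rightarrow> 'a oct" where
  "oct_conj S c = (\<lambda>i. case i of OE \<Rightarrow> c OF | OF \<Rightarrow> c OE
    | OU k \<Rightarrow> \<ominus>\<^bsub>S\<^esub> c (OU k) | OV k \<Rightarrow> \<ominus>\<^bsub>S\<^esub> c (OV k))"


section \<open>The split Albert algebra\<close>

text \<open>\<open>x (Dg i)\<close> is the scalar \<open>\<alpha>\<^sub>i\<close>, and \<open>x \<circ> Of i\<close> is the octonion \<open>c\<^sub>i\<close>.\<close>

datatype alb_ix = Dg three | Of three oct_ix

type_synonym 'a alb = "alb_ix \<Rightarrow> 'a"

definition alb_adj :: "('a, 'k) ring_scheme \<Rightarrow> 'a alb \<Rightarrow> 'a alb" where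
  "alb_adj S x = (\<lambda>m. case m of
      Dg i \<Rightarrow> x (Dg (nxt i)) \<otimes>\<^bsub>S\<^esub> x (Dg (nxt (nxt i))) \<ominus>\<^bsub>S\<^esub> oct_norm S (x \<circ> Of i)
    | Of i k \<Rightarrow> oct_conj S (oct_mult S (x \<circ> Of (nxt i)) (x \<circ> Of (nxt (nxt i)))) k
                  \<ominus>\<^bsub>S\<^esub> x (Dg i) \<otimes>\<^bsub>S\<^esub> x (Of i k))"

definition alb_cross :: "('a, 'k) ring_scheme \<Rightarrow> 'a alb \<Rightarrow> 'a alb \<Rightarrow> 'a alb" where
  "alb_cross S x y =
     alb_adj S (x \<oplus>\<^bsub>free_module S\<^esub> y) \<ominus>\<^bsub>free_module S\<^esub> alb_adj S x \<ominus>\<^bsub>free_module S\<^esub> alb_adj S y"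

definition alb_trace :: "('a, 'k) ring_scheme \<Rightarrow> 'a alb \<Rightarrow> 'a alb \<Rightarrow> 'a" where
  "alb_trace S x y = (\<Oplus>\<^bsub>S\<^esub>i\<in>UNIV. x (Dg i) \<otimes>\<^bsub>S\<^esub> y (Dg i))
     \<oplus>\<^bsub>S\<^esub> (\<Oplus>\<^bsub>S\<^esub>i\<in>UNIV. oct_polar S (x \<circ> Of i) (y \<circ> Of i))"


section \<open>The split Brown algebra\<close>

text \<open>\<open>x R1, x R2\<close> are the diagonal entries of the matrix \<open>x\<close>, while \<open>x \<circ> A1\<close> (upper right) and
  \<open>x \<circ> A2\<close> (lower left) are its off-diagonal entries.

  All constructions are carried out over an arbitrary ring \<open>S\<close>. The structure constants of the
  split Brown algebra are integers, so \<open>Brown S\<close> is the base change to \<open>S\<close> of the split Brown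
  algebra over the complex numbers, and the canonical map for \<open>f : S \<rightarrow> T\<close> is \<open>x \<mapsto> f \<circ> x\<close>.\<close>

datatype brown_ix = R1 | R2 | A1 alb_ix | A2 alb_ix

type_synonym 'a brown = "brown_ix \<Rightarrow> 'a"

definition brown_mult :: "('a, 'k) ring_scheme \<Rightarrow> 'a brown \<Rightarrow> 'a brown \<Rightarrow> 'a brown" where
  "brown_mult S x y = (\<lambda>m. case m of
      R1 \<Rightarrow> x R1 \<otimes>\<^bsub>S\<^esub> y R1 \<oplus>\<^bsub>S\<^esub> alb_trace S (x \<circ> A1) (y \<circ> A2)
    | R2 \<Rightarrow> x R2 \<otimes>\<^bsub>S\<^esub> y R2 \<oplus>\<^bsub>S\<^esub> alb_trace S (x \<circ> A2) (y \<circ> A1)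
    | A1 k \<Rightarrow> x R1 \<otimes>\<^bsub>S\<^esub> y (A1 k) \<oplus>\<^bsub>S\<^esub> y R2 \<otimes>\<^bsub>S\<^esub> x (A1 k)
                \<oplus>\<^bsub>S\<^esub> alb_cross S (x \<circ> A2) (y \<circ> A2) k
    | A2 k \<Rightarrow> x R2 \<otimes>\<^bsub>S\<^esub> y (A2 k) \<oplus>\<^bsub>S\<^esub> y R1 \<otimes>\<^bsub>S\<^esub> x (A2 k)
                \<oplus>\<^bsub>S\<^esub> alb_cross S (x \<circ> A1) (y \<circ> A1) k)"

definition brown_one :: "('a, 'k) ring_scheme \<Rightarrow> 'a brown" where
  "brown_one S = (\<lambda>m. case m of R1 \<Rightarrow> \<one>\<^bsub>S\<^esub> | R2 \<Rightarrow> \<one>\<^bsub>S\<^esub> | A1 k \<Rightarrow> \<zero>\<^bsub>S\<^esub> | A2 k \<Rightarrow> \<zero>\<^bsub>S\<^esub>)"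

definition Brown :: "('a, 'k) ring_scheme \<Rightarrow> ('a, 'a brown) module" where
  "Brown S = (free_module S)\<lparr>monoid.mult := brown_mult S, monoid.one := brown_one S\<rparr>"

definition star :: "'a brown \<Rightarrow> 'a brown" where
  "star x = (\<lambda>m. case m of R1 \<Rightarrow> x R2 | R2 \<Rightarrow> x R1 | A1 k \<Rightarrow> x (A1 k) | A2 k \<Rightarrow> x (A2 k))"

definition Brown_minus :: "('a, 'k) ring_scheme \<Rightarrow> 'a brown set" where
  "Brown_minus S = {x \<in> carrier (Brown S). star x = \<ominus>\<^bsub>Brown S\<^esub> x}"

definition brown_j :: "('a, 'k) ring_scheme \<Rightarrow> 'a brown" where
  "brown_j S = (\<lambda>m. case m of R1 \<Rightarrow> \<one>\<^bsub>S\<^esub> | R2 \<Rightarrow> \<ominus>\<^bsub>S\<^esub> \<one>\<^bsub>S\<^esub> | A1 k \<Rightarrow> \<zero>\<^bsub>S\<^esub> | A2 k \<Rightarrow> \<zero>\<^bsub>S\<^esub>)"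

definition Vop :: "('a, 'k) ring_scheme \<Rightarrow> 'a brown \<Rightarrow> 'a brown \<Rightarrow> 'a brown \<Rightarrow> 'a brown" where
  "Vop S x y = (\<lambda>z\<in>carrier (Brown S).
     (x \<otimes>\<^bsub>Brown S\<^esub> star y) \<otimes>\<^bsub>Brown S\<^esub> z \<oplus>\<^bsub>Brown S\<^esub> (z \<otimes>\<^bsub>Brown S\<^esub> star y) \<otimes>\<^bsub>Brown S\<^esub> x
       \<ominus>\<^bsub>Brown S\<^esub> (z \<otimes>\<^bsub>Brown S\<^esub> star x) \<otimes>\<^bsub>Brown S\<^esub> y)"


section \<open>The TKK construction\<close>

text \<open>The complex algebra \<open>L(B)\<close> is \<open>TKK complexes\<close>. Since \<open>B\<close> is free of finite rank and \<open>L\<^sub>0\<close> is the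
  span of the \<open>V\<^sub>x\<^sub>,\<^sub>y\<close> inside the endomorphisms of a complex vector space, the base change
  \<open>L(B) \<otimes> S\<close> is the same construction \<open>TKK S\<close> applied to \<open>Brown S\<close>.\<close>

datatype 'a tkk =
  Tkk (deg_m2: "'a brown") (deg_m1: "'a brown") (deg_0: "'a brown \<Rightarrow> 'a brown")
      (deg_p1: "'a brown") (deg_p2: "'a brown")

definition L0 :: "('a, 'k) ring_scheme \<Rightarrow> ('a brown \<Rightarrow> 'a brown) set" where
  "L0 S = span_of S (Endo S (Brown S))
     {Vop S x y | x y. x \<in> carrier (Brown S) \<and> y \<in> carrier (Brown S)}"

definition TKK_module :: "('a, 'k) ring_scheme \<Rightarrow> ('a, 'a tkk) module" where
  "TKK_module S = \<lparr>
     carrier = {Tkk s x \<phi> y t | s x \<phi> y t. s \<in> Brown_minus S \<and> x \<in> carrier (Brown S) \<and>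
       \<phi> \<in> L0 S \<and> y \<in> carrier (Brown S) \<and> t \<in> Brown_minus S},
     monoid.mult = undefined, monoid.one = undefined,
     ring.zero = Tkk \<zero>\<^bsub>Brown S\<^esub> \<zero>\<^bsub>Brown S\<^esub> \<zero>\<^bsub>Endo S (Brown S)\<^esub> \<zero>\<^bsub>Brown S\<^esub> \<zero>\<^bsub>Brown S\<^esub>,
     ring.add = (\<lambda>u v. Tkk (deg_m2 u \<oplus>\<^bsub>Brown S\<^esub> deg_m2 v) (deg_m1 u \<oplus>\<^bsub>Brown S\<^esub> deg_m1 v)
       (deg_0 u \<oplus>\<^bsub>Endo S (Brown S)\<^esub> deg_0 v)
       (deg_p1 u \<oplus>\<^bsub>Brown S\<^esub> deg_p1 v) (deg_p2 u \<oplus>\<^bsub>Brown S\<^esub> deg_p2 v)),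
     module.smult = (\<lambda>r u. Tkk (r \<odot>\<^bsub>Brown S\<^esub> deg_m2 u) (r \<odot>\<^bsub>Brown S\<^esub> deg_m1 u)
       (r \<odot>\<^bsub>Endo S (Brown S)\<^esub> deg_0 u)
       (r \<odot>\<^bsub>Brown S\<^esub> deg_p1 u) (r \<odot>\<^bsub>Brown S\<^esub> deg_p2 u))\<rparr>"

definition in_m2 :: "('a, 'k) ring_scheme \<Rightarrow> 'a brown \<Rightarrow> 'a tkk" where
  "in_m2 S s = (Tkk s \<zero>\<^bsub>Brown S\<^esub> \<zero>\<^bsub>Endo S (Brown S)\<^esub> \<zero>\<^bsub>Brown S\<^esub> \<zero>\<^bsub>Brown S\<^esub>)"

definition in_m1 :: "('a, 'k) ring_scheme \<Rightarrow> 'a brown \<Rightarrow> 'a tkk" where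
  "in_m1 S x = (Tkk \<zero>\<^bsub>Brown S\<^esub> x \<zero>\<^bsub>Endo S (Brown S)\<^esub> \<zero>\<^bsub>Brown S\<^esub> \<zero>\<^bsub>Brown S\<^esub>)"

definition in_0 :: "('a, 'k) ring_scheme \<Rightarrow> ('a brown \<Rightarrow> 'a brown) \<Rightarrow> 'a tkk" where
  "in_0 S \<phi> = (Tkk \<zero>\<^bsub>Brown S\<^esub> \<zero>\<^bsub>Brown S\<^esub> \<phi> \<zero>\<^bsub>Brown S\<^esub> \<zero>\<^bsub>Brown S\<^esub>)"

definition in_p1 :: "('a, 'k) ring_scheme \<Rightarrow> 'a brown \<Rightarrow> 'a tkk" where
  "in_p1 S x = (Tkk \<zero>\<^bsub>Brown S\<^esub> \<zero>\<^bsub>Brown S\<^esub> \<zero>\<^bsub>Endo S (Brown S)\<^esub> x \<zero>\<^bsub>Brown S\<^esub>)"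

definition in_p2 :: "('a, 'k) ring_scheme \<Rightarrow> 'a brown \<Rightarrow> 'a tkk" where
  "in_p2 S s = (Tkk \<zero>\<^bsub>Brown S\<^esub> \<zero>\<^bsub>Brown S\<^esub> \<zero>\<^bsub>Endo S (Brown S)\<^esub> \<zero>\<^bsub>Brown S\<^esub> s)"

definition bilinear_product ::
  "('a, 'k) ring_scheme \<Rightarrow> ('a, 'b, 'm) module_scheme \<Rightarrow> ('b \<Rightarrow> 'b \<Rightarrow> 'b) \<Rightarrow> bool" where
  "bilinear_product S M br \<longleftrightarrow>
     (\<forall>x\<in>carrier M. linear_map S M M (br x) \<and> linear_map S M M (\<lambda>y. br y x))"

text \<open>The last clause only makes the bracket unique as a total function.\<close>

definition is_TKK_bracket ::
  "('a, 'k) ring_scheme \<Rightarrow> ('a tkk \<Rightarrow> 'a tkk \<Rightarrow> 'a tkk) \<Rightarrow> bool" where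
  "is_TKK_bracket S br \<longleftrightarrow>
    (let B = Brown S; E = Endo S B; L = TKK_module S in
      bilinear_product S L br
    \<and> (\<forall>u\<in>carrier L. \<forall>v\<in>carrier L. br u v = \<ominus>\<^bsub>L\<^esub> br v u)
    \<and> (\<forall>\<phi>\<in>L0 S. \<forall>\<psi>\<in>L0 S.
          br (in_0 S \<phi>) (in_0 S \<psi>) = in_0 S (\<phi> \<otimes>\<^bsub>E\<^esub> \<psi> \<ominus>\<^bsub>E\<^esub> \<psi> \<otimes>\<^bsub>E\<^esub> \<phi>))
    \<and> (\<forall>x\<in>carrier B. \<forall>y\<in>carrier B. \<forall>z\<in>carrier B.
          br (in_0 S (Vop S x y)) (in_p1 S z) = in_p1 S (Vop S x y z)
        \<and> br (in_0 S (Vop S x y)) (in_m1 S z) = in_m1 S (\<ominus>\<^bsub>B\<^esub> Vop S y x z))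
    \<and> (\<forall>x\<in>carrier B. \<forall>y\<in>carrier B. \<forall>s\<in>Brown_minus S.
          br (in_0 S (Vop S x y)) (in_p2 S s)
            = in_p2 S ((s \<otimes>\<^bsub>B\<^esub> y) \<otimes>\<^bsub>B\<^esub> star x \<oplus>\<^bsub>B\<^esub> x \<otimes>\<^bsub>B\<^esub> (star y \<otimes>\<^bsub>B\<^esub> s))
        \<and> br (in_0 S (Vop S x y)) (in_m2 S s)
            = in_m2 S ((\<ominus>\<^bsub>B\<^esub> ((s \<otimes>\<^bsub>B\<^esub> x) \<otimes>\<^bsub>B\<^esub> star y)) \<ominus>\<^bsub>B\<^esub> y \<otimes>\<^bsub>B\<^esub> (star x \<otimes>\<^bsub>B\<^esub> s)))
    \<and> (\<forall>x\<in>carrier B. \<forall>y\<in>carrier B.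
          br (in_p1 S x) (in_p1 S y) = in_p2 S (x \<otimes>\<^bsub>B\<^esub> star y \<ominus>\<^bsub>B\<^esub> y \<otimes>\<^bsub>B\<^esub> star x)
        \<and> br (in_m1 S x) (in_m1 S y) = in_m2 S (x \<otimes>\<^bsub>B\<^esub> star y \<ominus>\<^bsub>B\<^esub> y \<otimes>\<^bsub>B\<^esub> star x)
        \<and> br (in_p1 S x) (in_m1 S y) = in_0 S (Vop S x y))
    \<and> (\<forall>s\<in>Brown_minus S. \<forall>t\<in>Brown_minus S.
          br (in_p2 S s) (in_m2 S t) = in_0 S (Vop S (s \<otimes>\<^bsub>B\<^esub> t) \<one>\<^bsub>B\<^esub>)
        \<and> br (in_p2 S s) (in_p2 S t) = \<zero>\<^bsub>L\<^esub>
        \<and> br (in_m2 S s) (in_m2 S t) = \<zero>\<^bsub>L\<^esub>)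
    \<and> (\<forall>s\<in>Brown_minus S. \<forall>x\<in>carrier B.
          br (in_p2 S s) (in_m1 S x) = in_p1 S (s \<otimes>\<^bsub>B\<^esub> x)
        \<and> br (in_m2 S s) (in_p1 S x) = in_m1 S (s \<otimes>\<^bsub>B\<^esub> x)
        \<and> br (in_p2 S s) (in_p1 S x) = \<zero>\<^bsub>L\<^esub>
        \<and> br (in_m2 S s) (in_m1 S x) = \<zero>\<^bsub>L\<^esub>)
    \<and> (\<forall>u v. u \<notin> carrier L \<or> v \<notin> carrier L \<longrightarrow> br u v = undefined))"

definition TKK :: "('a, 'k) ring_scheme \<Rightarrow> ('a, 'a tkk) module" where
  "TKK S = (TKK_module S)\<lparr>monoid.mult := (THE br. is_TKK_bracket S br)\<rparr>"

definition TKK_map :: "('a, 'k) ring_scheme \<Rightarrow> ('b, 'l) ring_scheme \<Rightarrow> ('a \<Rightarrow> 'b)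
    \<Rightarrow> 'a tkk \<Rightarrow> 'b tkk" where
  "TKK_map S T f u = Tkk (f \<circ> deg_m2 u) (f \<circ> deg_m1 u)
     (endo_base_change (Brown S) T (Brown T) (\<lambda>x. f \<circ> x) (deg_0 u))
     (f \<circ> deg_p1 u) (f \<circ> deg_p2 u)"

definition one_plus :: "('a, 'k) ring_scheme \<Rightarrow> 'a tkk" where
  "one_plus S = in_p2 S (brown_j S)"

definition one_minus :: "('a, 'k) ring_scheme \<Rightarrow> 'a tkk" where
  "one_minus S = in_m2 S (brown_j S)"


section \<open>The triple system \<open>Q(B,j)\<close>\<close>

text \<open>The product \<open>(xy\<^sup>* - yx\<^sup>*)j\<close> is a multiple of the unit, identified here with its upper left
  entry.\<close>

definition b_j :: "('a, 'k) ring_scheme \<Rightarrow> 'a brown \<Rightarrow> 'a brown \<Rightarrow> 'a" where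
  "b_j S x y =
     ((x \<otimes>\<^bsub>Brown S\<^esub> star y \<ominus>\<^bsub>Brown S\<^esub> y \<otimes>\<^bsub>Brown S\<^esub> star x) \<otimes>\<^bsub>Brown S\<^esub> brown_j S) R1"

definition t_j :: "('a, 'k) ring_scheme \<Rightarrow> 'a brown \<Rightarrow> 'a brown \<Rightarrow> 'a brown \<Rightarrow> 'a brown" where
  "t_j S x y z = (let B = Brown S; w = Vop S x (brown_j S \<otimes>\<^bsub>B\<^esub> y) z in
     (w \<oplus>\<^bsub>B\<^esub> w) \<ominus>\<^bsub>B\<^esub> b_j S y z \<odot>\<^bsub>B\<^esub> x \<ominus>\<^bsub>B\<^esub> b_j S y x \<odot>\<^bsub>B\<^esub> z \<ominus>\<^bsub>B\<^esub> b_j S x z \<odot>\<^bsub>B\<^esub> y)"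

definition Inv_Q :: "('a, 'k) ring_scheme \<Rightarrow> ('a brown \<Rightarrow> 'a brown) set" where
  "Inv_Q S = {\<phi> \<in> GL S (Brown S).
     (\<forall>x\<in>carrier (Brown S). \<forall>y\<in>carrier (Brown S). b_j S (\<phi> x) (\<phi> y) = b_j S x y) \<and>
     (\<forall>x\<in>carrier (Brown S). \<forall>y\<in>carrier (Brown S). \<forall>z\<in>carrier (Brown S).
        \<phi> (t_j S x y z) = t_j S (\<phi> x) (\<phi> y) (\<phi> z))}"

definition graded :: "('a, 'k) ring_scheme \<Rightarrow> ('a tkk \<Rightarrow> 'a tkk) \<Rightarrow> bool" where
  "graded S \<psi> \<longleftrightarrow>
     \<psi> ` in_m2 S ` Brown_minus S = in_m2 S ` Brown_minus S \<and>
     \<psi> ` in_m1 S ` carrier (Brown S) = in_m1 S ` carrier (Brown S) \<and>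
     \<psi> ` in_0 S ` L0 S = in_0 S ` L0 S \<and>
     \<psi> ` in_p1 S ` carrier (Brown S) = in_p1 S ` carrier (Brown S) \<and>
     \<psi> ` in_p2 S ` Brown_minus S = in_p2 S ` Brown_minus S"

text \<open>\<open>Inv(Q(B,j))(S)\<close> as a subgroup of the automorphism group of \<open>L(B)\<^sub>S\<close>.\<close>

definition Inv_Q_in_G :: "('a, 'k) ring_scheme \<Rightarrow> ('a tkk \<Rightarrow> 'a tkk) set" where
  "Inv_Q_in_G S = {\<psi> \<in> alg_Aut S (TKK S). graded S \<psi> \<and>
     (\<exists>\<phi>\<in>Inv_Q S. \<forall>x\<in>carrier (Brown S). \<psi> (in_p1 S x) = in_p1 S (\<phi> x))}"


section \<open>Extremal elements\<close>

definition unimodular ::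
  "('a, 'k) ring_scheme \<Rightarrow> ('a, 'b, 'm) module_scheme \<Rightarrow> 'b \<Rightarrow> bool" where
  "unimodular S M x \<longleftrightarrow> x \<in> carrier M \<and> (\<exists>\<alpha>. linear_form S M \<alpha> \<and> \<alpha> x = \<one>\<^bsub>S\<^esub>)"

definition extremal ::
  "('a, 'k) ring_scheme \<Rightarrow> ('a, 'b, 'm) module_scheme \<Rightarrow> 'b \<Rightarrow> bool" where
  "extremal S L x \<longleftrightarrow> unimodular S L x \<and>
     (\<forall>y\<in>carrier L. \<exists>s\<in>carrier S. x \<otimes>\<^bsub>L\<^esub> (x \<otimes>\<^bsub>L\<^esub> y) = s \<odot>\<^bsub>L\<^esub> x)"

definition extremal_form ::
  "('a, 'k) ring_scheme \<Rightarrow> ('a, 'b, 'm) module_scheme \<Rightarrow> 'b \<Rightarrow> 'b \<Rightarrow> 'a" where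
  "extremal_form S L x y =
     (THE s. s \<in> carrier S \<and> x \<otimes>\<^bsub>L\<^esub> (x \<otimes>\<^bsub>L\<^esub> y) = s \<odot>\<^bsub>L\<^esub> x)"

definition extremal_pairs ::
  "('a, 'k) ring_scheme \<Rightarrow> ('a, 'b, 'm) module_scheme \<Rightarrow> ('b \<times> 'b) set" where
  "extremal_pairs S L = {(x, y). extremal S L x \<and> extremal S L y \<and>
     extremal_form S L x y = \<ominus>\<^bsub>S\<^esub> (\<one>\<^bsub>S\<^esub> \<oplus>\<^bsub>S\<^esub> \<one>\<^bsub>S\<^esub>)}"


section \<open>Functors of points and torsors\<close>

text \<open>Affine schemes over the complex numbers are represented by their functors of points on the
  category of \<open>\<complex>\<close>-rings with carrier in the universe \<open>'u\<close>, and morphisms of schemes by natural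
  transformations. By Yoneda's lemma these are exactly the morphisms of schemes as soon as \<open>'u\<close>
  is large enough for the category to contain copies of the coordinate rings involved. For
  schemes of finite type over \<open>\<complex>\<close>, it suffices that \<open>'u\<close> is at least as large as \<open>\<complex>\<close>.\<close>

record ('u, 'x) point_functor =
  points :: "'u calg \<Rightarrow> 'x set"
  transport :: "'u calg \<Rightarrow> 'u calg \<Rightarrow> ('u \<Rightarrow> 'u) \<Rightarrow> 'x \<Rightarrow> 'x"

definition scheme_morphism ::
  "('u, 'x) point_functor \<Rightarrow> ('u, 'y) point_functor \<Rightarrow> ('u calg \<Rightarrow> 'x \<Rightarrow> 'y) \<Rightarrow> bool" where
  "scheme_morphism E Y \<sigma> \<longleftrightarrow>
     (\<forall>S. C_ring S \<longrightarrow> \<sigma> S \<in> points E S \<rightarrow> points Y S) \<and>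
     (\<forall>S T. \<forall>f\<in>C_hom S T. C_ring S \<longrightarrow> C_ring T \<longrightarrow>
        (\<forall>x\<in>points E S. \<sigma> T (transport E S T f x) = transport Y S T f (\<sigma> S x)))"

text \<open>The data of a torsor: a right action of a group functor on the total space, and the
  projection to the base. The torsor axioms are not part of the record. Triviality means the
  existence of a section.\<close>

record ('u, 'h, 'e, 'y) torsor =
  str_group :: "('u, 'h) point_functor"
  total :: "('u, 'e) point_functor"
  base :: "('u, 'y) point_functor"
  action :: "'u calg \<Rightarrow> 'e \<Rightarrow> 'h \<Rightarrow> 'e"
  proj :: "'u calg \<Rightarrow> 'e \<Rightarrow> 'y"

definition is_section :: "('u, 'h, 'e, 'y) torsor \<Rightarrow> ('u calg \<Rightarrow> 'y \<Rightarrow> 'e) \<Rightarrow> bool" where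
  "is_section P \<sigma> \<longleftrightarrow> scheme_morphism (base P) (total P) \<sigma> \<and>
     (\<forall>S. C_ring S \<longrightarrow> (\<forall>y\<in>points (base P) S. proj P S (\<sigma> S y) = y))"

definition trivial_torsor :: "('u, 'h, 'e, 'y) torsor \<Rightarrow> bool" where
  "trivial_torsor P \<longleftrightarrow> (\<exists>\<sigma>. is_section P \<sigma>)"


section \<open>The torsor of the split Brown algebra\<close>

definition G_transport ::
  "'u calg \<Rightarrow> 'u calg \<Rightarrow> ('u \<Rightarrow> 'u) \<Rightarrow> ('u tkk \<Rightarrow> 'u tkk) \<Rightarrow> 'u tkk \<Rightarrow> 'u tkk" where
  "G_transport S T f = endo_base_change (TKK S) T (TKK T) (TKK_map S T f)"

definition G_scheme :: "('u, 'u tkk \<Rightarrow> 'u tkk) point_functor" where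
  "G_scheme = \<lparr>points = (\<lambda>S. alg_Aut S (TKK S)), transport = G_transport\<rparr>"

definition Inv_scheme :: "('u, 'u tkk \<Rightarrow> 'u tkk) point_functor" where
  "Inv_scheme = \<lparr>points = Inv_Q_in_G, transport = G_transport\<rparr>"

definition Y_scheme :: "('u, 'u tkk \<times> 'u tkk) point_functor" where
  "Y_scheme = \<lparr>points = (\<lambda>S. extremal_pairs S (TKK S)),
     transport = (\<lambda>S T f. map_prod (TKK_map S T f) (TKK_map S T f))\<rparr>"

definition Brown_torsor ::
  "('u, 'u tkk \<Rightarrow> 'u tkk, 'u tkk \<Rightarrow> 'u tkk, 'u tkk \<times> 'u tkk) torsor" where
  "Brown_torsor = \<lparr>str_group = Inv_scheme, total = G_scheme, base = Y_scheme,
     action = (\<lambda>S \<phi> \<psi>. compose (carrier (TKK S)) \<phi> \<psi>),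
     proj = (\<lambda>S \<phi>. (\<phi> (one_plus S), \<phi> (one_minus S)))\<rparr>"

end

theory Submission
  imports Defs "HOL-Library.Function_Algebras" "HOL-Library.Product_Plus"
begin

text \<open>A section would give, for every \<open>\<complex>\<close>-ring \<open>S\<close> and every point \<open>(y\<^sub>1, y\<^sub>2)\<close> of \<open>Y\<^sup>L(S)\<close>, an automorphism of
  \<open>L(B)\<^sub>S\<close> carrying \<open>(1\<^sub>+, 1\<^sub>-)\<close> to \<open>(y\<^sub>1, y\<^sub>2)\<close>. It maps \<open>L\<^sub>1\<close> onto \<open>E = {u. [y\<^sub>1, [y\<^sub>2, u]] = u}\<close>, so \<open>E\<close> is
  free of rank 56. Elements \<open>z, x\<^sub>i, y\<^sub>i\<close> (\<open>1 \<le> i \<le> 6\<close>) of \<open>S\<close> with \<open>\<Sum> x\<^sub>i y\<^sub>i = z (1 - z)\<close> define a point of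
  \<open>Y\<^sup>L(S)\<close> for which \<open>E \<oplus> S\<^sup>4\<close> contains the range of \<open>e \<oplus> 1\<^sub>2\<^sub>8\<close> as a direct summand, where \<open>e\<close> is an idempotent
  matrix of size 64 with diagonal entries \<open>z\<close> and \<open>1 - z\<close> and off-diagonal entries \<open>0, \<plusminus>x\<^sub>i, \<plusminus>y\<^sub>i\<close>. It is the Bott
  projection on the 12-sphere, written on the exterior algebra of \<open>\<complex>\<^sup>6\<close>. Hence \<open>e \<oplus> 1\<^sub>2\<^sub>8\<close> would factor through \<open>S\<^sup>6\<^sup>0\<close>.

  To refute this without K-theory, let \<open>S\<close> consist of sequences of operators on functions on the simplices
  \<open>{\<alpha> \<in> \<nat>\<^sup>6. \<bar>\<alpha>\<bar> \<le> k}\<close> modulo null sequences, with shifts \<open>x\<^sub>i\<close>, weighted backward shifts \<open>y\<^sub>i\<close> and \<open>z = 1 - \<bar>\<alpha>\<bar>/k\<close>;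
  these commute up to \<open>O(1/k)\<close>. On a suitable set of basis vectors the compression of \<open>e \<oplus> 1\<^sub>2\<^sub>8\<close> is diagonal and bounded
  below, while the factorization makes it, up to a null sequence, singular: the set has one element more than 60 copies
  of the simplex, since the sixth difference of \<open>m \<mapsto> C(m+6, 6)\<close> is 1.\<close>

section \<open>Octonions and the Albert algebra\<close>

text \<open>The point comes from the grading 14 + 64 + 92 + 64 + 14 of the 248-dimensional
  \<open>L(B)\<close>, cut out by the Peirce decomposition of one idempotent of the Albert algebra.
  Nonzero isotropic vectors of an end space of dimension 14 are extremal; a point of the affine
  quadric and its partner in the opposite end space form an extremal pair. Its space
  \<open>E\<close> lies in degrees 2, 1, 0, with ranks 12, 32, 12. The parts of rank 12 are
  complements of hyperbolic planes in spaces of dimension 14, which explains both 28 = 14 + 14 and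
  60 = 56 + 4; the part of rank 32 is the range of a projection on the half-spin module of dimension
  64, given by Clifford multiplication. The obstacle is that such a projection is a free summand up
  to topology: what distinguishes it is a top Chern class. Almost commuting operators turn this
  class into an excess of one in a count of basis vectors. Moreover the test ring must fit into any
  universe as large as \<complex>, so it is generated algebraically, without completion.\<close>

text \<open>The operations of the definitions are restated over a ring given by a type of class \<^class>\<open>comm_ring_1\<close>, where
  automation is available. The locale \<open>ring_copy\<close> below transports them to record rings inside the universe.\<close>

definition sc :: "'a::comm_ring_1 \<Rightarrow> ('i \<Rightarrow> 'a) \<Rightarrow> 'i \<Rightarrow> 'a" (infixr "\<cdot>" 75) where
  "r \<cdot> x = (\<lambda>i. r * x i)"

lemma sc_apply [simp]: "(r \<cdot> x) i = r * x i"
  by (simp add: sc_def)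

definition omul :: "'a::comm_ring_1 oct \<Rightarrow> 'a oct \<Rightarrow> 'a oct" where
  "omul c d = (\<lambda>i. case i of
      OE \<Rightarrow> c OE * d OE + (c (OU I1) * d (OV I1) + c (OU I2) * d (OV I2) + c (OU I3) * d (OV I3))
    | OF \<Rightarrow> c OF * d OF + (c (OV I1) * d (OU I1) + c (OV I2) * d (OU I2) + c (OV I3) * d (OU I3))
    | OU k \<Rightarrow> c OE * d (OU k) + d OF * c (OU k)
        + (c (OV (nxt k)) * d (OV (nxt (nxt k))) - c (OV (nxt (nxt k))) * d (OV (nxt k)))
    | OV k \<Rightarrow> d OE * c (OV k) + c OF * d (OV k)
        - (c (OU (nxt k)) * d (OU (nxt (nxt k))) - c (OU (nxt (nxt k))) * d (OU (nxt k))))"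

definition opol :: "'a::comm_ring_1 oct \<Rightarrow> 'a oct \<Rightarrow> 'a" where
  "opol c d = c OE * d OF + d OE * c OF
     - (c (OU I1) * d (OV I1) + c (OU I2) * d (OV I2) + c (OU I3) * d (OV I3))
     - (d (OU I1) * c (OV I1) + d (OU I2) * c (OV I2) + d (OU I3) * c (OV I3))"

definition ocnj :: "'a::comm_ring_1 oct \<Rightarrow> 'a oct" where
  "ocnj c = (\<lambda>i. case i of OE \<Rightarrow> c OF | OF \<Rightarrow> c OE | OU k \<Rightarrow> - c (OU k) | OV k \<Rightarrow> - c (OV k))"

definition crs :: "'a::comm_ring_1 alb \<Rightarrow> 'a alb \<Rightarrow> 'a alb" where
  "crs x y = (\<lambda>m. case m of
      Dg i \<Rightarrow> x (Dg (nxt i)) * y (Dg (nxt (nxt i))) + y (Dg (nxt i)) * x (Dg (nxt (nxt i)))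
        - opol (x \<circ> Of i) (y \<circ> Of i)
    | Of i k \<Rightarrow> ocnj (omul (x \<circ> Of (nxt i)) (y \<circ> Of (nxt (nxt i)))
                    + omul (y \<circ> Of (nxt i)) (x \<circ> Of (nxt (nxt i)))) k
        - x (Dg i) * y (Of i k) - y (Dg i) * x (Of i k))"

definition trc :: "'a::comm_ring_1 alb \<Rightarrow> 'a alb \<Rightarrow> 'a" where
  "trc x y = x (Dg I1) * y (Dg I1) + x (Dg I2) * y (Dg I2) + x (Dg I3) * y (Dg I3)
     + opol (x \<circ> Of I1) (y \<circ> Of I1) + opol (x \<circ> Of I2) (y \<circ> Of I2) + opol (x \<circ> Of I3) (y \<circ> Of I3)"

definition shp :: "'a::comm_ring_1 alb \<Rightarrow> 'a alb" where
  "shp x = (\<lambda>m. case m of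
      Dg i \<Rightarrow> x (Dg (nxt i)) * x (Dg (nxt (nxt i)))
        - (x (Of i OE) * x (Of i OF) - (x (Of i (OU I1)) * x (Of i (OV I1))
            + x (Of i (OU I2)) * x (Of i (OV I2)) + x (Of i (OU I3)) * x (Of i (OV I3))))
    | Of i k \<Rightarrow> ocnj (omul (x \<circ> Of (nxt i)) (x \<circ> Of (nxt (nxt i)))) k - x (Dg i) * x (Of i k))"

lemma all_three: "(\<forall>i. P i) \<longleftrightarrow> P I1 \<and> P I2 \<and> P I3"
  by (metis three.exhaust)

lemma all_oct: "(\<forall>i. P i) \<longleftrightarrow> P OE \<and> P OF \<and> (\<forall>k. P (OU k)) \<and> (\<forall>k. P (OV k))"
  by (metis oct_ix.exhaust)

lemma all_alb: "(\<forall>i. P i) \<longleftrightarrow> (\<forall>i. P (Dg i)) \<and> (\<forall>i k. P (Of i k))"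
  by (metis alb_ix.exhaust)

lemma crs_add: "crs (x + y) z = crs x z + crs y z" "crs z (x + y) = crs z x + crs z y"
  by (simp_all add: crs_def fun_eq_iff all_alb opol_def ocnj_def omul_def algebra_simps split: oct_ix.split)
lemma crs_sc: "crs (r \<cdot> x) z = r \<cdot> crs x z" "crs z (r \<cdot> x) = r \<cdot> crs z x"
  by (simp_all add: crs_def fun_eq_iff all_alb opol_def ocnj_def omul_def algebra_simps split: oct_ix.split)
lemma crs_comm: "crs x y = crs y x"
  by (simp add: crs_def fun_eq_iff all_alb opol_def algebra_simps)
lemma trc_add: "trc (x + y) z = trc x z + trc y z" "trc z (x + y) = trc z x + trc z y"
  by (simp_all add: trc_def opol_def algebra_simps)
lemma trc_sc: "trc (r \<cdot> x) z = r * trc x z" "trc z (r \<cdot> x) = r * trc z x"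
  by (simp_all add: trc_def opol_def algebra_simps)
lemma trc_comm: "trc x y = trc y x"
  by (simp add: trc_def opol_def algebra_simps)
text \<open>\<open>trc (crs x y) z\<close> is the full polarization of the cubic norm, hence
  symmetric in all three arguments.\<close>

lemma trc_crs: "trc (crs x y) z = trc x (crs y z)"
  by (simp add: trc_def crs_def opol_def ocnj_def omul_def algebra_simps)
text \<open>Through this identity \<open>alb_cross_ec\<close> matches the explicit
  \<open>crs\<close> with the cross product of the definitions, which is a difference of
  adjoints.\<close>

lemma shp_add: "shp (x + y) = shp x + crs x y + shp y"
  by (simp add: crs_def shp_def fun_eq_iff all_alb opol_def ocnj_def omul_def algebra_simps split: oct_ix.split)

lemma nxt3 [simp]: "nxt (nxt (nxt i)) = i"
  by (cases i) simp_all

text \<open>The product \<open>conj(cd)\<close> makes the formulas for the adjoint invariant under cyclic permutations.\<close>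

definition otr :: "'a::comm_ring_1 oct \<Rightarrow> 'a oct \<Rightarrow> 'a oct" (infixl "\<bullet>" 72) where
  "c \<bullet> d = ocnj (omul c d)"

lemma otr_add: "(c + d) \<bullet> e = c \<bullet> e + d \<bullet> e" "e \<bullet> (c + d) = e \<bullet> c + e \<bullet> d"
  and otr_diff: "(c - d) \<bullet> e = c \<bullet> e - d \<bullet> e" "e \<bullet> (c - d) = e \<bullet> c - e \<bullet> d"
  and otr_sc: "(r \<cdot> c) \<bullet> e = r \<cdot> (c \<bullet> e)" "e \<bullet> (r \<cdot> c) = r \<cdot> (e \<bullet> c)"
  by (simp_all add: otr_def fun_eq_iff all_oct ocnj_def omul_def algebra_simps)

lemma opol_add: "opol (c + d) e = opol c e + opol d e" "opol e (c + d) = opol e c + opol e d"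
  and opol_diff: "opol (c - d) e = opol c e - opol d e" "opol e (c - d) = opol e c - opol e d"
  and opol_sc: "opol (r \<cdot> c) e = r * opol c e" "opol e (r \<cdot> c) = r * opol e c"
  by (simp_all add: opol_def algebra_simps)

lemma opol_comm: "opol c d = opol d c"
  by (simp add: opol_def algebra_simps)

lemma opol_otr: "opol (c \<bullet> d) e = opol c (d \<bullet> e)"
  by (simp add: opol_def otr_def ocnj_def omul_def algebra_simps)

definition onrm :: "'a::comm_ring_1 oct \<Rightarrow> 'a" where
  "onrm c = c OE * c OF - (c (OU I1) * c (OV I1) + c (OU I2) * c (OV I2) + c (OU I3) * c (OV I3))"

lemma onrm_add: "onrm (c + d) = onrm c + opol c d + onrm d"
  by (simp add: onrm_def opol_def algebra_simps)
text \<open>Together with \<open>opol_otr\<close> these are the laws of a symmetric composition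
  algebra: \<open>\<bullet>\<close> is, up to the order of the factors, the para-octonion product.
  The swap laws linearize the sandwich laws. They allow the adjoint identity to be proved without
  expanding products of octonions.\<close>

lemma otr_swap1: "(c \<bullet> d) \<bullet> e = opol c e \<cdot> d - (e \<bullet> d) \<bullet> c"
  and otr_swap2: "c \<bullet> (d \<bullet> e) = opol c e \<cdot> d - e \<bullet> (d \<bullet> c)"
  and otr_sandwich: "(c \<bullet> d) \<bullet> c = onrm c \<cdot> d" "c \<bullet> (d \<bullet> c) = onrm c \<cdot> d"
  by (simp_all add: fun_eq_iff all_oct all_three onrm_def opol_def otr_def ocnj_def omul_def algebra_simps)

lemma crs_Dg: "crs x y (Dg i) = x (Dg (nxt i)) * y (Dg (nxt (nxt i))) + y (Dg (nxt i)) * x (Dg (nxt (nxt i)))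
        - opol (x \<circ> Of i) (y \<circ> Of i)"
  by (simp add: crs_def)

lemma crs_Of: "crs x y \<circ> Of i = (x \<circ> Of (nxt i)) \<bullet> (y \<circ> Of (nxt (nxt i))) + (y \<circ> Of (nxt i)) \<bullet> (x \<circ> Of (nxt (nxt i)))
    - x (Dg i) \<cdot> (y \<circ> Of i) - y (Dg i) \<cdot> (x \<circ> Of i)"
  by (simp add: crs_def otr_def ocnj_def fun_eq_iff algebra_simps split: oct_ix.split)

lemma shp_Dg: "shp x (Dg i) = x (Dg (nxt i)) * x (Dg (nxt (nxt i))) - onrm (x \<circ> Of i)"
  by (simp add: shp_def onrm_def)

lemma shp_Of: "shp x \<circ> Of i = (x \<circ> Of (nxt i)) \<bullet> (x \<circ> Of (nxt (nxt i))) - x (Dg i) \<cdot> (x \<circ> Of i)"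
  by (simp add: shp_def otr_def ocnj_def fun_eq_iff algebra_simps split: oct_ix.split)

lemma trc_cyc: "trc x y = x (Dg i) * y (Dg i) + x (Dg (nxt i)) * y (Dg (nxt i)) + x (Dg (nxt (nxt i))) * y (Dg (nxt (nxt i)))
     + opol (x \<circ> Of i) (y \<circ> Of i) + opol (x \<circ> Of (nxt i)) (y \<circ> Of (nxt i)) + opol (x \<circ> Of (nxt (nxt i))) (y \<circ> Of (nxt (nxt i)))"
  by (cases i) (simp_all add: trc_def algebra_simps)

section \<open>The cubic norm and the adjoint identity\<close>

definition cnrm :: "'a::comm_ring_1 alb \<Rightarrow> 'a" where
  "cnrm x = x (Dg I1) * x (Dg I2) * x (Dg I3)
     - (x (Dg I1) * onrm (x \<circ> Of I1) + x (Dg I2) * onrm (x \<circ> Of I2) + x (Dg I3) * onrm (x \<circ> Of I3))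
     + opol ((x \<circ> Of I1) \<bullet> (x \<circ> Of I2)) (x \<circ> Of I3)"

lemma cnrm_cyc: "cnrm x = x (Dg i) * x (Dg (nxt i)) * x (Dg (nxt (nxt i)))
     - (x (Dg i) * onrm (x \<circ> Of i) + x (Dg (nxt i)) * onrm (x \<circ> Of (nxt i)) + x (Dg (nxt (nxt i))) * onrm (x \<circ> Of (nxt (nxt i))))
     + opol (x \<circ> Of i) ((x \<circ> Of (nxt i)) \<bullet> (x \<circ> Of (nxt (nxt i))))"
  by (cases i) (simp_all add: cnrm_def algebra_simps opol_otr, metis opol_otr opol_comm, metis opol_otr opol_comm)

text \<open>The adjoint is the gradient of the cubic norm with respect to the trace form.\<close>

lemma cnrm_add: "cnrm (x + y) = cnrm x + trc (shp x) y + trc x (shp y) + cnrm y"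
proof -
  obtain c1 c2 c3 where c: "x \<circ> Of I1 = c1" "x \<circ> Of I2 = c2" "x \<circ> Of I3 = c3" by blast
  obtain d1 d2 d3 where d: "y \<circ> Of I1 = d1" "y \<circ> Of I2 = d2" "y \<circ> Of I3 = d3" by blast
  have s: "(x + y) \<circ> Of i = (x \<circ> Of i) + (y \<circ> Of i)" for i by (simp add: fun_eq_iff)
  have e: "opol (c2 \<bullet> c3) d1 = opol (d1 \<bullet> c2) c3" "opol (c3 \<bullet> c1) d2 = opol (c1 \<bullet> d2) c3" "opol (c1 \<bullet> c2) d3 = opol (c1 \<bullet> c2) d3"
    "opol c1 (d2 \<bullet> d3) = opol (c1 \<bullet> d2) d3" "opol c2 (d3 \<bullet> d1) = opol (d1 \<bullet> c2) d3" "opol c3 (d1 \<bullet> d2) = opol (d1 \<bullet> d2) c3"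
     "opol d1 c1 = opol c1 d1" "opol d2 c2 = opol c2 d2" "opol d3 c3 = opol c3 d3"
    by (metis opol_comm opol_otr)+
  show ?thesis
    by (simp add: trc_def cnrm_def shp_Dg shp_Of s c d otr_add otr_sc opol_add opol_diff opol_sc onrm_add)
      (simp add: e algebra_simps)
qed

lemma opol_otr_rot: "opol c (d \<bullet> e) = opol d (e \<bullet> c)" "opol c (d \<bullet> e) = opol e (c \<bullet> d)"
  by (metis opol_comm opol_otr)+

text \<open>The indices \<open>i\<close>, \<open>j\<close>, \<open>l\<close> are kept cyclic
  throughout, so that one diagonal component here and one octonion component in \<open>adjO\<close>
  cover all three of each kind.\<close>

lemma adjD: "crs x (crs b (shp x)) (Dg i) = cnrm x * b (Dg i) + trc x b * shp x (Dg i)"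
proof -
  define j l where "j = nxt i" and "l = nxt (nxt i)"
  have n: "nxt i = j" "nxt j = l" "nxt l = i" by (simp_all add: j_def l_def)
  obtain c1 c2 c3 where c: "x \<circ> Of i = c1" "x \<circ> Of j = c2" "x \<circ> Of l = c3" by blast
  obtain d1 d2 d3 where d: "b \<circ> Of i = d1" "b \<circ> Of j = d2" "b \<circ> Of l = d3" by blast
  obtain a1 a2 a3 where a: "x (Dg i) = a1" "x (Dg j) = a2" "x (Dg l) = a3" by blast
  obtain b1 b2 b3 where b: "b (Dg i) = b1" "b (Dg j) = b2" "b (Dg l) = b3" by blast
  have e1: "opol c1 (d2 \<bullet> (c1 \<bullet> c2)) = onrm c1 * opol c2 d2"
    by (subst opol_otr [symmetric], subst opol_otr_rot(2)) (simp add: otr_sandwich opol_sc)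
  have e2: "opol c1 ((c3 \<bullet> c1) \<bullet> d3) = onrm c1 * opol c3 d3"
    by (subst opol_otr_rot(2)) (simp add: otr_sandwich opol_sc opol_comm[of d3])
  have e3: "opol c1 (c2 \<bullet> d3) = opol d3 (c1 \<bullet> c2)" "opol c1 (d2 \<bullet> c3) = opol d2 (c3 \<bullet> c1)" "opol c1 d1 = opol d1 c1" "opol c2 d2 = opol d2 c2" "opol c3 d3 = opol d3 c3" "opol c1 c1 = 2 * onrm c1"
    by (metis opol_otr_rot opol_comm, metis opol_otr_rot opol_comm, (metis opol_comm)+, simp add: onrm_def opol_def algebra_simps)
  show ?thesis
    by (simp only: crs_Dg trc_cyc[of _ _ i] cnrm_cyc[of _ i] shp_Dg crs_Of shp_Of n c d a b
       otr_add otr_diff otr_sc opol_add opol_diff opol_sc)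
      (simp add: e1 e2 e3 algebra_simps)
qed

lemma adjO: "crs x (crs b (shp x)) \<circ> Of i = cnrm x \<cdot> (b \<circ> Of i) + trc x b \<cdot> (shp x \<circ> Of i)"
proof -
  define j l where "j = nxt i" and "l = nxt (nxt i)"
  have n: "nxt i = j" "nxt j = l" "nxt l = i" by (simp_all add: j_def l_def)
  obtain c1 c2 c3 where c: "x \<circ> Of i = c1" "x \<circ> Of j = c2" "x \<circ> Of l = c3" by blast
  obtain d1 d2 d3 where d: "b \<circ> Of i = d1" "b \<circ> Of j = d2" "b \<circ> Of l = d3" by blast
  obtain a1 a2 a3 where a: "x (Dg i) = a1" "x (Dg j) = a2" "x (Dg l) = a3" by blast
  obtain b1 b2 b3 where b: "b (Dg i) = b1" "b (Dg j) = b2" "b (Dg l) = b3" by blast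
  have e1: "c2 \<bullet> ((c2 \<bullet> c3) \<bullet> d2) = opol c2 d2 \<cdot> (c2 \<bullet> c3) - onrm c2 \<cdot> (d2 \<bullet> c3)"
    "c2 \<bullet> (c1 \<bullet> d2) = opol c2 d2 \<cdot> c1 - d2 \<bullet> (c1 \<bullet> c2)"
    "(d3 \<bullet> (c2 \<bullet> c3)) \<bullet> c3 = opol c3 d3 \<cdot> (c2 \<bullet> c3) - onrm c3 \<cdot> (c2 \<bullet> d3)"
    "(d3 \<bullet> c1) \<bullet> c3 = opol c3 d3 \<cdot> c1 - (c3 \<bullet> c1) \<bullet> d3"
    "c2 \<bullet> (d1 \<bullet> (c3 \<bullet> c1)) = opol c1 (c2 \<bullet> c3) \<cdot> d1 - (c3 \<bullet> c1) \<bullet> (d1 \<bullet> c2)"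
    subgoal by (subst otr_swap2) (simp add: otr_sandwich otr_sc)
    subgoal by (subst otr_swap2) simp
    subgoal by (subst otr_swap1) (simp add: otr_sandwich otr_sc opol_comm)
    subgoal by (subst otr_swap1) (simp add: opol_comm)
    subgoal by (subst otr_swap2) (metis opol_otr_rot)
    done
  have e2: "((c1 \<bullet> c2) \<bullet> d1) \<bullet> c3 = opol c1 d1 \<cdot> (c2 \<bullet> c3) - (opol d1 (c2 \<bullet> c3) \<cdot> c1 - (c3 \<bullet> c1) \<bullet> (d1 \<bullet> c2))"
    by (subst otr_swap1[of c1], simp only: otr_diff otr_sc, subst otr_swap1[of "d1 \<bullet> c2"])
      (simp only: opol_otr)
  have e3: "opol d1 c1 = opol c1 d1" by (simp add: opol_comm)
  show ?thesis
    by (simp only: crs_Dg trc_cyc[of _ _ i] cnrm_cyc[of _ i] shp_Dg crs_Of shp_Of n c d a b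
       otr_add otr_diff otr_sc opol_add opol_diff opol_sc e1 e2 otr_sandwich)
      (simp add: e3 fun_eq_iff algebra_simps)
qed

lemma adj: "crs x (crs b (shp x)) = cnrm x \<cdot> b + trc x b \<cdot> shp x"
proof -
  have "crs x (crs b (shp x)) (Of i k) = (cnrm x \<cdot> b + trc x b \<cdot> shp x) (Of i k)" for i k
    using fun_cong[OF adjO[of x b i], of k] by simp
  then show ?thesis
    by (auto simp: fun_eq_iff all_alb adjD)
qed

lemma sc_add: "r \<cdot> (x + y) = r \<cdot> x + r \<cdot> y" and add_sc: "(r + s) \<cdot> x = r \<cdot> x + s \<cdot> x"
  and sc_diff: "r \<cdot> (x - y) = r \<cdot> x - r \<cdot> y" and diff_sc: "(r - s) \<cdot> x = r \<cdot> x - s \<cdot> x"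
  and sc_sc: "r \<cdot> s \<cdot> x = (r * s) \<cdot> x"
  and sc_one: "1 \<cdot> x = x" and sc_zero: "0 \<cdot> x = 0" "r \<cdot> (0 :: 'i \<Rightarrow> 'a) = 0"
  and sc_minus: "r \<cdot> (- x) = - (r \<cdot> x)" "(- r) \<cdot> x = - (r \<cdot> x)"
  for x :: "'i \<Rightarrow> 'a::comm_ring_1"
  by (simp_all add: fun_eq_iff algebra_simps)

text \<open>\<open>adj\<close> is homogeneous of degree 3 in \<open>x\<close>, and this is its
  complete linearization. It is the identity behind the commutators with \<open>Dop\<close> and
  behind the relations in \<open>Dop_a23\<close>.\<close>

lemma adj_lin: "crs a (crs b (crs c p)) + crs c (crs b (crs a p)) + crs p (crs b (crs a c))
   = trc a (crs c p) \<cdot> b + trc a b \<cdot> crs c p + trc b p \<cdot> crs a c + trc b c \<cdot> crs a p"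
proof -
  let ?F = "\<lambda>x. crs x (crs b (shp x)) - cnrm x \<cdot> b - trc x b \<cdot> shp x"
  have z: "?F x = 0" for x by (simp add: adj)
  \<comment> \<open>The alternating sum over the nonempty subsets of \<open>a\<close>,
    \<open>c\<close>, \<open>p\<close> isolates the part of the cubic expression \<open>?F\<close>
    that is linear in each of them.\<close>
  have "?F (a + c + p) - ?F (a + c) - ?F (a + p) - ?F (c + p) + ?F a + ?F c + ?F p
     = crs a (crs b (crs c p)) + crs c (crs b (crs a p)) + crs p (crs b (crs a c))
   - (trc a (crs c p) \<cdot> b + trc a b \<cdot> crs c p + trc b p \<cdot> crs a c + trc b c \<cdot> crs a p)"
    by (simp add: shp_add cnrm_add crs_add trc_add sc_add add_sc trc_crs trc_comm[of b])
  then show ?thesis unfolding z by simp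
qed

lemma crs_diff: "crs (x - y) z = crs x z - crs y z" "crs z (x - y) = crs z x - crs z y"
  and crs_minus: "crs (- x) z = - crs x z" "crs z (- x) = - crs z x"
  and crs_0: "crs 0 z = 0" "crs z 0 = 0"
proof -
  have 1: "additive (\<lambda>x. crs x z)" and 2: "additive (crs z)" for z
    by (simp_all add: additive_def crs_add)
  show "crs (x - y) z = crs x z - crs y z" "crs z (x - y) = crs z x - crs z y"
    "crs (- x) z = - crs x z" "crs z (- x) = - crs z x" "crs 0 z = 0" "crs z 0 = 0"
    using additive.diff[OF 1] additive.diff[OF 2] additive.minus[OF 1] additive.minus[OF 2]
      additive.zero[OF 1] additive.zero[OF 2] by auto
qed

lemma trc_diff: "trc (x - y) z = trc x z - trc y z" "trc z (x - y) = trc z x - trc z y"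
  and trc_minus: "trc (- x) z = - trc x z" "trc z (- x) = - trc z x"
  and trc_0: "trc 0 z = 0" "trc z 0 = 0"
proof -
  have 1: "additive (\<lambda>x. trc x z)" and 2: "additive (trc z)" for z
    by (simp_all add: additive_def trc_add)
  show "trc (x - y) z = trc x z - trc y z" "trc z (x - y) = trc z x - trc z y"
    "trc (- x) z = - trc x z" "trc z (- x) = - trc z x" "trc 0 z = 0" "trc z 0 = 0"
    using additive.diff[OF 1] additive.diff[OF 2] additive.minus[OF 1] additive.minus[OF 2]
      additive.zero[OF 1] additive.zero[OF 2] by auto
qed

lemmas lin_simps = crs_add crs_diff crs_sc crs_minus crs_0 trc_add trc_diff trc_sc trc_minus trc_0

section \<open>The Brown algebra and its operators\<close>

definition bmk :: "'a \<Rightarrow> 'a alb \<Rightarrow> 'a alb \<Rightarrow> 'a \<Rightarrow> 'a brown" where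
  "bmk r a b s = (\<lambda>m. case m of R1 \<Rightarrow> r | R2 \<Rightarrow> s | A1 k \<Rightarrow> a k | A2 k \<Rightarrow> b k)"

lemma bmk_simps [simp]: "bmk r a b s R1 = r" "bmk r a b s R2 = s"
  "bmk r a b s (A1 k) = a k" "bmk r a b s (A2 k) = b k"
  "bmk r a b s \<circ> A1 = a" "bmk r a b s \<circ> A2 = b"
  by (simp_all add: bmk_def fun_eq_iff)

lemma all_brown: "(\<forall>i. P i) \<longleftrightarrow> P R1 \<and> P R2 \<and> (\<forall>k. P (A1 k)) \<and> (\<forall>k. P (A2 k))"
  by (metis brown_ix.exhaust)

lemma brown_eqI: "x R1 = y R1 \<Longrightarrow> x \<circ> A1 = y \<circ> A1 \<Longrightarrow> x \<circ> A2 = y \<circ> A2 \<Longrightarrow> x R2 = y R2 \<Longrightarrow> x = y"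
  by (simp add: fun_eq_iff all_brown)

lemma bmk_collapse [simp]: "bmk (x R1) (x \<circ> A1) (x \<circ> A2) (x R2) = x"
  by (rule brown_eqI) simp_all

lemma bmk_cases: obtains r a b s where "x = bmk r a b s"
  by (metis bmk_collapse)

lemma bmk_eq [simp]: "bmk r a b s = bmk r' a' b' s' \<longleftrightarrow> r = r' \<and> a = a' \<and> b = b' \<and> s = s'"
  by (metis bmk_simps(1,2,5,6))

lemma bmk_add: "bmk r a b s + bmk r' a' b' s' = bmk (r + r') (a + a') (b + b') (s + s')"
  and bmk_diff: "bmk r a b s - bmk r' a' b' s' = bmk (r - r') (a - a') (b - b') (s - s')"
  and bmk_minus: "- bmk r a b s = bmk (- r) (- a) (- b) (- s)"
  and bmk_sc: "t \<cdot> bmk r a b s = bmk (t * r) (t \<cdot> a) (t \<cdot> b) (t * s)"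
  and bmk_0: "0 = bmk 0 0 0 0"
  for r :: "'a::comm_ring_1"
  by (simp_all add: fun_eq_iff all_brown)

lemma star_bmk: "star (bmk r a b s) = bmk s a b r"
  by (simp add: star_def fun_eq_iff all_brown)

definition bml :: "'a::comm_ring_1 brown \<Rightarrow> 'a brown \<Rightarrow> 'a brown" where
  "bml x y = bmk (x R1 * y R1 + trc (x \<circ> A1) (y \<circ> A2))
     (x R1 \<cdot> (y \<circ> A1) + y R2 \<cdot> (x \<circ> A1) + crs (x \<circ> A2) (y \<circ> A2))
     (x R2 \<cdot> (y \<circ> A2) + y R1 \<cdot> (x \<circ> A2) + crs (x \<circ> A1) (y \<circ> A1))
     (x R2 * y R2 + trc (x \<circ> A2) (y \<circ> A1))"

lemma bml_bmk: "bml (bmk r a b s) (bmk r' a' b' s') =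
    bmk (r * r' + trc a b') (r \<cdot> a' + s' \<cdot> a + crs b b') (s \<cdot> b' + r' \<cdot> b + crs a a') (s * s' + trc b a')"
  by (simp add: bml_def)

definition Vq :: "'a::comm_ring_1 brown \<Rightarrow> 'a brown \<Rightarrow> 'a brown \<Rightarrow> 'a brown" where
  "Vq x y z = bml (bml x (star y)) z + bml (bml z (star y)) x - bml (bml z (star x)) y"

definition osc :: "'a::comm_ring_1 \<Rightarrow> ('b \<Rightarrow> 'i \<Rightarrow> 'a) \<Rightarrow> 'b \<Rightarrow> 'i \<Rightarrow> 'a" where
  "osc r f = (\<lambda>z. r \<cdot> f z)"

lemma osc_apply [simp]: "osc r f z = r \<cdot> f z" by (simp add: osc_def)

text \<open>Every \<open>V\<^sub>x\<^sub>,\<^sub>y\<close> is a combination of these operators and the identity (lemma \<open>Vq_bmk\<close>); identities on \<open>L\<^sub>0\<close> are checked on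
  them.\<close>

definition Phi :: "'a::comm_ring_1 alb \<Rightarrow> 'a brown \<Rightarrow> 'a brown" where
  "Phi c z = bmk (trc c (z \<circ> A2)) (z R2 \<cdot> c) (crs c (z \<circ> A1)) 0"
definition Psi :: "'a::comm_ring_1 alb \<Rightarrow> 'a brown \<Rightarrow> 'a brown" where
  "Psi c z = bmk 0 (crs c (z \<circ> A2)) (z R1 \<cdot> c) (trc c (z \<circ> A1))"
definition Dop :: "'a::comm_ring_1 alb \<Rightarrow> 'a alb \<Rightarrow> 'a brown \<Rightarrow> 'a brown" where
  "Dop a b z = bmk 0 (trc a b \<cdot> (z \<circ> A1) + trc b (z \<circ> A1) \<cdot> a - crs b (crs a (z \<circ> A1)))
     (crs a (crs b (z \<circ> A2)) - trc a (z \<circ> A2) \<cdot> b) (trc a b * z R2)"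
definition Gop :: "'a::comm_ring_1 brown \<Rightarrow> 'a brown" where
  "Gop z = bmk (2 * z R1) 0 (z \<circ> A2) (- z R2)"

lemma ops_bmk:
  "Phi c (bmk r a b s) = bmk (trc c b) (s \<cdot> c) (crs c a) 0"
  "Psi c (bmk r a b s) = bmk 0 (crs c b) (r \<cdot> c) (trc c a)"
  "Dop u v (bmk r a b s) = bmk 0 (trc u v \<cdot> a + trc v a \<cdot> u - crs v (crs u a))
     (crs u (crs v b) - trc u b \<cdot> v) (trc u v * s)"
  "Gop (bmk r a b s) = bmk (2 * r) 0 b (- s)"
  by (simp_all add: Phi_def Psi_def Dop_def Gop_def)

lemma Vq_bmk: "Vq (bmk (r :: 'a::comm_ring_1) a b s) (bmk r' a' b' s') =
   osc (r * s' - s * r') Gop + osc (s * r' + trc b a') id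
   + Phi (r \<cdot> a' + r' \<cdot> a + crs b b') + Psi (s \<cdot> b' + s' \<cdot> b + crs a a') + Dop a b' - Dop a' b"
proof (rule ext)
  fix z :: "'a brown"
  obtain t p q u where z: "z = bmk t p q u" by (rule bmk_cases)
  show "Vq (bmk r a b s) (bmk r' a' b' s') z = (osc (r * s' - s * r') Gop + osc (s * r' + trc b a') id
   + Phi (r \<cdot> a' + r' \<cdot> a + crs b b') + Psi (s \<cdot> b' + s' \<cdot> b + crs a a') + Dop a b' - Dop a' b) z"
    by (simp add: z Vq_def star_bmk bml_bmk ops_bmk bmk_add bmk_diff bmk_sc lin_simps
       sc_add sc_diff add_sc diff_sc sc_sc trc_crs)
      (simp add: fun_eq_iff crs_comm trc_comm algebra_simps)
qed

lemma osc_add: "osc r (f + g) = osc r f + osc r g" and add_osc: "osc (r + s) f = osc r f + osc s f"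
  and osc_diff: "osc r (f - g) = osc r f - osc r g" and diff_osc: "osc (r - s) f = osc r f - osc s f"
  and osc_osc: "osc r (osc s f) = osc (r * s) f" and osc_minus: "osc (- r) f = - osc r f" "osc r (- f) = - osc r f"
  and osc_0: "osc 0 f = 0" "osc r 0 = 0" and osc_1: "osc 1 f = f"
  for f :: "'b \<Rightarrow> 'i \<Rightarrow> 'a::comm_ring_1"
  by (simp_all add: fun_eq_iff algebra_simps)

definition blin :: "('a::comm_ring_1 brown \<Rightarrow> 'a brown) \<Rightarrow> bool" where
  "blin f \<longleftrightarrow> (\<forall>x y. f (x + y) = f x + f y) \<and> (\<forall>r x. f (r \<cdot> x) = r \<cdot> f x)"

lemma blinD: assumes "blin f"
  shows "f (x + y) = f x + f y" "f (r \<cdot> x) = r \<cdot> f x" "f (x - y) = f x - f y" "f (- x) = - f x" "f 0 = 0"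
proof -
  have a: "additive f" using assms by (simp add: blin_def additive_def)
  show "f (x + y) = f x + f y" "f (r \<cdot> x) = r \<cdot> f x" using assms by (simp_all add: blin_def)
  show "f (x - y) = f x - f y" "f (- x) = - f x" "f 0 = 0"
    using additive.diff[OF a] additive.minus[OF a] additive.zero[OF a] by auto
qed

lemma comp_add: "(x + y) \<circ> A = (x \<circ> A) + (y \<circ> A)" and comp_sc: "(r \<cdot> x) \<circ> A = r \<cdot> (x \<circ> A)"
  for x :: "'i \<Rightarrow> 'a::comm_ring_1"
  by (simp_all add: fun_eq_iff)

lemma blin_ops:
  "blin (Phi c)" "blin (Psi c)" "blin (Dop a b)" "blin Gop" "blin id" "blin 0"
  by (simp_all add: blin_def Phi_def Psi_def Dop_def Gop_def comp_add comp_sc lin_simps bmk_add bmk_sc,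
    simp_all add: fun_eq_iff algebra_simps)

lemma blin_add: "blin f \<Longrightarrow> blin g \<Longrightarrow> blin (f + g)"
  and blin_diff: "blin f \<Longrightarrow> blin g \<Longrightarrow> blin (f - g)"
  and blin_minus: "blin f \<Longrightarrow> blin (- f)"
  and blin_osc: "blin f \<Longrightarrow> blin (osc r f)"
  and blin_comp: "blin f \<Longrightarrow> blin g \<Longrightarrow> blin (f \<circ> g)"
  by (simp_all add: blin_def sc_add sc_diff sc_sc sc_minus mult.commute)

lemmas fun_applies = zero_fun_apply plus_fun_apply minus_apply uminus_apply sc_apply osc_apply

text \<open>Induction leaves function-valued terms eta-expanded, so the pointwise rules have to be
  kept away from them.\<close>

definition L0T :: "('a::comm_ring_1 brown \<Rightarrow> 'a brown) set" where
  "L0T = range (\<lambda>xs. \<Sum>p\<leftarrow>xs. Vq (fst p) (snd p))"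

lemma L0T_0: "0 \<in> L0T"
  unfolding L0T_def by (rule range_eqI[of _ _ "[]"]) simp

lemma L0T_Vq: "f \<in> L0T \<Longrightarrow> Vq x y + f \<in> L0T"
  unfolding L0T_def by (auto intro: range_eqI[of _ _ "(x, y) # _"])

lemma L0T_induct [consumes 1, case_names zero Vq]:
  assumes "f \<in> L0T" "P 0" "\<And>x y f. f \<in> L0T \<Longrightarrow> P f \<Longrightarrow> P (Vq x y + f)"
  shows "P f"
proof -
  have "P (\<Sum>p\<leftarrow>xs. Vq (fst p) (snd p))" for xs
    by (rule list.induct[of _ xs]) (auto intro: assms simp: L0T_def simp del: fun_applies)
  then show ?thesis using assms(1) by (auto simp: L0T_def)
qed

lemma Vq_L0T: "Vq x y \<in> L0T"
  using L0T_Vq[OF L0T_0, of x y] by simp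

lemma L0T_add: "f \<in> L0T \<Longrightarrow> g \<in> L0T \<Longrightarrow> f + g \<in> L0T"
  by (erule L0T_induct) (auto simp del: fun_applies simp: add.assoc intro: L0T_0 L0T_Vq)

lemma star_add: "star (x + y) = star x + star y" and star_sc: "star (r \<cdot> x) = r \<cdot> star x"
  for x :: "'a::comm_ring_1 brown"
  by (simp_all add: fun_eq_iff all_brown star_def)

lemma bml_add: "bml (x + y) z = bml x z + bml y z" "bml z (x + y) = bml z x + bml z y"
  and bml_sc: "bml (r \<cdot> x) z = r \<cdot> bml x z" "bml z (r \<cdot> x) = r \<cdot> bml z x"
  by (simp_all add: bml_def comp_add comp_sc lin_simps bmk_add bmk_sc, simp_all add: fun_eq_iff algebra_simps)

lemma Vq_add: "Vq (x + y) z = Vq x z + Vq y z" "Vq z (x + y) = Vq z x + Vq z y"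
  and Vq_sc: "Vq (r \<cdot> x) z = osc r (Vq x z)" "Vq z (r \<cdot> x) = osc r (Vq z x)"
  by (simp_all add: Vq_def star_add star_sc bml_add bml_sc fun_eq_iff[of "Vq _ _"] fun_eq_iff[of "osc _ _"] sc_add sc_diff)

lemma Vq_blin: "blin (Vq x y)"
  by (simp add: blin_def Vq_def bml_add bml_sc sc_add sc_diff)

lemma Vq_diff: "Vq (x - y) z = Vq x z - Vq y z" "Vq z (x - y) = Vq z x - Vq z y"
  and Vq_minus: "Vq (- x) z = - Vq x z" "Vq z (- x) = - Vq z x"
  and Vq_0: "Vq 0 z = 0" "Vq z 0 = 0"
proof -
  have 1: "additive (\<lambda>x. Vq x z)" and 2: "additive (Vq z)" for z
    by (simp_all add: additive_def Vq_add)
  show "Vq (x - y) z = Vq x z - Vq y z" "Vq z (x - y) = Vq z x - Vq z y"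
    "Vq (- x) z = - Vq x z" "Vq z (- x) = - Vq z x" "Vq 0 z = 0" "Vq z 0 = 0"
    using additive.diff[OF 1] additive.diff[OF 2] additive.minus[OF 1] additive.minus[OF 2]
      additive.zero[OF 1] additive.zero[OF 2] by auto
qed

lemma L0T_blin: "f \<in> L0T \<Longrightarrow> blin f"
  by (erule L0T_induct) (auto simp del: fun_applies intro: blin_ops blin_add Vq_blin)

text \<open>Scalars are absorbed by the first argument of \<open>Vq\<close>, so plain finite sums
  already form a submodule.\<close>

lemma L0T_osc: "f \<in> L0T \<Longrightarrow> osc r f \<in> L0T"
  by (erule L0T_induct) (auto simp del: fun_applies simp: osc_0 osc_add Vq_sc(1)[symmetric] intro: L0T_0 L0T_Vq)

lemma L0T_minus: "f \<in> L0T \<Longrightarrow> - f \<in> L0T"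
  using L0T_osc[of f "- 1"] by (simp add: osc_minus osc_1)

lemma L0T_diff: "f \<in> L0T \<Longrightarrow> g \<in> L0T \<Longrightarrow> f - g \<in> L0T"
  using L0T_add[OF _ L0T_minus, of f g] by simp

lemma ops_0: "Phi 0 = 0" "Psi 0 = 0" "Dop 0 a = 0" "Dop a 0 = 0"
  by (simp_all add: Phi_def Psi_def Dop_def fun_eq_iff all_brown lin_simps)

lemma ops_add: "Phi (a + b) = Phi a + Phi b" "Psi (a + b) = Psi a + Psi b"
    "Dop (a + b) c = Dop a c + Dop b c" "Dop c (a + b) = Dop c a + Dop c b"
  and ops_sc: "Phi (r \<cdot> a) = osc r (Phi a)" "Psi (r \<cdot> a) = osc r (Psi a)"
    "Dop (r \<cdot> a) c = osc r (Dop a c)" "Dop c (r \<cdot> a) = osc r (Dop c a)"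
  by (simp_all add: Phi_def Psi_def Dop_def fun_eq_iff all_brown lin_simps algebra_simps)

lemma ops_minus: "Phi (- a) = - Phi a" "Psi (- a) = - Psi a" "Dop (- a) c = - Dop a c" "Dop c (- a) = - Dop c a"
  by (simp_all add: Phi_def Psi_def Dop_def fun_eq_iff all_brown lin_simps algebra_simps)

lemma Vq_gen:
  "Phi c = Vq (bmk 1 0 0 0) (bmk 0 c 0 0)"
  "Phi c = Vq (bmk 0 c 0 0) (bmk 1 0 0 0)"
  "Psi c = Vq (bmk 0 0 0 1) (bmk 0 0 c 0)"
  "Dop a b = Vq (bmk 0 a 0 0) (bmk 0 0 b 0)"
  "Gop = Vq (bmk 1 0 0 0) (bmk 0 0 0 1)"
  "id = Vq (bmk 1 0 0 0) (bmk 0 0 0 1) + Vq (bmk 0 0 0 1) (bmk 1 0 0 0)"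
  by (simp_all add: Vq_bmk lin_simps osc_0 osc_1 osc_minus ops_0 sc_one sc_zero)

lemma ops_L0T: "Phi c \<in> L0T" "Psi c \<in> L0T" "Dop a b \<in> L0T" "Gop \<in> L0T" "id \<in> L0T"
  unfolding Vq_gen by (intro L0T_add Vq_L0T)+

text \<open>Since \<open>Vq_bmk\<close> writes every \<open>Vq x y\<close> as a sum of members of
  five families, an additive property need only be tested on these. Scalar factors appear at
  \<open>Gop\<close> and \<open>id\<close> because the other families absorb them in their
  arguments.\<close>

lemma L0T_gen [consumes 1, case_names add Gop id Phi Psi Dop]:
  assumes f: "f \<in> L0T" and P_add: "\<And>f g. f \<in> L0T \<Longrightarrow> g \<in> L0T \<Longrightarrow> P f \<Longrightarrow> P g \<Longrightarrow> P (f + g)"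
    and g: "\<And>r. P (osc r Gop)" "\<And>r. P (osc r id)" "\<And>c. P (Phi c)" "\<And>c. P (Psi c)" "\<And>a b. P (Dop a b)"
  shows "P f"
  using f
proof (rule L0T_induct)
  show "P 0" using g(3)[of 0] by (simp add: ops_0)
next
  fix x y :: "'a brown" and f assume Vq: "f \<in> L0T" "P f"
  obtain r a b s where x: "x = bmk r a b s" by (rule bmk_cases)
  obtain r' a' b' s' where y: "y = bmk r' a' b' s'" by (rule bmk_cases)
  have "P (Vq x y)"
    unfolding x y Vq_bmk diff_conv_add_uminus[of _ "Dop _ _"] ops_minus(3)[symmetric]
    by (intro P_add g L0T_add ops_L0T L0T_osc)
  then show "P (Vq x y + f)" using Vq by (intro P_add Vq_L0T)
qed

text \<open>Left multiplication by \<open>j\<close>, see \<open>bml_jb\<close>.\<close>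

definition jm :: "'a::comm_ring_1 brown \<Rightarrow> 'a brown" where
  "jm z = bmk (z R1) (z \<circ> A1) (- (z \<circ> A2)) (- z R2)"

lemma jm_bmk: "jm (bmk r a b s) = bmk r a (- b) (- s)"
  by (simp add: jm_def)

lemma jm_jm [simp]: "jm (jm z) = z"
  by (rule brown_eqI) (simp_all add: jm_def)

lemma blin_jm: "blin jm"
  by (simp add: blin_def jm_def fun_eq_iff all_brown)

lemmas jm_lin = blinD[OF blin_jm]

text \<open>An operator \<open>f \<in> L\<^sub>0\<close> acts on \<open>L\<^sub>2\<close> as the scalar \<open>lam f\<close> and on \<open>L\<^sub>-\<^sub>1\<close> as \<open>eps f\<close>.\<close>

definition lam :: "('a::comm_ring_1 brown \<Rightarrow> 'a brown) \<Rightarrow> 'a" where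
  "lam f = f (bmk 1 0 0 0) R1 + f (bmk 0 0 0 1) R2"

definition eps :: "('a::comm_ring_1 brown \<Rightarrow> 'a brown) \<Rightarrow> 'a brown \<Rightarrow> 'a brown" where
  "eps f z = jm (f (jm z)) - lam f \<cdot> z"

lemma lam_lin: "lam (f + g) = lam f + lam g" "lam (f - g) = lam f - lam g" "lam (- f) = - lam f"
   "lam (osc r f) = r * lam f" "lam 0 = 0"
  by (simp_all add: lam_def algebra_simps)

lemma eps_lin: "eps (f + g) = eps f + eps g" "eps (f - g) = eps f - eps g" "eps (- f) = - eps f"
   "eps (osc r f) = osc r (eps f)" "eps 0 = 0"
  by (auto simp: eps_def fun_eq_iff[of "eps _"] lam_lin jm_lin add_sc diff_sc sc_diff sc_sc sc_minus sc_zero)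

lemma lam_ops: "lam (Phi c) = 0" "lam (Psi c) = 0" "lam (Dop a b) = trc a b" "lam Gop = 1" "lam id = 2"
  by (simp_all add: lam_def ops_bmk lin_simps)

lemma eps_ops: "eps (Phi c) = - Phi c" "eps (Psi c) = - Psi c" "eps (Dop a b) = Dop a b - osc (trc a b) id"
  "eps Gop = Gop - id" "eps id = - id"
  by (simp_all add: fun_eq_iff[of "eps _"] eps_def lam_ops, simp_all add: jm_def Phi_def Psi_def Dop_def Gop_def
     fun_eq_iff all_brown lin_simps)

lemma lam_Vq: "lam (Vq x y) = x R1 * y R2 + x R2 * y R1 + trc (x \<circ> A1) (y \<circ> A2) + trc (x \<circ> A2) (y \<circ> A1)"
proof -
  obtain r a b s where x: "x = bmk r a b s" by (rule bmk_cases)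
  obtain r' a' b' s' where y: "y = bmk r' a' b' s'" by (rule bmk_cases)
  show ?thesis unfolding x y Vq_bmk by (simp add: lam_lin lam_ops algebra_simps trc_comm)
qed

text \<open>The construction prescribes the action of degree 0 on the other degrees only for the
  operators V, in terms of \<open>x\<close> and \<open>y\<close>. This lemma, and
  \<open>lam_jb\<close> in degree 2, identify it with \<open>eps\<close> and \<open>lam\<close>,
  which depend on the operator alone; so the action is well defined on sums.\<close>

lemma eps_Vq: "eps (Vq x y) = - Vq y x"
proof -
  obtain r a b s where x: "x = bmk r a b s" by (rule bmk_cases)
  obtain r' a' b' s' where y: "y = bmk r' a' b' s'" by (rule bmk_cases)
  show ?thesis unfolding x y Vq_bmk eps_lin eps_ops
    by (simp add: fun_eq_iff trc_comm crs_comm algebra_simps)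
qed

lemma eps_L0T: "f \<in> L0T \<Longrightarrow> eps f \<in> L0T"
  by (erule L0T_induct) (auto simp del: fun_applies simp: eps_lin eps_Vq intro: L0T_0 L0T_diff Vq_L0T)

section \<open>Commutators and the closure of the degree 0 part\<close>

definition cmt :: "('a::comm_ring_1 brown \<Rightarrow> 'a brown) \<Rightarrow> ('a brown \<Rightarrow> 'a brown) \<Rightarrow> 'a brown \<Rightarrow> 'a brown" where
  "cmt f g = (f \<circ> g) - (g \<circ> f)"

lemma cmt_apply: "cmt f g z = f (g z) - g (f z)"
  by (simp add: cmt_def)

lemma cmt_swap: "cmt f g = - cmt g f"
  by (simp add: cmt_def)

lemma cmt_add: "blin f \<Longrightarrow> cmt f (g + h) = cmt f g + cmt f h" "blin f \<Longrightarrow> cmt (g + h) f = cmt g f + cmt h f"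
  and cmt_diff: "blin f \<Longrightarrow> cmt f (g - h) = cmt f g - cmt f h" "blin f \<Longrightarrow> cmt (g - h) f = cmt g f - cmt h f"
  and cmt_osc: "blin f \<Longrightarrow> cmt f (osc r g) = osc r (cmt f g)" "blin f \<Longrightarrow> cmt (osc r g) f = osc r (cmt g f)"
  and cmt_minus: "blin f \<Longrightarrow> cmt f (- g) = - cmt f g" "blin f \<Longrightarrow> cmt (- g) f = - cmt g f"
  by (simp_all add: fun_eq_iff cmt_apply blinD algebra_simps)

lemma cmt_jacobi: "blin f \<Longrightarrow> blin g \<Longrightarrow> blin h \<Longrightarrow> cmt f (cmt g h) = cmt (cmt f g) h + cmt g (cmt f h)"
  by (simp add: fun_eq_iff cmt_apply blinD algebra_simps)

lemma cmt_id: "blin f \<Longrightarrow> cmt f id = 0" "blin f \<Longrightarrow> cmt id f = 0"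
  by (simp_all add: fun_eq_iff[of "cmt _ _"] cmt_apply)

text \<open>\<open>cmt Gop\<close> assigns degree 1 to \<open>Phi\<close>, -1 to \<open>Psi\<close>
  and 0 to \<open>Dop\<close>. This is the three-grading of a Lie algebra of type E7 (with a centre
  spanned by \<open>id\<close>) whose outer parts are two copies of the Albert algebra.\<close>

lemma cmt_ops:
  "cmt Gop (Phi c) = Phi c" "cmt Gop (Psi c) = - Psi c" "cmt Gop (Dop a b) = 0"
  "cmt (Phi a) (Phi b) = 0" "cmt (Psi a) (Psi b) = 0"
  "cmt (Phi a) (Psi b) = Dop a b - osc (trc a b) id + osc (trc a b) Gop"
proof -
  note d = fun_eq_iff[of "cmt _ _"] cmt_apply Phi_def Psi_def Dop_def Gop_def bmk_diff
  show "cmt Gop (Phi c) = Phi c" "cmt Gop (Psi c) = - Psi c" "cmt Gop (Dop a b) = 0"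
    by (simp_all add: d fun_eq_iff lin_simps all_brown)
  show "cmt (Phi a) (Phi b) = 0" "cmt (Psi a) (Psi b) = 0"
    by (simp_all add: d lin_simps bmk_0 sc_zero) (simp_all add: crs_comm trc_crs[symmetric])
  show "cmt (Phi a) (Psi b) = Dop a b - osc (trc a b) id + osc (trc a b) Gop"
    by (simp add: d lin_simps fun_eq_iff all_brown) (simp add: algebra_simps trc_comm)
qed

lemma cmt_ops':
  "cmt (Phi c) Gop = - Phi c" "cmt (Psi c) Gop = Psi c" "cmt (Dop a b) Gop = 0" "cmt Gop Gop = 0"
  "cmt (Psi b) (Phi a) = osc (trc a b) id - Dop a b - osc (trc a b) Gop"
  using cmt_ops[of c] cmt_ops(3)[of a b] cmt_ops(6)[of a b]
  by (simp_all add: cmt_swap[of "Phi c" Gop] cmt_swap[of "Psi c" Gop] cmt_swap[of "Dop a b" Gop]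
     cmt_swap[of "Psi b" "Phi a"]) (simp add: cmt_def)

text \<open>The linearized adjoint identity is solved for the term that applies \<open>c\<close>,
  \<open>b\<close>, \<open>a\<close> to \<open>p\<close> in turn; the remaining terms match by
  symmetry of the cubic form.\<close>

lemma cmt_Dop:
  "cmt (Dop a b) (Phi c) = Phi (trc b c \<cdot> a - crs b (crs a c))"
  "cmt (Dop a b) (Psi c) = Psi (crs a (crs b c) - trc a c \<cdot> b)"
proof -
  have e: "crs a (crs b (crs c p)) = trc a (crs c p) \<cdot> b + trc a b \<cdot> crs c p + trc b p \<cdot> crs a c + trc b c \<cdot> crs a p
    - (crs c (crs b (crs a p)) + crs p (crs b (crs a c)))" for a b c p
    using adj_lin[of a b c p] by (simp add: algebra_simps)
  have t: "trc c (crs a (crs b q)) = trc (crs b (crs a c)) q" for a b q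
    by (metis trc_crs crs_comm)
  have c: "crs p (crs b (crs a c)) = crs (crs b (crs a c)) p" for a b p
    by (rule crs_comm)
  show "cmt (Dop a b) (Phi c) = Phi (trc b c \<cdot> a - crs b (crs a c))"
    by (simp add: fun_eq_iff[of "cmt _ _"] cmt_apply Phi_def Dop_def bmk_diff lin_simps e[of a b c])
      (simp add: fun_eq_iff t c crs_comm[of c a] crs_comm[of c b] trc_comm[of c a] trc_comm[of c b] trc_comm[of b a] algebra_simps)
  show "cmt (Dop a b) (Psi c) = Psi (crs a (crs b c) - trc a c \<cdot> b)"
    by (simp add: fun_eq_iff[of "cmt _ _"] cmt_apply Psi_def Dop_def bmk_diff lin_simps e[of b a c])
      (simp add: fun_eq_iff t c crs_comm[of c a] crs_comm[of c b] trc_comm[of c a] trc_comm[of c b] trc_comm[of b a] algebra_simps)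
qed

text \<open>Brackets with \<open>Phi\<close>, \<open>Psi\<close> and \<open>Gop\<close> are read off
  on generators. A \<open>Dop\<close> is, up to multiples of \<open>id\<close> and
  \<open>Gop\<close>, the commutator of a \<open>Phi\<close> and a \<open>Psi\<close>, so brackets
  with it follow from the Jacobi identity.\<close>

lemma cmt_L0T: "f \<in> L0T \<Longrightarrow> g \<in> L0T \<Longrightarrow> cmt f g \<in> L0T"
proof -
  note bl = blin_ops L0T_blin
  note cl = L0T_add L0T_diff L0T_minus L0T_osc ops_L0T L0T_0
  have Phi: "cmt g (Phi c) \<in> L0T" if "g \<in> L0T" for g and c :: "'a alb"
    using that by (rule L0T_gen)
      (auto simp del: fun_applies simp: bl cmt_add cmt_osc cmt_id cmt_ops cmt_ops' cmt_Dop intro!: cl)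
  have Psi: "cmt g (Psi c) \<in> L0T" if "g \<in> L0T" for g and c :: "'a alb"
    using that by (rule L0T_gen)
      (auto simp del: fun_applies simp: bl cmt_add cmt_osc cmt_id cmt_ops cmt_ops' cmt_Dop intro!: cl)
  have Gop: "cmt g Gop \<in> L0T" if "g \<in> L0T" for g :: "'a brown \<Rightarrow> 'a brown"
    using that by (rule L0T_gen)
      (auto simp del: fun_applies simp: bl cmt_add cmt_osc cmt_id cmt_ops' osc_0 intro!: cl)
  have Dop: "cmt g (Dop c d) \<in> L0T" if "g \<in> L0T" for g and c d :: "'a alb"
  proof -
    have 1: "Dop c d = cmt (Phi c) (Psi d) + (osc (trc c d) id - osc (trc c d) Gop)"
      by (simp add: cmt_ops)
    have "cmt (cmt g (Phi c)) (Psi d) \<in> L0T" by (intro Psi Phi that)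
    moreover have "cmt (cmt g (Psi d)) (Phi c) \<in> L0T" by (intro Psi Phi that)
    ultimately show ?thesis using that Gop[OF that]
      unfolding 1 by (auto simp del: fun_applies simp: bl cmt_add cmt_diff cmt_osc cmt_id cmt_jacobi
        cmt_swap[of "Phi c" "cmt g (Psi d)"] intro!: cl)
  qed
  show "g \<in> L0T \<Longrightarrow> cmt f g \<in> L0T" if "f \<in> L0T"
    by (erule L0T_gen) (auto simp del: fun_applies simp: bl that cmt_add cmt_osc cmt_id osc_0 intro!: cl Phi Psi Gop Dop)
qed

section \<open>The Lie algebra\<close>

text \<open>The tuple \<open>(a, x, f, y, b)\<close> stands for \<open>aj + x + f + y + bj\<close> with the summands in degrees \<open>-2, \<dots>, 2\<close>.\<close>

type_synonym 'a lie = "'a \<times> 'a brown \<times> ('a brown \<Rightarrow> 'a brown) \<times> 'a brown \<times> 'a"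

text \<open>The coefficient of \<open>j\<close> in the bracket of two elements of degree 1, see
  \<open>psi_jb\<close>: the invariant alternating form on the 56-dimensional module.\<close>

definition psi :: "'a::comm_ring_1 brown \<Rightarrow> 'a brown \<Rightarrow> 'a" where
  "psi x y = x R1 * y R2 - x R2 * y R1 + trc (x \<circ> A1) (y \<circ> A2) - trc (x \<circ> A2) (y \<circ> A1)"

text \<open>The middle entry may be any function, while the rules for \<open>cmt\<close> require
  linear ones; this is why bilinearity is stated on \<open>LT\<close> only.\<close>

fun lbr :: "'a::comm_ring_1 lie \<Rightarrow> 'a lie \<Rightarrow> 'a lie" where
  "lbr (a, x, f, y, b) (a', x', f', y', b') =
    (lam (eps f) * a' - lam (eps f') * a + psi x x',
     eps f x' - eps f' x + a \<cdot> jm y' - a' \<cdot> jm y,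
     cmt f f' + Vq y x' - Vq y' x + osc (b * a' - b' * a) id,
     f y' - f' y + b \<cdot> jm x' - b' \<cdot> jm x,
     lam f * b' - lam f' * b + psi y y')"

fun lsc :: "'a::comm_ring_1 \<Rightarrow> 'a lie \<Rightarrow> 'a lie" where
  "lsc r (a, x, f, y, b) = (r * a, r \<cdot> x, osc r f, r \<cdot> y, r * b)"

definition LT :: "'a::comm_ring_1 lie set" where
  "LT = {(a, x, f, y, b) | a x f y b. f \<in> L0T}"

lemma LT_iff [simp]: "(a, x, f, y, b) \<in> LT \<longleftrightarrow> f \<in> L0T"
  by (simp add: LT_def)

lemma psi_lin: "psi (x + y) z = psi x z + psi y z" "psi z (x + y) = psi z x + psi z y"
   "psi (r \<cdot> x) z = r * psi x z" "psi z (r \<cdot> x) = r * psi z x" "psi 0 z = 0" "psi z 0 = 0"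
  by (simp_all add: psi_def comp_add comp_sc lin_simps algebra_simps)
     (simp_all add: trc_def opol_def)

lemma psi_anti: "psi x y = - psi y x"
  by (simp add: psi_def trc_comm algebra_simps)

lemma L0T_eps_blin: "f \<in> L0T \<Longrightarrow> blin (eps f)"
  by (intro L0T_blin eps_L0T)

lemma LT_add: "p \<in> LT \<Longrightarrow> q \<in> LT \<Longrightarrow> p + q \<in> LT" and LT_lsc: "p \<in> LT \<Longrightarrow> lsc r p \<in> LT"
  and LT_minus: "p \<in> LT \<Longrightarrow> - p \<in> LT" and LT_0: "0 \<in> LT" and LT_lbr: "p \<in> LT \<Longrightarrow> q \<in> LT \<Longrightarrow> lbr p q \<in> LT"
  by (auto simp: LT_def zero_prod_def intro!: L0T_add L0T_diff L0T_osc L0T_minus L0T_0 cmt_L0T Vq_L0T ops_L0T)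

lemma lbr_anti: "lbr p q = - lbr q p"
proof (cases p; cases q)
  fix a x f y b and a' x' f' y' b' assume p: "p = (a, x, f, y, b)" and q: "q = (a', x', f', y', b')"
  show ?thesis
    by (simp add: p q cmt_swap[of f f'] psi_anti[of x x'] psi_anti[of y y'])
      (simp add: fun_eq_iff algebra_simps)
qed

lemma lbr_add: "p \<in> LT \<Longrightarrow> p' \<in> LT \<Longrightarrow> q \<in> LT \<Longrightarrow> lbr (p + p') q = lbr p q + lbr p' q"
  by (cases p; cases p'; cases q)
    (simp add: lam_lin eps_lin psi_lin cmt_add L0T_blin blinD L0T_eps_blin jm_lin Vq_add add_osc diff_osc algebra_simps
      sc_add add_sc sc_diff diff_sc, simp add: fun_eq_iff)

lemma lbr_lsc: "p \<in> LT \<Longrightarrow> q \<in> LT \<Longrightarrow> lbr (lsc r p) q = lsc r (lbr p q)"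
  by (cases p; cases q)
    (simp add: lam_lin eps_lin psi_lin cmt_osc L0T_blin blinD L0T_eps_blin jm_lin Vq_sc, simp add: fun_eq_iff algebra_simps)

lemma lsc_add: "lsc r (p + q) = lsc r p + lsc r q"
  by (cases p; cases q) (simp add: fun_eq_iff algebra_simps)

lemma lsc_1: "lsc 1 p = p"
  by (cases p) (simp add: fun_eq_iff algebra_simps)

lemma lsc_minus: "lsc (- r) p = - lsc r p"
  by (cases p) (simp add: fun_eq_iff algebra_simps)

lemma lsc_minus2: "lsc r (- p) = - lsc r p"
  by (cases p) (simp add: fun_eq_iff algebra_simps)

lemma lbr_add2: "p \<in> LT \<Longrightarrow> p' \<in> LT \<Longrightarrow> q \<in> LT \<Longrightarrow> lbr q (p + p') = lbr q p + lbr q p'"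
  using lbr_add[of p p' q] by (simp add: lbr_anti[of q])

lemma lbr_lsc2: "p \<in> LT \<Longrightarrow> q \<in> LT \<Longrightarrow> lbr q (lsc r p) = lsc r (lbr q p)"
  using lbr_lsc[of p q r] by (simp add: lbr_anti[of q] lsc_minus2)


section \<open>Copies of a ring inside the universe\<close>

text \<open>Negation and subtraction in a record are inverses in its additive monoid, hence only
  indirectly given. They are computed here once for all carriers that are images of an additively
  closed set under an additive coding \<open>E\<close>.\<close>

lemma image_abelian_group:
  fixes M :: "('b, 'm) ring_scheme" and E :: "'c::ab_group_add \<Rightarrow> 'b"
  assumes c: "carrier M = E ` A" and A: "0 \<in> A" "\<And>a b. a \<in> A \<Longrightarrow> b \<in> A \<Longrightarrow> a + b \<in> A" "\<And>a. a \<in> A \<Longrightarrow> - a \<in> A"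
    and z: "\<zero>\<^bsub>M\<^esub> = E 0" and p: "\<And>a b. a \<in> A \<Longrightarrow> b \<in> A \<Longrightarrow> E a \<oplus>\<^bsub>M\<^esub> E b = E (a + b)"
  shows "abelian_group M" and "\<And>a. a \<in> A \<Longrightarrow> \<ominus>\<^bsub>M\<^esub> E a = E (- a)"
    and "\<And>a b. a \<in> A \<Longrightarrow> b \<in> A \<Longrightarrow> E a \<ominus>\<^bsub>M\<^esub> E b = E (a - b)"
proof -
  show ab: "abelian_group M"
  proof (rule abelian_groupI)
    fix x assume "x \<in> carrier M"
    then obtain a where "a \<in> A" "x = E a" unfolding c by blast
    then have "E (- a) \<oplus>\<^bsub>M\<^esub> x = \<zero>\<^bsub>M\<^esub>" "E (- a) \<in> carrier M" using A by (auto simp: p z c)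
    then show "\<exists>y\<in>carrier M. y \<oplus>\<^bsub>M\<^esub> x = \<zero>\<^bsub>M\<^esub>" by blast
  qed (use A in \<open>auto simp: c z p add_ac\<close>)
  show 1: "\<ominus>\<^bsub>M\<^esub> E a = E (- a)" if "a \<in> A" for a
    using that A by (intro abelian_group.minus_equality[OF ab]) (auto simp: p z c)
  show "E a \<ominus>\<^bsub>M\<^esub> E b = E (a - b)" if "a \<in> A" "b \<in> A" for a b
    using that A by (simp add: a_minus_def 1 p)
qed

definition jb :: "'a::comm_ring_1 \<Rightarrow> 'a brown" where
  "jb a = bmk a 0 0 (- a)"

lemma jb_lin: "jb (a + b) = jb a + jb b" "jb (- a) = - jb a" "r \<cdot> jb a = jb (r * a)" "jb 0 = 0" "jb (a - b) = jb a - jb b"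
  by (simp_all add: jb_def bmk_add bmk_minus bmk_sc bmk_diff sc_zero bmk_0)

lemma inj_jb: "jb a = jb b \<longleftrightarrow> a = b"
  by (auto simp: jb_def)

lemma bml_jb: "bml (jb a) x = a \<cdot> jm x"
  by (rule bmk_cases[of x]) (simp add: jb_def bml_bmk jm_bmk bmk_sc lin_simps sc_zero sc_minus)

lemma Vq_one: "Vq (bml (jb a) (jb b)) (bmk 1 0 0 1) = osc (a * b) id"
  by (simp add: jb_def bml_bmk Vq_bmk lin_simps sc_zero osc_0 ops_0)

lemma psi_jb: "bml x (star y) - bml y (star x) = jb (psi x y)"
  by (rule bmk_cases[of x], rule bmk_cases[of y])
    (simp add: star_bmk bml_bmk jb_def psi_def bmk_diff crs_comm trc_comm algebra_simps)

lemma lam_jb: "bml (bml (jb s) y) (star x) + bml x (bml (star y) (jb s)) = jb (lam (Vq x y) * s)"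
  by (rule bmk_cases[of x], rule bmk_cases[of y])
    (simp add: star_bmk bml_bmk jb_def lam_Vq bmk_add lin_simps crs_comm trc_comm, simp add: fun_eq_iff algebra_simps)

locale ring_copy =
  fixes emb :: "'a::comm_ring_1 \<Rightarrow> 'u" and h :: "complex \<Rightarrow> 'a" and S :: "'u calg"
  assumes inj: "inj emb"
    and h_add: "\<And>c d. h (c + d) = h c + h d" and h_mult: "\<And>c d. h (c * d) = h c * h d" and h_1: "h 1 = 1"
    and S_def: "S = \<lparr>carrier = range emb, monoid.mult = (\<lambda>x y. emb (inv_into UNIV emb x * inv_into UNIV emb y)), monoid.one = emb 1,
       ring.zero = emb 0, ring.add = (\<lambda>x y. emb (inv_into UNIV emb x + inv_into UNIV emb y)), module.smult = (\<lambda>c x. emb (h c * inv_into UNIV emb x))\<rparr>"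
begin

lemma inv_emb [simp]: "inv_into UNIV emb (emb a) = a"
  by (simp add: inj)

lemma emb_eq [simp]: "emb a = emb b \<longleftrightarrow> a = b"
  using inj by (auto dest: injD)

lemma S_simps [simp]: "carrier S = range emb" "emb a \<otimes>\<^bsub>S\<^esub> emb b = emb (a * b)" "\<one>\<^bsub>S\<^esub> = emb 1"
  "\<zero>\<^bsub>S\<^esub> = emb 0" "emb a \<oplus>\<^bsub>S\<^esub> emb b = emb (a + b)" "c \<odot>\<^bsub>S\<^esub> emb a = emb (h c * a)"
  by (simp_all add: S_def)

lemma S_ab: "abelian_group S" and S_minus [simp]: "\<ominus>\<^bsub>S\<^esub> emb a = emb (- a)" "emb a \<ominus>\<^bsub>S\<^esub> emb b = emb (a - b)"
  using image_abelian_group[of S emb UNIV] by auto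

lemma S_cring: "cring S"
proof (rule cringI)
  show "abelian_group S" by (rule S_ab)
  show "comm_monoid S" by unfold_locales (auto simp: mult_ac)
qed (auto simp: algebra_simps)

lemma C_ring_S: "C_ring S"
  unfolding C_ring_def
proof (rule algebraI)
  show "cring complexes" by (rule cring_from_type_algebra)
qed (auto simp: S_cring ring_of_type_algebra_def h_add h_mult h_1 algebra_simps)

text \<open>The image of 1/2 under \<open>h\<close> makes 2 invertible. In
  \<open>Brown_minus_eq\<close> this forces the off-diagonal entries of a skew element to
  vanish.\<close>

lemma two_cancel: "x + x = 0 \<Longrightarrow> x = (0::'a)"
proof -
  assume "x + x = 0"
  then have "h (1/2) * (h 1 * x + h 1 * x) = 0" by (simp add: h_1)
  then have "(h (1/2) * h 1 + h (1/2) * h 1) * x = 0" by (simp add: algebra_simps)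
  then show "x = 0" by (simp add: h_mult[symmetric] h_add[symmetric] h_1)
qed

definition ec :: "('i \<Rightarrow> 'a) \<Rightarrow> 'i \<Rightarrow> 'u" where "ec x = (\<lambda>i. emb (x i))"

lemma ec_apply [simp]: "ec x i = emb (x i)" and ec_comp [simp]: "ec x \<circ> g = ec (x \<circ> g)"
  by (simp_all add: ec_def fun_eq_iff)

lemma ec_eq [simp]: "ec x = ec y \<longleftrightarrow> x = y"
  by (auto simp: ec_def fun_eq_iff)

lemma finsum_three: "(\<Oplus>\<^bsub>S\<^esub>k\<in>(UNIV :: three set). emb (g k)) = emb (g I1 + g I2 + g I3)"
proof -
  interpret cring S by (rule S_cring)
  have "(UNIV :: three set) = {I1, I2, I3}" using three.exhaust by auto
  moreover have "(\<Oplus>\<^bsub>S\<^esub>k\<in>{I1, I2, I3}. emb (g k)) = emb (g I1 + g I2 + g I3)"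
    by (simp add: Pi_def add.assoc)
  ultimately show ?thesis by simp
qed

lemma free_simps: "carrier (free_module S) = range ec" "ec x \<oplus>\<^bsub>free_module S\<^esub> ec y = ec (x + y)"
   "\<zero>\<^bsub>free_module S\<^esub> = ec 0" "emb r \<odot>\<^bsub>free_module S\<^esub> ec x = ec (r \<cdot> x)"
proof -
  have "x \<in> range ec" if "\<And>i. x i \<in> range emb" for x :: "'i \<Rightarrow> 'u"
  proof -
    have "x = ec (\<lambda>i. inv_into UNIV emb (x i))" using that by (auto simp: fun_eq_iff f_inv_into_f)
    then show ?thesis by blast
  qed
  then show "carrier (free_module S) = (range ec :: ('i \<Rightarrow> 'u) set)"
    by (auto simp: free_module_def Pi_def)
qed (simp_all add: free_module_def fun_eq_iff)

lemma free_minus: "ec x \<ominus>\<^bsub>free_module S\<^esub> ec y = ec (x - y)"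
  using image_abelian_group[of "free_module S" ec UNIV] by (auto simp: free_simps)

lemma oct_ec: "oct_norm S (ec c) = emb (onrm c)" "oct_mult S (ec c) (ec d) = ec (omul c d)"
  "oct_conj S (ec c) = ec (ocnj c)"
  by (auto simp: oct_norm_def oct_mult_def oct_conj_def vdot_def vcross_def finsum_three onrm_def omul_def ocnj_def
     fun_eq_iff split: oct_ix.split)

lemma oct_polar_ec: "oct_polar S (ec c) (ec d) = emb (opol c d)"
  by (simp add: oct_polar_def oct_ec free_simps onrm_add)

lemma alb_adj_ec: "alb_adj S (ec x) = ec (shp x)"
  by (auto simp: alb_adj_def shp_def oct_ec onrm_def fun_eq_iff split: alb_ix.split)

lemma alb_cross_ec: "alb_cross S (ec x) (ec y) = ec (crs x y)"
  by (simp add: alb_cross_def free_simps alb_adj_ec free_minus shp_add)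

lemma alb_trace_ec: "alb_trace S (ec x) (ec y) = emb (trc x y)"
  by (simp add: alb_trace_def finsum_three oct_polar_ec trc_def add.assoc)

lemma Brown_simps: "carrier (Brown S) = range ec" "ec x \<oplus>\<^bsub>Brown S\<^esub> ec y = ec (x + y)"
   "\<zero>\<^bsub>Brown S\<^esub> = ec 0" "emb r \<odot>\<^bsub>Brown S\<^esub> ec x = ec (r \<cdot> x)" "\<one>\<^bsub>Brown S\<^esub> = ec (bmk 1 0 0 1)"
   "ec x \<otimes>\<^bsub>Brown S\<^esub> ec y = ec (bml x y)" "star (ec x) = ec (star x)" "brown_j S = ec (jb 1)"
proof -
  show "ec x \<otimes>\<^bsub>Brown S\<^esub> ec y = ec (bml x y)"
    by (auto simp: Brown_def brown_mult_def bml_def alb_trace_ec alb_cross_ec fun_eq_iff bmk_def split: brown_ix.split)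
qed (auto simp: free_simps Brown_def free_module_def brown_one_def brown_j_def jb_def star_def fun_eq_iff bmk_def
   split: brown_ix.split, auto simp: free_simps[unfolded free_module_def, simplified])

lemma Brown_minus_op: "\<ominus>\<^bsub>Brown S\<^esub> ec x = ec (- x)" "ec x \<ominus>\<^bsub>Brown S\<^esub> ec y = ec (x - y)"
  using image_abelian_group[of "Brown S" ec UNIV] by (auto simp: Brown_simps)

text \<open>Members of \<open>Endo\<close> are extensional, so the code of an operator is restricted
  to the carrier; equality of codes is then equality of operators, as in
  \<open>eo_eq\<close>.\<close>

definition eo :: "('a brown \<Rightarrow> 'a brown) \<Rightarrow> 'u brown \<Rightarrow> 'u brown" where
  "eo f = (\<lambda>x\<in>carrier (Brown S). ec (f (inv_into UNIV emb \<circ> x)))"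

lemma inv_ec [simp]: "inv_into UNIV emb \<circ> ec x = x"
  by (simp add: fun_eq_iff)

lemma eo_apply [simp]: "eo f (ec x) = ec (f x)"
  by (simp add: eo_def Brown_simps comp_def)

lemma eo_eq: "eo f = eo g \<longleftrightarrow> f = g"
  by (metis (no_types, lifting) ec_eq eo_apply ext)

lemma eo_ext: "eo f \<in> extensional (carrier (Brown S))"
  by (simp add: eo_def)

lemma fun_ext_eqI: "\<phi> \<in> extensional (range ec) \<Longrightarrow> \<psi> \<in> extensional (range ec) \<Longrightarrow> (\<And>x. \<phi> (ec x) = \<psi> (ec x)) \<Longrightarrow> \<phi> = \<psi>"
  by (rule extensionalityI) auto

lemma Vop_ec: "Vop S (ec x) (ec y) = eo (Vq x y)"
  by (rule fun_ext_eqI) (auto simp: Vop_def Vq_def Brown_simps Brown_minus_op eo_ext[unfolded Brown_simps])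

lemma Endo_simps: "carrier (Endo S (Brown S)) = eo ` {f. blin f}" "\<zero>\<^bsub>Endo S (Brown S)\<^esub> = eo 0"
  "eo f \<oplus>\<^bsub>Endo S (Brown S)\<^esub> eo g = eo (f + g)" "emb r \<odot>\<^bsub>Endo S (Brown S)\<^esub> eo f = eo (osc r f)"
  "eo f \<otimes>\<^bsub>Endo S (Brown S)\<^esub> eo g = eo (f \<circ> g)"
proof -
  have lm: "linear_map S (Brown S) (Brown S) (eo f) \<longleftrightarrow> blin f" for f
    by (auto simp: linear_map_def Brown_simps blin_def)
  have "\<phi> \<in> eo ` {f. blin f}" if \<phi>: "\<phi> \<in> extensional (carrier (Brown S))" "linear_map S (Brown S) (Brown S) \<phi>" for \<phi>
  proof -
    have "\<forall>x. \<exists>y. \<phi> (ec x) = ec y" using \<phi>(2) by (auto simp: linear_map_def Brown_simps)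
    then obtain f where f: "\<And>x. \<phi> (ec x) = ec (f x)" by metis
    have "\<phi> = eo f" using \<phi>(1) by (intro fun_ext_eqI) (auto simp: f Brown_simps eo_ext[unfolded Brown_simps])
    then show ?thesis using \<phi>(2) lm by blast
  qed
  then show "carrier (Endo S (Brown S)) = eo ` {f. blin f}"
    by (auto simp: Endo_def eo_ext lm)
  show "\<zero>\<^bsub>Endo S (Brown S)\<^esub> = eo 0"
  "eo f \<oplus>\<^bsub>Endo S (Brown S)\<^esub> eo g = eo (f + g)" "emb r \<odot>\<^bsub>Endo S (Brown S)\<^esub> eo f = eo (osc r f)"
  "eo f \<otimes>\<^bsub>Endo S (Brown S)\<^esub> eo g = eo (f \<circ> g)"
    by (rule fun_ext_eqI; auto simp: Endo_def Brown_simps eo_def compose_def)+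
qed

lemma Endo_minus_op: "blin f \<Longrightarrow> \<ominus>\<^bsub>Endo S (Brown S)\<^esub> eo f = eo (- f)"
   "blin f \<Longrightarrow> blin g \<Longrightarrow> eo f \<ominus>\<^bsub>Endo S (Brown S)\<^esub> eo g = eo (f - g)"
  and Endo_ab: "abelian_group (Endo S (Brown S))"
  using image_abelian_group[of "Endo S (Brown S)" eo "{f. blin f}"] by (auto simp: Endo_simps blin_ops blin_add blin_minus)

text \<open>The span is an intersection of submodules: the codes of \<open>L0T\<close> form one of
  them, and finite sums of V operators lie in each.\<close>

lemma L0_eq: "L0 S = eo ` L0T"
proof
  interpret E: abelian_group "Endo S (Brown S)" by (rule Endo_ab)
  have "submodule (eo ` L0T) S (Endo S (Brown S))"
  proof (intro submodule.intro subgroup.intro submodule_axioms.intro)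
    fix x assume "x \<in> eo ` L0T"
    then obtain f where f: "f \<in> L0T" "x = eo f" by blast
    then show "m_inv (add_monoid (Endo S (Brown S))) x \<in> eo ` L0T"
      using Endo_minus_op(1)[OF L0T_blin[OF f(1)]] L0T_minus[OF f(1)] by (auto simp: a_inv_def)
  qed (auto simp: Endo_simps L0T_0 L0T_add L0T_osc intro: L0T_blin)
  then show "L0 S \<subseteq> eo ` L0T"
    unfolding L0_def span_of_def by (auto simp: Brown_simps Vop_ec Vq_L0T)
  have "eo f \<in> N" if N: "submodule N S (Endo S (Brown S))" "{Vop S x y |x y. x \<in> carrier (Brown S) \<and> y \<in> carrier (Brown S)} \<subseteq> N"
    and f: "f \<in> L0T" for f N
    using f
  proof (rule L0T_induct)
    interpret N: submodule N S "Endo S (Brown S)" by (rule N)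
    show "eo 0 \<in> N" using N.one_closed by (simp add: Endo_simps)
    fix x y and f :: "'a brown \<Rightarrow> 'a brown" assume "eo f \<in> N"
    moreover have "eo (Vq x y) \<in> N" using N(2) unfolding Vop_ec[symmetric] Brown_simps by blast
    ultimately show "eo (Vq x y + f) \<in> N" using N.m_closed[of "eo (Vq x y)" "eo f"] by (simp add: Endo_simps)
  qed
  then show "eo ` L0T \<subseteq> L0 S"
    unfolding L0_def span_of_def by blast
qed

lemma Brown_minus_eq: "Brown_minus S = range (\<lambda>a. ec (jb a))"
proof -
  have "star x = - x \<longleftrightarrow> x \<in> range jb" for x :: "'a brown"
  proof
    assume "star x = - x"
    then have 1: "x R2 = - x R1" "\<And>k. x (A1 k) + x (A1 k) = 0" "\<And>k. x (A2 k) + x (A2 k) = 0"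
      by (auto simp: fun_eq_iff all_brown star_def eq_neg_iff_add_eq_0)
    have "x = jb (x R1)"
      using 1(1) two_cancel[OF 1(2)] two_cancel[OF 1(3)] by (simp add: jb_def fun_eq_iff all_brown)
    then show "x \<in> range jb" by blast
  qed (auto simp: jb_def star_bmk bmk_minus)
  then show ?thesis
    by (auto simp: Brown_minus_def Brown_simps Brown_minus_op image_iff)
qed

fun el :: "'a lie \<Rightarrow> 'u tkk" where
  "el (a, x, f, y, b) = Tkk (ec (jb a)) (ec x) (eo f) (ec y) (ec (jb b))"

lemma el_eq: "el p = el q \<longleftrightarrow> p = q"
  by (cases p; cases q) (simp add: inj_jb eo_eq)

lemma TKK_module_simps: "carrier (TKK_module S) = el ` LT" "\<zero>\<^bsub>TKK_module S\<^esub> = el 0"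
  "el p \<oplus>\<^bsub>TKK_module S\<^esub> el q = el (p + q)" "emb r \<odot>\<^bsub>TKK_module S\<^esub> el p = el (lsc r p)"
proof -
  show "carrier (TKK_module S) = el ` LT"
  proof (intro subset_antisym subsetI)
    fix u assume "u \<in> carrier (TKK_module S)"
    then obtain s x \<phi> y t where u: "u = Tkk s x \<phi> y t" "s \<in> Brown_minus S" "x \<in> carrier (Brown S)" "\<phi> \<in> L0 S"
      "y \<in> carrier (Brown S)" "t \<in> Brown_minus S"
      unfolding TKK_module_def by auto
    moreover obtain a b where "s = ec (jb a)" "t = ec (jb b)" using u(2,6) unfolding Brown_minus_eq by blast
    moreover obtain x' y' where "x = ec x'" "y = ec y'" using u(3,5) unfolding Brown_simps by blast
    moreover obtain f where f: "\<phi> = eo f" "f \<in> L0T" using u(4) unfolding L0_eq by blast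
    ultimately have "u = el (a, x', f, y', b)" by simp
    moreover have "(a, x', f, y', b) \<in> LT" using f by simp
    ultimately show "u \<in> el ` LT" by blast
  next
    fix u assume "u \<in> el ` LT"
    then obtain a x f y b where "u = el (a, x, f, y, b)" "f \<in> L0T"
      unfolding LT_def by blast
    then show "u \<in> carrier (TKK_module S)"
      unfolding TKK_module_def Brown_minus_eq Brown_simps L0_eq by auto
  qed
  show "\<zero>\<^bsub>TKK_module S\<^esub> = el 0"
    by (simp add: TKK_module_def Brown_simps zero_prod_def jb_lin Endo_simps)
  show "el p \<oplus>\<^bsub>TKK_module S\<^esub> el q = el (p + q)" 
    by (cases p; cases q) (simp add: TKK_module_def Brown_simps Endo_simps jb_lin)
  show "emb r \<odot>\<^bsub>TKK_module S\<^esub> el p = el (lsc r p)"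
    by (cases p) (simp add: TKK_module_def Brown_simps Endo_simps jb_lin)
qed

lemma TKK_module_minus: "p \<in> LT \<Longrightarrow> \<ominus>\<^bsub>TKK_module S\<^esub> el p = el (- p)"
  using image_abelian_group[of "TKK_module S" el LT] by (auto simp: TKK_module_simps LT_0 LT_add LT_minus)

lemma in_el: "in_m2 S (ec (jb a)) = el (a, 0, 0, 0, 0)" "in_m1 S (ec x) = el (0, x, 0, 0, 0)"
  "in_0 S (eo f) = el (0, 0, f, 0, 0)" "in_p1 S (ec x) = el (0, 0, 0, x, 0)" "in_p2 S (ec (jb a)) = el (0, 0, 0, 0, a)"
  by (simp_all add: in_m2_def in_m1_def in_0_def in_p1_def in_p2_def Brown_simps Endo_simps jb_lin)

definition brS :: "'u tkk \<Rightarrow> 'u tkk \<Rightarrow> 'u tkk" where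
  "brS u v = (if u \<in> el ` LT \<and> v \<in> el ` LT then el (lbr (inv_into UNIV el u) (inv_into UNIV el v)) else undefined)"

lemma brS_el: "p \<in> LT \<Longrightarrow> q \<in> LT \<Longrightarrow> brS (el p) (el q) = el (lbr p q)"
proof -
  have "inj el" by (auto simp: inj_def el_eq)
  then show "p \<in> LT \<Longrightarrow> q \<in> LT \<Longrightarrow> brS (el p) (el q) = el (lbr p q)" by (simp add: brS_def)
qed

lemmas TKK_all = Brown_simps Brown_minus_op Endo_simps Endo_minus_op L0_eq Brown_minus_eq TKK_module_simps
  TKK_module_minus in_el Vop_ec

end

section \<open>Existence and uniqueness of the bracket\<close>

context ring_copy
begin

lemma lam_jb2: "- bml (bml (jb s) x) (star y) - bml y (bml (star x) (jb s)) = jb (lam (eps (Vq x y)) * s)"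
proof -
  have "- bml (bml (jb s) x) (star y) - bml y (bml (star x) (jb s)) = - (bml (bml (jb s) x) (star y) + bml y (bml (star x) (jb s)))"
    by simp
  then show ?thesis by (simp only: lam_jb) (simp add: eps_Vq lam_lin jb_lin)
qed

lemma brS_bilinear: "bilinear_product S (TKK_module S) brS"
  unfolding bilinear_product_def linear_map_def TKK_module_simps ball_simps S_simps Pi_iff
  by (intro ballI conjI) (simp_all add: TKK_module_simps brS_el LT_lbr LT_add LT_lsc lbr_add lbr_add2 lbr_lsc lbr_lsc2)

text \<open>The product of \<open>TKK\<close> is a definite description, so the explicit bracket has
  to satisfy every clause and, in \<open>is_TKK_unique\<close>, to be the only function that
  does.\<close>

lemma brS_is_TKK: "is_TKK_bracket S brS"
proof -
  have e0: "cmt 0 f = 0" "cmt f 0 = 0" if "blin f" for f :: "'a brown \<Rightarrow> 'a brown"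
    using that by (auto simp: fun_eq_iff cmt_apply blinD)
  have c: "cmt f g = (f \<circ> g) - (g \<circ> f)" for f g :: "'a brown \<Rightarrow> 'a brown" by (rule cmt_def)
  note bl = L0T_eps_blin L0T_blin blin_ops Vq_blin blin_comp
  note z = lam_lin eps_lin psi_lin sc_zero Vq_0 osc_0 jm_lin(5) blinD(5)
  show ?thesis
    unfolding is_TKK_bracket_def Let_def
  proof (intro conjI)
    show "bilinear_product S (TKK_module S) brS" by (rule brS_bilinear)
    show "\<forall>u v. u \<notin> carrier (TKK_module S) \<or> v \<notin> carrier (TKK_module S) \<longrightarrow> brS u v = undefined"
      by (auto simp: TKK_module_simps brS_def)
    show "\<forall>u\<in>carrier (TKK_module S). \<forall>v\<in>carrier (TKK_module S). brS u v = \<ominus>\<^bsub>TKK_module S\<^esub> brS v u"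
      unfolding TKK_module_simps ball_simps
      by (intro ballI) (simp add: brS_el TKK_module_minus LT_lbr el_eq lbr_anti[symmetric])
  qed (auto simp: TKK_all brS_el L0T_0 Vq_L0T bml_jb lam_jb[unfolded bml_jb] lam_jb2[unfolded bml_jb] psi_jb e0 bl z c[symmetric] el_eq Vq_one[unfolded bml_jb] zero_prod_def
     jb_lin(1,3,4,5) LT_0 eps_Vq lam_lin mult.commute simp del: el.simps)
qed

text \<open>Bilinearity and antisymmetry reduce to homogeneous arguments. When degree 0 acts on
  another degree, a further induction over sums reduces to the operators V, the only ones for which
  the clauses give a value.\<close>

lemma is_TKK_unique:
  assumes "is_TKK_bracket S br"
  shows "br = brS"
proof -
  note T = assms[unfolded is_TKK_bracket_def Let_def]
  have bil: "bilinear_product S (TKK_module S) br"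
    and anti: "\<forall>u\<in>carrier (TKK_module S). \<forall>v\<in>carrier (TKK_module S). br u v = \<ominus>\<^bsub>TKK_module S\<^esub> br v u"
    and t00: "\<forall>\<phi>\<in>L0 S. \<forall>\<psi>\<in>L0 S. br (in_0 S \<phi>) (in_0 S \<psi>) = in_0 S (\<phi> \<otimes>\<^bsub>Endo S (Brown S)\<^esub> \<psi> \<ominus>\<^bsub>Endo S (Brown S)\<^esub> \<psi> \<otimes>\<^bsub>Endo S (Brown S)\<^esub> \<phi>)"
    and und: "\<forall>u v. u \<notin> carrier (TKK_module S) \<or> v \<notin> carrier (TKK_module S) \<longrightarrow> br u v = undefined"
    using T by blast+
  define P where "P p q \<longleftrightarrow> br (el p) (el q) = el (lbr p q)" for p q
  have cl: "\<exists>r\<in>LT. br (el p) (el q) = el r" if "p \<in> LT" "q \<in> LT" for p q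
    using bil that unfolding bilinear_product_def linear_map_def TKK_module_simps ball_simps Pi_iff by blast
  have P_add: "P (p + p') q" if "P p q" "P p' q" "p \<in> LT" "p' \<in> LT" "q \<in> LT" for p p' q
    using bil that unfolding bilinear_product_def linear_map_def TKK_module_simps ball_simps P_def
    by (simp add: TKK_module_simps[symmetric] lbr_add)
  have P_anti: "P q p" if "P p q" "p \<in> LT" "q \<in> LT" for p q
  proof -
    have "br (el q) (el p) = \<ominus>\<^bsub>TKK_module S\<^esub> br (el p) (el q)"
      using anti that(2,3) unfolding TKK_module_simps ball_simps by blast
    also have "\<dots> = el (- lbr p q)" using that unfolding P_def by (simp add: TKK_module_minus LT_lbr)
    finally show ?thesis unfolding P_def by (simp only: lbr_anti[of q p])
  qed
  have LT1: "(a, 0, 0, 0, 0) \<in> LT" "(0, x, 0, 0, 0) \<in> LT" "(0, 0, 0, x, 0) \<in> LT" "(0, 0, 0, 0, a) \<in> LT" for a :: 'a and x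
    by (simp_all add: L0T_0)
  have P_gen1: "P p q" if q: "q \<in> LT" and p: "p \<in> LT"
    and g: "\<And>a. P (a, 0, 0, 0, 0) q" "\<And>x. P (0, x, 0, 0, 0) q" "\<And>f. f \<in> L0T \<Longrightarrow> P (0, 0, f, 0, 0) q"
      "\<And>y. P (0, 0, 0, y, 0) q" "\<And>b. P (0, 0, 0, 0, b) q" for p q
  proof -
    obtain a x f y b where p': "p = (a, x, f, y, b)" by (cases p)
    with p have f: "f \<in> L0T" by simp
    have "P ((a, 0, 0, 0, 0) + ((0, x, 0, 0, 0) + ((0, 0, f, 0, 0) + ((0, 0, 0, y, 0) + (0, 0, 0, 0, b))))) q"
      using f by (intro P_add g LT_add LT1 q) (simp_all)
    then show ?thesis by (simp add: p')
  qed
  have P_V: "P (0, 0, f, 0, 0) q" if "f \<in> L0T" and q: "q \<in> LT" and V: "\<And>x y. P (0, 0, Vq x y, 0, 0) q" for f q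
    using that(1)
  proof (rule L0T_induct)
    have "0 * 0 = (0::'a)" by simp
    have "Vq 0 0 = (0 :: 'a brown \<Rightarrow> 'a brown)" by (simp add: Vq_0)
    then show "P (0, 0, 0, 0, 0) q" using V[of 0 0] by simp
    fix x y :: "'a brown" and f assume "f \<in> L0T" "P (0, 0, f, 0, 0) q"
    then have "P ((0, 0, Vq x y, 0, 0) + (0, 0, f, 0, 0)) q" by (intro P_add V q) (auto simp: Vq_L0T)
    then show "P (0, 0, Vq x y + f, 0, 0) q" by simp
  qed
  have e0: "cmt 0 f = 0" "cmt f 0 = 0" if "blin f" for f :: "'a brown \<Rightarrow> 'a brown"
    using that by (auto simp: fun_eq_iff cmt_apply blinD)
  note all_el = TKK_all bml_jb lam_jb[unfolded bml_jb] lam_jb2[unfolded bml_jb] psi_jb Vq_one[unfolded bml_jb]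
  note z = lam_lin eps_lin psi_lin sc_zero Vq_0 osc_0 jm_lin(5) blinD(5) e0 L0T_eps_blin L0T_blin blin_ops Vq_blin
     jb_lin(1,3,4,5) eps_Vq zero_fun_def[symmetric]
  have f00: "P (0, 0, f, 0, 0) (0, 0, g, 0, 0)" if "f \<in> L0T" "g \<in> L0T" for f g
    using t00 that by (simp add: all_el P_def z cmt_def[symmetric] blin_comp del: el.simps)
  have fs0: "P (0, 0, Vq x y, 0, 0) (0, 0, 0, z, 0)" "P (0, 0, Vq x y, 0, 0) (0, z, 0, 0, 0)" for x y z
    using T by (simp_all add: all_el P_def z del: el.simps)
  have fs1: "P (0, 0, Vq x y, 0, 0) (0, 0, 0, 0, a)" "P (0, 0, Vq x y, 0, 0) (a, 0, 0, 0, 0)" for x y a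
    using T by (simp_all add: all_el P_def z del: el.simps)
  have fs2: "P (0, 0, 0, x, 0) (0, 0, 0, y, 0)" "P (0, x, 0, 0, 0) (0, y, 0, 0, 0)" "P (0, 0, 0, x, 0) (0, y, 0, 0, 0)" for x y
    using T by (simp_all add: all_el P_def z del: el.simps)
  have fs3: "P (0, 0, 0, 0, a) (b, 0, 0, 0, 0)" "P (0, 0, 0, 0, a) (0, 0, 0, 0, b)" "P (a, 0, 0, 0, 0) (b, 0, 0, 0, 0)" for a b
    using T by (simp_all add: all_el P_def z zero_prod_def del: el.simps)
  have fs4: "P (0, 0, 0, 0, a) (0, x, 0, 0, 0)" "P (a, 0, 0, 0, 0) (0, 0, 0, x, 0)" 
     "P (0, 0, 0, 0, a) (0, 0, 0, x, 0)" "P (a, 0, 0, 0, 0) (0, x, 0, 0, 0)" for a x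
    using T by (simp_all add: all_el P_def z zero_prod_def del: el.simps)
  note fs = fs0 fs1 fs2 fs3 fs4
  have f0: "P (0, 0, f, 0, 0) (a, 0, 0, 0, 0)" "P (0, 0, f, 0, 0) (0, x, 0, 0, 0)"
    "P (0, 0, f, 0, 0) (0, 0, 0, x, 0)" "P (0, 0, f, 0, 0) (0, 0, 0, 0, a)" if "f \<in> L0T" for f a x
    using that by - (rule P_V, assumption, rule LT1, rule fs)+
  have q: "P p (a, 0, 0, 0, 0)" "P p (0, x, 0, 0, 0)" "P p (0, 0, 0, x, 0)" "P p (0, 0, 0, 0, a)" if "p \<in> LT" for p a x
    using that by - (rule P_gen1, rule LT1, assumption,
       (rule fs | (rule f0, assumption) | (rule P_anti, rule fs, rule LT1, rule LT1))+)+
  have q0: "P p (0, 0, g, 0, 0)" if "p \<in> LT" "g \<in> L0T" for p g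
    using that by - (rule P_gen1, simp, assumption,
       (rule f00, assumption, assumption | (rule P_anti, rule f0, assumption, simp, rule LT1))+)
  have P: "P p q" if "p \<in> LT" "q \<in> LT" for p q
    using that by - (rule P_gen1, assumption, assumption,
      ((rule P_anti, rule q, assumption, assumption, rule LT1) | (rule P_anti, rule q0, assumption, assumption, assumption, simp))+)
  show "br = brS"
  proof (intro ext)
    fix u v show "br u v = brS u v"
    proof (cases "u \<in> el ` LT \<and> v \<in> el ` LT")
      case True
      then show ?thesis using P by (auto simp: P_def brS_el simp del: el.simps)
    next
      case False
      then show ?thesis using und by (auto simp: brS_def TKK_module_simps)
    qed
  qed
qed
end

text \<open>The double bracket kills degrees -2 and -1, is 1 on degree 1 and 2 on degree 2, and
  sends \<open>f\<close> of degree 0 to \<open>lam f\<close> times the identity.\<close>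

lemma E1_eq:
  assumes "lbr (0, 0, 0, 0, 1) (lbr (1, 0, 0, 0, 0) w) = w" and "w \<in> LT"
  shows "\<exists>v. w = (0, 0, 0, v, 0)"
proof -
  obtain a x f y b where w: "w = (a, x, f, y, b)" by (cases w)
  have bl: "blin f" "blin (eps f)" using assms(2) by (auto simp: w L0T_blin L0T_eps_blin)
  have e0: "cmt 0 f = 0" "cmt f 0 = 0" if "blin f" for f :: "'a::comm_ring_1 brown \<Rightarrow> 'a brown"
    using that by (auto simp: fun_eq_iff cmt_apply blinD)
  have "(a, x, f, y, b) = (0, 0, osc (- lam (eps f)) id, y, 2 * b)"
    using assms(1) bl unfolding w
    by (simp add: lam_lin lam_ops eps_lin eps_ops zero_fun_def[symmetric] psi_lin sc_zero sc_one Vq_0 osc_0 osc_minus jm_lin blinD e0 blin_ops blin_osc blin_minus)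
  then have 1: "a = 0" "x = 0" "f = osc (- lam (eps f)) id" "b = 2 * b" by auto
  define c where "c = lam (eps f)"
  have "f = osc (- c) id" using 1(3) by (simp add: c_def)
  \<comment> \<open>A degree 0 part of \<open>w\<close> is a multiple of \<open>id\<close>, and
    \<open>lam id = 2\<close> makes the operator act on it as 2 instead of 1.\<close>
  then have "c = 2 * c" unfolding c_def
    by (metis (no_types, lifting) add.inverse_inverse eps_lin(4) eps_ops(5) lam_lin(3,4) lam_ops(5) mult.commute mult_minus_left)
  then have "c = 0" by simp
  with 1 show ?thesis by (auto simp: w c_def osc_0)
qed

context ring_copy
begin

declare el.simps [simp del]

lemma TKK_simps: "carrier (TKK S) = el ` LT" "\<zero>\<^bsub>TKK S\<^esub> = el 0"
  "el p \<oplus>\<^bsub>TKK S\<^esub> el q = el (p + q)" "emb r \<odot>\<^bsub>TKK S\<^esub> el p = el (lsc r p)"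
  and TKK_mult: "p \<in> LT \<Longrightarrow> q \<in> LT \<Longrightarrow> el p \<otimes>\<^bsub>TKK S\<^esub> el q = el (lbr p q)"
proof -
  have "(THE br. is_TKK_bracket S br) = brS"
    by (rule the_equality) (auto intro: brS_is_TKK is_TKK_unique)
  then show "p \<in> LT \<Longrightarrow> q \<in> LT \<Longrightarrow> el p \<otimes>\<^bsub>TKK S\<^esub> el q = el (lbr p q)"
    by (simp add: TKK_def brS_el)
qed (use TKK_module_simps in \<open>simp_all add: TKK_def\<close>)

lemma one_pm: "one_plus S = el (0, 0, 0, 0, 1)" "one_minus S = el (1, 0, 0, 0, 0)"
  by (simp_all only: one_plus_def one_minus_def Brown_simps in_el)

lemma inv_el [simp]: "inv_into UNIV el (el p) = p"
  by (rule inv_into_f_f) (auto simp: inj_def el_eq)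

text \<open>The form \<alpha> serves twice: it witnesses that \<open>y\<close> is unimodular, and it
  makes the scalar in the definite description \<open>extremal_form\<close> unique.\<close>

lemma extremal_el:
  assumes y: "y \<in> LT" and \<alpha>: "\<And>p q. \<alpha> (p + q) = \<alpha> p + \<alpha> q" "\<And>r p. \<alpha> (lsc r p) = r * \<alpha> p" "\<alpha> y = 1"
    and s: "\<And>u. u \<in> LT \<Longrightarrow> lbr y (lbr y u) = lsc (s u) y"
  shows "extremal S (TKK S) (el y)" and "u \<in> LT \<Longrightarrow> extremal_form S (TKK S) (el y) (el u) = emb (s u)"
proof -
  have um: "unimodular S (TKK S) (el y)"
    unfolding unimodular_def linear_form_def
    by (intro conjI exI[of _ "\<lambda>u. emb (\<alpha> (inv_into UNIV el u))"])
      (auto simp: y TKK_simps \<alpha> simp del: el.simps)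
  have e: "el y \<otimes>\<^bsub>TKK S\<^esub> (el y \<otimes>\<^bsub>TKK S\<^esub> el u) = emb (s u) \<odot>\<^bsub>TKK S\<^esub> el y" if "u \<in> LT" for u
    using that y by (simp add: TKK_mult TKK_simps LT_lbr s)
  have "\<forall>u\<in>carrier (TKK S). \<exists>r\<in>carrier S. el y \<otimes>\<^bsub>TKK S\<^esub> (el y \<otimes>\<^bsub>TKK S\<^esub> u) = r \<odot>\<^bsub>TKK S\<^esub> el y"
    unfolding TKK_simps ball_simps using e by (auto simp del: el.simps)
  with um show "extremal S (TKK S) (el y)" unfolding extremal_def by blast
  show "extremal_form S (TKK S) (el y) (el u) = emb (s u)" if u: "u \<in> LT"
    unfolding extremal_form_def
  proof (rule the_equality)
    fix r assume r: "r \<in> carrier S \<and> el y \<otimes>\<^bsub>TKK S\<^esub> (el y \<otimes>\<^bsub>TKK S\<^esub> el u) = r \<odot>\<^bsub>TKK S\<^esub> el y"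
    then obtain r' where r': "r = emb r'" by auto
    with r u have "lsc (s u) y = lsc r' y" by (simp add: e TKK_simps el_eq)
    then have "\<alpha> (lsc (s u) y) = \<alpha> (lsc r' y)" by simp
    then show "r = emb (s u)" by (simp add: \<alpha> r')
  qed (use e[OF u] in simp)
qed

lemma Aut_el:
  assumes "\<phi> \<in> alg_Aut S (TKK S)"
  obtains F where "\<And>p. p \<in> LT \<Longrightarrow> \<phi> (el p) = el (F p)" "bij_betw F LT LT"
    "\<And>p q. p \<in> LT \<Longrightarrow> q \<in> LT \<Longrightarrow> F (p + q) = F p + F q" "\<And>r p. p \<in> LT \<Longrightarrow> F (lsc r p) = lsc r (F p)"
    "\<And>p q. p \<in> LT \<Longrightarrow> q \<in> LT \<Longrightarrow> F (lbr p q) = lbr (F p) (F q)"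
proof -
  have a: "bij_betw \<phi> (el ` LT) (el ` LT)" "linear_map S (TKK S) (TKK S) \<phi>"
    "\<And>x y. x \<in> carrier (TKK S) \<Longrightarrow> y \<in> carrier (TKK S) \<Longrightarrow> \<phi> (x \<otimes>\<^bsub>TKK S\<^esub> y) = \<phi> x \<otimes>\<^bsub>TKK S\<^esub> \<phi> y"
    using assms unfolding alg_Aut_def GL_def Endo_def by (auto simp: TKK_simps)
  have inj: "inj_on el LT" by (auto simp: inj_on_def el_eq)
  have "\<exists>q\<in>LT. \<phi> (el p) = el q" if p: "p \<in> LT" for p
    using bij_betw_apply[OF a(1) imageI[OF p]] by (metis imageE)
  then obtain F where 1: "\<And>p. p \<in> LT \<Longrightarrow> \<phi> (el p) = el (F p)" and cl: "\<And>p. p \<in> LT \<Longrightarrow> F p \<in> LT"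
    by metis
  have b: "bij_betw F LT LT"
  proof (rule bij_betw_imageI)
    show "inj_on F LT"
    proof (rule inj_onI)
      fix p q assume pq: "p \<in> LT" "q \<in> LT" "F p = F q"
      then have "\<phi> (el p) = \<phi> (el q)" using 1 by metis
      then have "el p = el q" using a(1) pq by (auto simp: bij_betw_def inj_on_def)
      then show "p = q" by (simp add: el_eq)
    qed
    show "F ` LT = LT"
    proof (intro subset_antisym subsetI)
      fix q :: "'a lie" assume "q \<in> LT"
      then have "el q \<in> \<phi> ` el ` LT" using a(1) by (auto simp: bij_betw_def)
      then obtain p where "p \<in> LT" "\<phi> (el p) = el q" by auto
      then have "F p = q" by (simp add: 1 el_eq)
      then show "q \<in> F ` LT" using \<open>p \<in> LT\<close> by blast
    qed (use cl in auto)
  qed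
  have f1: "F (p + q) = F p + F q" if "p \<in> LT" "q \<in> LT" for p q
  proof -
    have "\<phi> (el p \<oplus>\<^bsub>TKK S\<^esub> el q) = \<phi> (el p) \<oplus>\<^bsub>TKK S\<^esub> \<phi> (el q)"
      using a(2) that unfolding linear_map_def by (auto simp add: TKK_simps)
    then have "\<phi> (el (p + q)) = el (F p + F q)"
      unfolding TKK_simps 1[OF that(1)] 1[OF that(2)] by simp
    then show ?thesis by (simp add: 1 LT_add that el_eq)
  qed
  have f2: "F (lsc r p) = lsc r (F p)" if "p \<in> LT" for p r
  proof -
    have "\<phi> (emb r \<odot>\<^bsub>TKK S\<^esub> el p) = emb r \<odot>\<^bsub>TKK S\<^esub> \<phi> (el p)"
      using a(2) that unfolding linear_map_def by (auto simp add: TKK_simps)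
    then have "\<phi> (el (lsc r p)) = el (lsc r (F p))"
      unfolding TKK_simps 1[OF that(1)] by simp
    then show ?thesis by (simp add: 1 LT_lsc that el_eq)
  qed
  have f3: "F (lbr p q) = lbr (F p) (F q)" if "p \<in> LT" "q \<in> LT" for p q
  proof -
    have "\<phi> (el p \<otimes>\<^bsub>TKK S\<^esub> el q) = \<phi> (el p) \<otimes>\<^bsub>TKK S\<^esub> \<phi> (el q)"
      using that by (intro a(3)) (auto simp: TKK_simps)
    also have "\<dots> = el (lbr (F p) (F q))"
      unfolding 1[OF that(1)] 1[OF that(2)] by (rule TKK_mult[OF cl[OF that(1)] cl[OF that(2)]])
    finally show ?thesis by (simp add: TKK_mult 1 LT_lbr that el_eq)
  qed
  show thesis by (rule that[of F]) (use 1 b f1 f2 f3 in auto)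
qed

end

section \<open>Extremal pairs\<close>

text \<open>The Peirce decomposition with respect to the idempotent \<open>cE\<close>: \<open>u10\<close> is the 0-space, with the quadratic form \<open>mu\<close>, and
  \<open>a23\<close> is the 1/2-space.\<close>

definition cE :: "'a::comm_ring_1 alb" where
  "cE m = (if m = Dg I1 then 1 else 0)"

definition u10 :: "'a::comm_ring_1 alb \<Rightarrow> bool" where
  "u10 m \<longleftrightarrow> m (Dg I1) = 0 \<and> (\<forall>k. m (Of I2 k) = 0) \<and> (\<forall>k. m (Of I3 k) = 0)"

definition a23 :: "'a::comm_ring_1 alb \<Rightarrow> bool" where
  "a23 a \<longleftrightarrow> (\<forall>i. a (Dg i) = 0) \<and> (\<forall>k. a (Of I1 k) = 0)"

definition mu :: "'a::comm_ring_1 alb \<Rightarrow> 'a" where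
  "mu m = m (Dg I2) * m (Dg I3) - onrm (m \<circ> Of I1)"

lemma cE_simps [simp]: "cE (Dg I1) = 1" "cE (Dg I2) = 0" "cE (Dg I3) = 0" "cE (Of i k) = 0"
  by (simp_all add: cE_def)

lemmas expand = fun_eq_iff all_alb all_oct all_three crs_def trc_def opol_def ocnj_def omul_def

lemma trc_cE: "trc cE x = x (Dg I1)" "trc x cE = x (Dg I1)"
  by (simp_all add: trc_def opol_def)

lemma crs_cE: "crs cE x = (\<lambda>m. case m of Dg I1 \<Rightarrow> 0 | Dg I2 \<Rightarrow> x (Dg I3) | Dg I3 \<Rightarrow> x (Dg I2)
    | Of I1 k \<Rightarrow> - x (Of I1 k) | Of I2 k \<Rightarrow> 0 | Of I3 k \<Rightarrow> 0)"
  by (simp add: expand)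

lemma u10_cE: "u10 (crs cE x)"
  by (simp add: crs_cE u10_def)

lemma cE_cE: "crs cE cE = 0"
  by (simp add: crs_cE fun_eq_iff all_alb all_three)

lemma cE_cE_u10: "u10 m \<Longrightarrow> crs cE (crs cE m) = m"
  by (simp add: crs_cE u10_def fun_eq_iff all_alb all_three)

lemma u10_crs_cE: "u10 m \<Longrightarrow> crs m (crs cE p) = trc m p \<cdot> cE"
  by (simp add: u10_def crs_cE) (simp add: expand algebra_simps)

lemma cE_crs_u10: "u10 m \<Longrightarrow> crs cE (crs m p) = p (Dg I1) \<cdot> m"
  by (simp add: u10_def crs_cE) (simp add: expand algebra_simps)

lemma u10_sq: "u10 m \<Longrightarrow> crs m m = (2 * mu m) \<cdot> cE"
  by (simp add: u10_def mu_def onrm_def) (simp add: expand algebra_simps)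

lemma u10_mult: "u10 m \<Longrightarrow> u10 m' \<Longrightarrow> crs m m' = crs m m' (Dg I1) \<cdot> cE"
  by (simp add: u10_def) (simp add: expand algebra_simps)

lemma cE_crs_cE: "crs cE (crs b (crs cE a)) = b (Dg I1) \<cdot> crs cE a"
  by (simp add: crs_cE) (simp add: expand algebra_simps)

lemma u10_lin: "u10 m \<Longrightarrow> u10 m' \<Longrightarrow> u10 (m + m')" "u10 m \<Longrightarrow> u10 (r \<cdot> m)" "u10 m \<Longrightarrow> u10 (- m)"
  and a23_lin: "a23 a \<Longrightarrow> a23 a' \<Longrightarrow> a23 (a + a')" "a23 a \<Longrightarrow> a23 (r \<cdot> a)" "a23 a \<Longrightarrow> a23 (- a)" "a23 a \<Longrightarrow> a23 a' \<Longrightarrow> a23 (a - a')"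
  by (simp_all add: u10_def a23_def)

lemma Dop_cE_u10: "u10 m \<Longrightarrow> Dop cE m = 0"
  by (simp add: fun_eq_iff[of "Dop _ _"] Dop_def u10_crs_cE cE_crs_u10 trc_cE bmk_0) (simp add: u10_def sc_zero)

lemma a23_cE: "a23 a \<Longrightarrow> crs cE a = 0" "a23 a \<Longrightarrow> trc cE a = 0" "a23 a \<Longrightarrow> a (Dg I1) = 0"
  by (simp_all add: a23_def crs_cE trc_cE fun_eq_iff all_alb all_three)

lemma a23_u10: "a23 a \<Longrightarrow> u10 m \<Longrightarrow> trc m a = 0" "a23 a \<Longrightarrow> u10 m \<Longrightarrow> trc a m = 0"
   "a23 a \<Longrightarrow> u10 m \<Longrightarrow> a23 (crs m a)"
  by (simp_all add: a23_def u10_def expand)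

lemma a23_Of: "a23 a \<Longrightarrow> a23 b \<Longrightarrow> a \<circ> Of I2 = b \<circ> Of I2 \<Longrightarrow> a \<circ> Of I3 = b \<circ> Of I3 \<Longrightarrow> a = b"
  by (simp add: a23_def fun_eq_iff all_alb all_three)

lemma crs_u10_a23:
  assumes "u10 m" "a23 a"
  shows "crs m a \<circ> Of I2 = (a \<circ> Of I3) \<bullet> (m \<circ> Of I1) - m (Dg I2) \<cdot> (a \<circ> Of I2)"
    "crs m a \<circ> Of I3 = (m \<circ> Of I1) \<bullet> (a \<circ> Of I2) - m (Dg I3) \<cdot> (a \<circ> Of I3)"
proof -
  have z: "m \<circ> Of I2 = 0" "m \<circ> Of I3 = 0" using assms(1) by (auto simp: u10_def fun_eq_iff)
  have z0: "c \<bullet> 0 = 0" "0 \<bullet> c = 0" for c :: "'a oct"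
    using otr_diff(2)[of c c c] otr_diff(1)[of c c c] by simp_all
  show "crs m a \<circ> Of I2 = (a \<circ> Of I3) \<bullet> (m \<circ> Of I1) - m (Dg I2) \<cdot> (a \<circ> Of I2)"
    "crs m a \<circ> Of I3 = (m \<circ> Of I1) \<bullet> (a \<circ> Of I2) - m (Dg I3) \<cdot> (a \<circ> Of I3)"
    using assms(2) by (simp_all add: crs_Of z z0 a23_def sc_zero)
qed

text \<open>The Clifford relations, the source of the idempotent matrix. The 10-dimensional
  quadratic space of \<open>u10\<close> elements acts on the 16-dimensional space \<open>a23\<close>
  through \<open>m\<close> and through \<open>crs cE m\<close>; that these actions compose to
  \<open>mu m\<close> is, in components, the sandwich law of \<open>\<bullet>\<close>.\<close>

lemma a23_sandwich:
  assumes m: "u10 m" and a: "a23 a"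
  shows "crs m (crs (crs cE m) a) = mu m \<cdot> a" "crs (crs cE m) (crs m a) = mu m \<cdot> a"
proof -
  have n: "(crs cE m) (Dg I2) = m (Dg I3)" "(crs cE m) (Dg I3) = m (Dg I2)" "crs cE m \<circ> Of I1 = (- 1) \<cdot> (m \<circ> Of I1)"
    by (simp_all add: crs_cE fun_eq_iff)
  show "crs m (crs (crs cE m) a) = mu m \<cdot> a" "crs (crs cE m) (crs m a) = mu m \<cdot> a"
    by (intro a23_Of a23_lin a23_u10 m u10_cE a;
      simp add: crs_u10_a23 a23_u10 m u10_cE a n otr_diff otr_sc otr_sandwich comp_sc mu_def sc_diff diff_sc sc_sc;
      simp add: fun_eq_iff algebra_simps)+
qed

lemma trc_nondeg:
  assumes "\<And>p. trc x p = trc y p"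
  shows "x = y"
proof -
  have 1: "trc x (\<lambda>m. if m = k then 1 else 0) = (case k of Dg i \<Rightarrow> x (Dg i) | Of i OE \<Rightarrow> x (Of i OF) | Of i OF \<Rightarrow> x (Of i OE)
     | Of i (OU j) \<Rightarrow> - x (Of i (OV j)) | Of i (OV j) \<Rightarrow> - x (Of i (OU j)))" for k and x :: "'a alb"
  proof (cases k)
    case (Dg i) then show ?thesis by (cases i) (simp_all add: trc_def opol_def)
  next
    case (Of i o') then show ?thesis
      by (cases i; cases o'; simp add: trc_def opol_def; rename_tac j; case_tac j; simp)
  qed
  have "\<forall>k. trc x (\<lambda>m. if m = k then 1 else 0) = trc y (\<lambda>m. if m = k then 1 else 0)" using assms by blast
  then show ?thesis unfolding 1 by (simp add: all_alb all_oct fun_eq_iff)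
qed

lemma Dop_dual: "trc (crs a (crs b q) - trc a q \<cdot> b) p = - trc q (trc b p \<cdot> a - crs b (crs a p))"
proof -
  have "trc (crs a (crs b q)) p = trc p (crs a (crs b q))" by (rule trc_comm)
  also have "\<dots> = trc (crs (crs p a) b) q" by (simp only: trc_crs)
  also have "\<dots> = trc q (crs (crs p a) b)" by (rule trc_comm)
  also have "\<dots> = trc q (crs b (crs a p))" by (simp only: crs_comm[of p a] crs_comm[of b])
  finally have "trc (crs a (crs b q)) p = trc q (crs b (crs a p))" .
  then show ?thesis by (simp add: lin_simps trc_comm[of q a] algebra_simps)
qed

text \<open>These relations bring mixed operators back to the forms \<open>Dop _ cE\<close> and
  \<open>Dop cE _\<close>. On one copy of the Albert algebra each is an instance of
  \<open>adj_lin\<close>; on the other it follows by duality, because \<open>Dop_dual\<close> makes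
  the two actions negative transposes up to a scalar.\<close>

lemma Dop_a23:
  assumes m: "u10 m" and a: "a23 a"
  shows "Dop (crs cE m) a = - Dop (crs m a) cE" "Dop a m = - Dop cE (crs (crs cE m) a)"
proof -
  let ?n = "crs cE m"
  have ac: "crs a cE = 0" "crs cE a = 0" using a by (simp_all add: a23_cE crs_comm[of a])
  have am: "crs a m = crs m a" and an: "crs a ?n = crs ?n a" by (simp_all add: crs_comm)
  have t: "trc ?n a = 0" "trc a ?n = 0" "trc (crs m a) cE = 0" "trc a m = 0" "trc cE (crs ?n a) = 0"
    using a m a23_cE(2)[OF a23_u10(3)[OF a m]] a23_cE(2)[OF a23_u10(3)[OF a u10_cE]]
    by (simp_all add: a23_u10 u10_cE trc_comm[of _ cE])
  have p1: "trc a p \<cdot> ?n - crs a (crs ?n p) = - (trc cE p \<cdot> crs m a - crs cE (crs (crs m a) p))" for p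
    using adj_lin[of a p cE m] by (simp add: ac am t crs_comm[of p] lin_simps sc_zero trc_comm[of p] algebra_simps)
  have q1: "crs ?n (crs a q) - trc ?n q \<cdot> a = - (crs (crs m a) (crs cE q) - trc (crs m a) q \<cdot> cE)" for q
    by (rule trc_nondeg, simp only: trc_minus Dop_dual p1)
  show "Dop (crs cE m) a = - Dop (crs m a) cE"
    by (rule ext, simp only: uminus_apply Dop_def t q1) (simp add: bmk_minus sc_zero p1)
  have q2: "crs a (crs m q) - trc a q \<cdot> m = - (crs cE (crs (crs ?n a) q) - trc cE q \<cdot> crs ?n a)" for q
    using adj_lin[of a q cE ?n] by (simp add: ac an t cE_cE_u10[OF m] crs_comm[of q] lin_simps sc_zero trc_comm[of q] algebra_simps)
  have p2: "trc m p \<cdot> a - crs m (crs a p) = - (trc (crs ?n a) p \<cdot> cE - crs (crs ?n a) (crs cE p))" for p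
  proof (rule trc_nondeg)
    fix q
    have "trc q (trc m p \<cdot> a - crs m (crs a p)) = trc q (- (trc (crs ?n a) p \<cdot> cE - crs (crs ?n a) (crs cE p)))"
      using Dop_dual[of a m q p] unfolding q2 trc_minus Dop_dual by simp
    then show "trc (trc m p \<cdot> a - crs m (crs a p)) q = trc (- (trc (crs ?n a) p \<cdot> cE - crs (crs ?n a) (crs cE p))) q"
      by (simp only: trc_comm)
  qed
  show "Dop a m = - Dop cE (crs (crs cE m) a)"
    by (rule ext, simp only: uminus_apply Dop_def t q2) (simp add: bmk_minus sc_zero p2)
qed

text \<open>The polar form of \<open>mu\<close>: by \<open>u10_mult\<close>, \<open>crs\<close> of
  two \<open>u10\<close> elements is a multiple of \<open>cE\<close>, and this is the
  factor.\<close>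

definition bmu :: "'a::comm_ring_1 alb \<Rightarrow> 'a alb \<Rightarrow> 'a" where
  "bmu m m' = crs m m' (Dg I1)"

lemma bmu_lin: "bmu (m + n) p = bmu m p + bmu n p" "bmu p (m + n) = bmu p m + bmu p n"
  "bmu (m - n) p = bmu m p - bmu n p" "bmu p (m - n) = bmu p m - bmu p n"
  "bmu (- m) p = - bmu m p" "bmu p (- m) = - bmu p m"
  "bmu (r \<cdot> m) p = r * bmu m p" "bmu p (r \<cdot> m) = r * bmu p m"
  by (simp_all add: bmu_def lin_simps)

lemma bmu_comm: "bmu m p = bmu p m"
  by (simp add: bmu_def crs_comm)

lemma u10_rules:
  assumes m: "u10 m" and p: "u10 p"
  shows "crs cE (crs cE m) = m" "crs m p = bmu m p \<cdot> cE" "trc cE m = 0" "trc m cE = 0"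
    "trc m (crs cE p) = bmu m p" "trc (crs cE m) p = bmu m p"
    "crs (crs cE m) p = trc m p \<cdot> cE" "crs p (crs cE m) = trc m p \<cdot> cE"
    "Dop cE m = 0" "Dop cE (crs cE m) = 0" "u10 (crs cE m)" "u10 (r \<cdot> m)" "u10 (m + p)" "u10 (m - p)" "u10 (- m)"
    "crs m cE = crs cE m" "crs (crs cE m) cE = m"
proof -
  show "crs m cE = crs cE m" "crs (crs cE m) cE = m"
    using cE_cE_u10[OF m] by (simp_all add: crs_comm[of m cE] crs_comm[of "crs cE m" cE])
  show 1: "crs cE (crs cE m) = m" "crs m p = bmu m p \<cdot> cE" "trc cE m = 0" "trc m cE = 0"
    using m p u10_mult[OF m p] by (simp_all add: cE_cE_u10 trc_cE bmu_def) (simp_all add: u10_def)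
  have "trc m (crs cE p) = trc (crs m p) cE" by (simp add: trc_crs crs_comm)
  then show 2: "trc m (crs cE p) = bmu m p" by (simp add: trc_cE bmu_def)
  have "trc (crs cE m) p = trc cE (crs m p)" by (simp only: trc_crs)
  then show 3: "trc (crs cE m) p = bmu m p" by (simp add: trc_cE bmu_def)
  show 4: "crs p (crs cE m) = trc m p \<cdot> cE" using u10_crs_cE[OF p, of m] by (simp add: trc_comm)
  then show "crs (crs cE m) p = trc m p \<cdot> cE" by (simp only: crs_comm[of _ p])
  show "Dop cE m = 0" "Dop cE (crs cE m) = 0" "u10 (crs cE m)" "u10 (r \<cdot> m)" "u10 (m + p)" "u10 (m - p)" "u10 (- m)"
    using m p u10_lin(1)[OF m u10_lin(3)[OF p]] by (auto intro: Dop_cE_u10 u10_cE u10_lin)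
qed

lemma trc_cE_crs: "trc cE (crs cE p) = 0" "trc (crs cE p) cE = 0" "trc cE cE = 1"
  by (simp_all add: trc_cE crs_cE)

text \<open>For \<open>s = 1 - t\<close> and \<open>xy - mu m = t (1 - t)\<close> these are the two elements of an extremal pair.\<close>

definition vp :: "'a::comm_ring_1 \<Rightarrow> 'a \<Rightarrow> 'a \<Rightarrow> 'a alb \<Rightarrow> 'a \<Rightarrow> 'a lie" where
  "vp t x y m s = (0, 0, osc s (Phi cE), bmk x (y \<cdot> cE) m 0, t)"

definition vm :: "'a::comm_ring_1 \<Rightarrow> 'a \<Rightarrow> 'a \<Rightarrow> 'a alb \<Rightarrow> 'a \<Rightarrow> 'a lie" where
  "vm t x y m s = (t, bmk 0 (- crs cE m) (x \<cdot> cE) y, osc s (Psi cE), 0, 0)"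

lemma vpm_LT: "vp t x y m s \<in> LT" "vm t x y m s \<in> LT"
  by (simp_all add: vp_def vm_def L0T_osc ops_L0T)

lemma cmt_ops'':
  "cmt (Phi c) (Dop a b) = - Phi (trc b c \<cdot> a - crs b (crs a c))"
  "cmt (Psi c) (Dop a b) = - Psi (crs a (crs b c) - trc a c \<cdot> b)"
  by (simp_all add: cmt_swap[of "Phi c" "Dop a b"] cmt_swap[of "Psi c" "Dop a b"] cmt_Dop)

lemma vm_vp:
  assumes m: "u10 m" and m': "u10 m'"
  shows "lbr (vm z x y m r) (vp t x' y' m' s) =
   (0, bmk (s * x + z * x') ((s * y + z * y') \<cdot> cE) (- (s \<cdot> m + z \<cdot> m')) 0,
     osc (r * s) (id - Dop cE cE - Gop) - (osc (x' * y) Gop - osc (bmu m' m) id + Phi (crs cE (x \<cdot> m' - x' \<cdot> m))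
       + Psi (y \<cdot> m' - y' \<cdot> m) + osc (x * y') (Dop cE cE) + Dop (crs cE m) m') - osc (t * z) id,
     bmk 0 (crs cE (r \<cdot> m' + t \<cdot> m)) ((r * x' + t * x) \<cdot> cE) (r * y' + t * y), 0)"
proof -
  note R = u10_rules[OF m m'] u10_rules[OF m' m] u10_rules[OF m m] trc_cE_crs cE_cE
  have V: "Vq (bmk x' (y' \<cdot> cE) m' 0) (bmk 0 (- crs cE m) (x \<cdot> cE) y) = osc (x' * y) Gop - osc (bmu m' m) id
      + Phi (crs cE (x \<cdot> m' - x' \<cdot> m)) + Psi (y \<cdot> m' - y' \<cdot> m) + osc (x * y') (Dop cE cE) + Dop (crs cE m) m'"
  proof -
    have 1: "x' \<cdot> (- crs cE m) + 0 \<cdot> (y' \<cdot> cE) + crs m' (x \<cdot> cE) = crs cE (x \<cdot> m' - x' \<cdot> m)"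
      by (simp add: lin_simps R sc_zero sc_minus)
    have 2: "0 \<cdot> (x \<cdot> cE) + y \<cdot> m' + crs (y' \<cdot> cE) (- crs cE m) = y \<cdot> m' - y' \<cdot> m"
      by (simp add: lin_simps R sc_zero sc_minus)
    show ?thesis unfolding Vq_bmk 1 2
      by (simp add: lin_simps R ops_sc ops_minus osc_osc osc_minus mult.commute)
  qed
  show ?thesis
    unfolding vm_def vp_def lbr.simps V
    by (simp add: lam_lin eps_lin lam_ops eps_ops psi_lin Vq_0 osc_0 jm_lin jm_bmk cmt_osc blin_ops blin_osc cmt_ops' R
        ops_bmk lin_simps bmk_sc bmk_add bmk_minus bmk_diff bmk_0[symmetric] sc_zero osc_osc osc_minus osc_diff osc_add blinD(5))
      (simp add: fun_eq_iff all_brown algebra_simps)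
qed

lemma lbr_vp:
  assumes m: "u10 m" and n: "u10 n" and \<Phi>: "blin f"
  shows "lbr (vp z x y m r) (0, bmk x1 (y1 \<cdot> cE) (- n) 0, f, w, 0)
    = (0, 0, osc r (cmt (Phi cE) f) + osc (x * y1 + x1 * y - bmu m n) (Phi cE),
       osc r (Phi cE) w - f (bmk x (y \<cdot> cE) m 0) + z \<cdot> bmk x1 (y1 \<cdot> cE) n 0,
       psi (bmk x (y \<cdot> cE) m 0) w - lam f * z)"
proof -
  note R = u10_rules[OF m n] u10_rules[OF n m] u10_rules[OF m m] trc_cE_crs cE_cE
  have V: "Vq (bmk x (y \<cdot> cE) m 0) (bmk x1 (y1 \<cdot> cE) (- n) 0) = osc (x * y1 + x1 * y - bmu m n) (Phi cE)"
  proof -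
    have "x \<cdot> y1 \<cdot> cE + x1 \<cdot> y \<cdot> cE + crs m (- n) = (x * y1 + x1 * y - bmu m n) \<cdot> cE"
      by (simp add: lin_simps R sc_sc add_sc diff_sc)
    then show ?thesis
      unfolding Vq_bmk by (simp add: lin_simps R ops_sc ops_minus sc_zero ops_0 osc_0 cE_cE)
  qed
  have e: "eps f 0 = 0" using \<Phi> by (simp add: eps_def jm_lin blinD sc_zero zero_fun_def[symmetric])
  show ?thesis
    unfolding vp_def lbr.simps V
    by (simp add: lam_lin eps_lin lam_ops eps_ops psi_lin Vq_0 osc_0 jm_lin jm_bmk cmt_osc \<Phi> e R
        ops_bmk lin_simps bmk_0[symmetric] sc_zero)
qed

text \<open>With \<open>p = (z, x, y, m, 1 - z)\<close> and \<open>g = (t, x', y', m', s)\<close>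
  the result is \<open>g + P p - B q\<close>, where \<open>q\<close> exchanges the first and last
  entries of \<open>p\<close> and negates the others. So the operator is 2 on \<open>p\<close>, 0 on
  \<open>q\<close>, and 1 where \<open>P = B = 0\<close>; only the last part belongs to
  \<open>E\<close>.\<close>

lemma vp_vm_vp:
  assumes m: "u10 m" and m': "u10 m'" and q: "x * y - mu m = z * (1 - z)"
    and b_def: "b = x * y' + x' * y - bmu m m'"
    and P_def: "P = z * t + (1 - z) * s + b" and B_def: "B = z * s + (1 - z) * t - b"
  shows "lbr (vp z x y m (1 - z)) (lbr (vm z x y m (1 - z)) (vp t x' y' m' s)) =
    vp (t + P * z - B * (1 - z)) (x' + (P + B) * x) (y' + (P + B) * y) (m' + (P + B) \<cdot> m) (s + P * (1 - z) - B * z)"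
proof -
  note R = u10_rules[OF m m'] u10_rules[OF m' m] u10_rules[OF m m] u10_rules[OF m' m'] trc_cE_crs cE_cE
  have n: "u10 (s \<cdot> m + z \<cdot> m')" using m m' by (intro u10_lin)
  have mm: "bmu m m = 2 * mu m" using u10_sq[OF m] by (simp add: bmu_def)
  have mq: "bmu m m = 2 * (x * y - z * (1 - z))" using q by (simp add: mm algebra_simps)
  have PB: "P + B = t + s" by (simp add: P_def B_def algebra_simps)
  define f where "f = osc ((1 - z) * s) (id - Dop cE cE - Gop) - (osc (x' * y) Gop - osc (bmu m' m) id + Phi (crs cE (x \<cdot> m' - x' \<cdot> m))
       + Psi (y \<cdot> m' - y' \<cdot> m) + osc (x * y') (Dop cE cE) + Dop (crs cE m) m') - osc (t * z) id"
  have bf: "blin f" unfolding f_def by (intro blin_add blin_diff blin_osc blin_ops)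
  have d: "Dop cE (y \<cdot> m' - y' \<cdot> m) = 0" using m m' by (intro Dop_cE_u10 u10_rules(14) u10_lin)
  have c: "cmt (Phi cE) f = osc (2 * (1 - z) * s + b) (Phi cE)"
    unfolding f_def
    by (simp add: cmt_add cmt_diff cmt_osc cmt_minus blin_ops cmt_id cmt_ops cmt_ops' cmt_ops'' R lin_simps sc_one sc_zero d
       ops_0 osc_0 ops_minus osc_minus ops_sc b_def)
      (simp add: fun_eq_iff bmu_comm[of m' m] algebra_simps)
  have l: "lam f = - b - 2 * t * z"
    unfolding f_def by (simp add: lam_lin lam_ops R b_def bmu_comm[of m' m] algebra_simps)
  have fX: "f (bmk x (y \<cdot> cE) m 0) = bmk ((- (1 - z) * s - t * z) * x - 2 * (x * y - mu m) * x')
     (((- (1 - z) * s - t * z) * y - 2 * (x * y - mu m) * y') \<cdot> cE)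
     ((- (1 - z) * s - t * z) \<cdot> m - (2 * (x * y - mu m)) \<cdot> m') 0"
    unfolding f_def
    by (simp add: ops_bmk R lin_simps mm bmk_add bmk_diff bmk_sc bmk_minus)
      (simp add: fun_eq_iff bmu_comm[of m' m] algebra_simps)
  show ?thesis
    unfolding vm_vp[OF m m'] f_def[symmetric] lbr_vp[OF m n bf] c fX[unfolded q] l
    by (simp add: vp_def psi_def ops_bmk bmk_add bmk_diff bmk_sc R lin_simps)
      (simp add: fun_eq_iff PB P_def B_def b_def bmu_lin mq algebra_simps)
qed

subsection \<open>Extremality\<close>

lemma Phi_X: "u10 m \<Longrightarrow> Phi cE (bmk x (y \<cdot> cE) m 0) = 0"
  by (simp add: ops_bmk u10_rules lin_simps cE_cE sc_zero bmk_0[symmetric])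

lemma Phi_Phi: "Phi cE (Phi cE w) = 0"
  by (simp add: Phi_def cE_cE trc_cE_crs sc_zero lin_simps bmk_0[symmetric])

lemma Phi_jm: "Phi cE (jm w) = - jm (Phi cE w)"
  by (simp add: Phi_def jm_def lin_simps bmk_minus sc_minus)

text \<open>Up to the factor \<open>-2\<close> this is the extremal form of \<open>Phi cE\<close> on \<open>L\<^sub>0\<close>.\<close>

definition kap :: "('a::comm_ring_1 brown \<Rightarrow> 'a brown) \<Rightarrow> 'a" where
  "kap f = f (bmk 1 0 0 0) (A2 (Dg I1))"

lemma kap_lin: "kap (f + g) = kap f + kap g" "kap (osc r f) = r * kap f"
  and kap_ops: "kap Gop = 0" "kap id = 0" "kap (Phi c) = 0" "kap (Psi c) = c (Dg I1)" "kap (Dop a b) = 0"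
  by (simp_all add: kap_def ops_bmk lin_simps)

lemma trc_sandwich:
  assumes m: "u10 m"
  shows "trc cE (crs a (crs b m)) = trc a m * b (Dg I1)" "trc m (crs b (crs a cE)) = trc a m * b (Dg I1)"
proof -
  have "trc cE (crs a (crs b m)) = trc (crs cE a) (crs b m)" by (simp only: trc_crs)
  also have "\<dots> = trc (crs m b) (crs cE a)" by (simp only: trc_comm[of "crs cE a"] crs_comm[of b])
  also have "\<dots> = trc (crs cE (crs m b)) a" by (simp only: trc_crs[symmetric] crs_comm[of "crs m b"])
  also have "\<dots> = trc a m * b (Dg I1)" by (simp add: cE_crs_u10[OF m] lin_simps trc_comm[of m])
  finally show "trc cE (crs a (crs b m)) = trc a m * b (Dg I1)" .
  have "trc m (crs b (crs a cE)) = trc (crs m b) (crs a cE)" by (simp only: trc_crs)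
  also have "\<dots> = trc (crs (crs m b) cE) a" by (simp only: trc_crs crs_comm[of a])
  also have "\<dots> = trc a m * b (Dg I1)" by (simp add: cE_crs_u10[OF m] crs_comm[of _ cE] lin_simps trc_comm[of m])
  finally show "trc m (crs b (crs a cE)) = trc a m * b (Dg I1)" .
qed

text \<open>Contributions of a degree 0 element \<open>g\<close> to the double bracket with
  \<open>vp\<close>. They are all governed by the one scalar \<open>kap g\<close>, which is why it
  appears in the extremal form.\<close>

lemma kap_X:
  assumes m: "u10 m" and g: "g \<in> L0T"
  shows "Phi cE (g (bmk x (y \<cdot> cE) m 0)) = kap g \<cdot> bmk x (y \<cdot> cE) m 0"
    and "psi (bmk x (y \<cdot> cE) m 0) (g (bmk x (y \<cdot> cE) m 0)) = 2 * (x * y - mu m) * kap g"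
proof -
  let ?X = "bmk x (y \<cdot> cE) m 0"
  have bl: "blin (Phi cE)" by (rule blin_ops)
  have cc: "crs p cE = crs cE p" for p by (rule crs_comm)
  have md: "m (Dg I1) = 0" using m by (simp add: u10_def)
  have p1: "trc m (crs p m) = 2 * mu m * p (Dg I1)" for p
    using u10_sq[OF m] trc_crs[of m m p] by (simp add: crs_comm[of p] lin_simps trc_cE)
  have c1: "crs cE (crs p m) = p (Dg I1) \<cdot> m" for p
    using cE_crs_u10[OF m, of p] by (simp add: crs_comm[of p])
  have 0: "Phi cE (g ?X) = kap g \<cdot> ?X \<and> psi ?X (g ?X) = 2 * (x * y - mu m) * kap g"
    using g
  proof (rule L0T_gen)
    fix f g :: "'a brown \<Rightarrow> 'a brown"
    assume "Phi cE (f ?X) = kap f \<cdot> ?X \<and> psi ?X (f ?X) = 2 * (x * y - mu m) * kap f"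
      "Phi cE (g ?X) = kap g \<cdot> ?X \<and> psi ?X (g ?X) = 2 * (x * y - mu m) * kap g"
    then show "Phi cE ((f + g) ?X) = kap (f + g) \<cdot> ?X \<and> psi ?X ((f + g) ?X) = 2 * (x * y - mu m) * kap (f + g)"
      by (simp add: kap_lin blinD[OF bl] psi_lin add_sc) (simp add: fun_eq_iff algebra_simps)
  next
    show "Phi cE (osc r Gop ?X) = kap (osc r Gop) \<cdot> ?X \<and> psi ?X (osc r Gop ?X) = 2 * (x * y - mu m) * kap (osc r Gop)" for r
      by (simp add: kap_lin kap_ops ops_bmk bmk_sc psi_def u10_rules[OF m m] lin_simps sc_zero bmk_0[symmetric])
    show "Phi cE (osc r id ?X) = kap (osc r id) \<cdot> ?X \<and> psi ?X (osc r id ?X) = 2 * (x * y - mu m) * kap (osc r id)" for r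
      by (simp add: kap_lin kap_ops ops_bmk bmk_sc psi_def u10_rules[OF m m] lin_simps sc_zero bmk_0[symmetric] cE_cE)
    show "Phi cE (Phi c ?X) = kap (Phi c) \<cdot> ?X \<and> psi ?X (Phi c ?X) = 2 * (x * y - mu m) * kap (Phi c)" for c
      by (simp add: kap_ops ops_bmk psi_def lin_simps sc_zero cc trc_cE_crs bmk_0[symmetric])
    show "Phi cE (Psi c ?X) = kap (Psi c) \<cdot> ?X \<and> psi ?X (Psi c ?X) = 2 * (x * y - mu m) * kap (Psi c)" for c
      by (simp add: kap_ops ops_bmk psi_def lin_simps p1 c1 trc_cE bmk_sc) (simp add: fun_eq_iff algebra_simps)
    show "Phi cE (Dop a b ?X) = kap (Dop a b) \<cdot> ?X \<and> psi ?X (Dop a b ?X) = 2 * (x * y - mu m) * kap (Dop a b)" for a b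
      by (simp add: kap_ops ops_bmk psi_def lin_simps trc_sandwich[OF m] cE_cE u10_rules[OF m m] sc_zero bmk_0[symmetric] trc_cE(2))
        (simp add: cc cE_crs_cE sc_sc bmk_0 mult.commute trc_comm[of m] trc_cE md)
  qed
  then show "Phi cE (g ?X) = kap g \<cdot> ?X" "psi ?X (g ?X) = 2 * (x * y - mu m) * kap g" by auto
qed

text \<open>Contributions of a degree -1 element \<open>w\<close>. The term with
  \<open>jm (Phi cE w)\<close> is not a multiple of \<open>u\<close>; in \<open>vp_extremal\<close>
  it cancels against terms with factor \<open>z * (1 - z)\<close> that arise from the degree 0 and
  degree 2 components of \<open>vp\<close>. This is where the equation of the quadric is
  used.\<close>

lemma Vq_X:
  assumes m: "u10 m" and u_def: "u = bmk x (y \<cdot> cE) m 0"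
  shows "Vq u w u + (2 * (x * y - mu m)) \<cdot> jm (Phi cE w) = (2 * lam (Vq u w)) \<cdot> u"
    and "cmt (Phi cE) (Vq u w) = Vq u (Phi cE w) - osc (2 * lam (Vq u w)) (Phi cE)"
proof -
  obtain w1 a b w2 where w: "w = bmk w1 a b w2" by (rule bmk_cases)
  have cc: "crs p cE = crs cE p" for p by (rule crs_comm)
  note R = u10_rules[OF m m] trc_cE_crs cE_cE
  have l: "lam (Vq u w) = x * w2 + y * b (Dg I1) + trc m a"
    by (simp add: lam_Vq u_def w lin_simps trc_cE)
  have V: "Vq u w = osc (x * w2) Gop + osc (trc m a) id + Phi (x \<cdot> a + (w1 * y) \<cdot> cE + crs m b)
     + Psi (w2 \<cdot> m + y \<cdot> crs cE a) + osc y (Dop cE b) - Dop a m"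
    by (simp add: u_def w Vq_bmk lin_simps sc_zero sc_sc ops_sc)
  have t0: "trc (crs cE a) m = trc a (crs cE m)"
    by (simp only: crs_comm[of cE a] trc_crs)
  have t: "trc (crs m b) m = 2 * mu m * b (Dg I1)" "crs (crs m b) cE = b (Dg I1) \<cdot> m"
    using u10_sq[OF m] trc_crs[of m b m] trc_crs[of b m m] cE_crs_u10[OF m, of b]
    by (simp_all add: crs_comm[of m b] lin_simps trc_cE crs_comm[of _ cE] trc_crs)
  have mm: "bmu m m = 2 * mu m" using u10_sq[OF m] by (simp add: bmu_def)
  have md: "m (Dg I1) = 0" "crs cE a (Dg I1) = 0" using m by (simp_all add: u10_def crs_cE)
  have t1: "crs a cE = crs cE a" "crs b cE = crs cE b" "crs m (crs cE a) = trc m a \<cdot> cE" "crs (crs cE a) m = trc m a \<cdot> cE"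
    "crs cE (crs b m) = b (Dg I1) \<cdot> m" "crs cE (crs m b) = b (Dg I1) \<cdot> m" "trc cE p = p (Dg I1)" "trc p cE = p (Dg I1)" "trc a m = trc m a"
    for p
    using u10_crs_cE[OF m, of a] cE_crs_u10[OF m, of b]
    by (simp_all add: crs_comm[of _ cE] crs_comm[of _ m] trc_cE trc_comm[of a])
  show "Vq u w u + (2 * (x * y - mu m)) \<cdot> jm (Phi cE w) = (2 * lam (Vq u w)) \<cdot> u"
    unfolding l unfolding V by (simp add: u_def w ops_bmk R lin_simps t t0 t1 md mm bmk_add bmk_diff bmk_sc jm_bmk sc_zero)
      (simp add: fun_eq_iff algebra_simps)
  show "cmt (Phi cE) (Vq u w) = Vq u (Phi cE w) - osc (2 * lam (Vq u w)) (Phi cE)"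
    unfolding l unfolding V
    by (simp add: u_def w ops_bmk Vq_bmk cmt_add cmt_diff cmt_osc cmt_minus blin_ops cmt_id cmt_ops cmt_ops' cmt_ops''
        R lin_simps t t0 t1 md mm ops_add ops_sc ops_minus ops_0 sc_zero osc_0 Dop_cE_u10[OF u10_cE])
      (simp add: fun_eq_iff algebra_simps)
qed

lemma Vq_X_jX:
  assumes m: "u10 m"
  shows "Vq (bmk x (y \<cdot> cE) m 0) (jm (bmk x (y \<cdot> cE) m 0)) = osc (2 * (x * y - mu m)) (Phi cE)"
proof -
  have "x \<cdot> y \<cdot> cE + x \<cdot> y \<cdot> cE + crs m (- m) = (2 * (x * y - mu m)) \<cdot> cE"
    using u10_sq[OF m] by (simp add: lin_simps) (simp add: fun_eq_iff algebra_simps)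
  then show ?thesis
    by (simp add: jm_bmk Vq_bmk lin_simps u10_rules[OF m m] cE_cE ops_sc ops_minus sc_zero ops_0 osc_0)
qed

lemma cmt_0: "blin f \<Longrightarrow> cmt f 0 = 0" "blin f \<Longrightarrow> cmt 0 f = 0"
  by (simp_all add: fun_eq_iff cmt_apply blinD)

lemma cmt_Phi_Phi:
  assumes "g \<in> L0T"
  shows "cmt (Phi cE) (cmt (Phi cE) g) = osc (- (2 * kap g)) (Phi cE)" and "lam (cmt (Phi cE) g) = 0"
proof -
  have cc: "crs p cE = crs cE p" for p by (rule crs_comm)
  have "cmt (Phi cE) (cmt (Phi cE) g) = osc (- (2 * kap g)) (Phi cE) \<and> lam (cmt (Phi cE) g) = 0"
    using assms
  proof (rule L0T_gen)
    show "cmt (Phi cE) (cmt (Phi cE) (f + g)) = osc (- (2 * kap (f + g))) (Phi cE) \<and> lam (cmt (Phi cE) (f + g)) = 0"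
      if "cmt (Phi cE) (cmt (Phi cE) f) = osc (- (2 * kap f)) (Phi cE) \<and> lam (cmt (Phi cE) f) = 0"
      "cmt (Phi cE) (cmt (Phi cE) g) = osc (- (2 * kap g)) (Phi cE) \<and> lam (cmt (Phi cE) g) = 0" for f g :: "'a brown \<Rightarrow> 'a brown"
      using that by (simp add: cmt_add blin_ops kap_lin lam_lin distrib_left add_osc diff_osc osc_minus)
  next
    show "cmt (Phi cE) (cmt (Phi cE) (osc r Gop)) = osc (- (2 * kap (osc r Gop))) (Phi cE) \<and> lam (cmt (Phi cE) (osc r Gop)) = 0" for r
      by (simp add: cmt_add cmt_diff cmt_osc cmt_minus blin_ops cmt_id cmt_ops cmt_ops' cmt_ops'' kap_lin kap_ops lam_lin lam_ops
      osc_0 osc_minus lin_simps cE_cE trc_cE sc_zero ops_sc ops_0 add_osc ops_minus diff_osc osc_1 ops_add cmt_0)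
    show "cmt (Phi cE) (cmt (Phi cE) (osc r id)) = osc (- (2 * kap (osc r id))) (Phi cE) \<and> lam (cmt (Phi cE) (osc r id)) = 0" for r
      by (simp add: cmt_add cmt_diff cmt_osc cmt_minus blin_ops cmt_id cmt_ops cmt_ops' cmt_ops'' kap_lin kap_ops lam_lin lam_ops
      osc_0 osc_minus lin_simps cE_cE trc_cE sc_zero ops_sc ops_0 add_osc ops_minus diff_osc osc_1 ops_add cmt_0)
    show "cmt (Phi cE) (cmt (Phi cE) (Phi c)) = osc (- (2 * kap (Phi c))) (Phi cE) \<and> lam (cmt (Phi cE) (Phi c)) = 0" for c
      by (simp add: cmt_add cmt_diff cmt_osc cmt_minus blin_ops cmt_id cmt_ops cmt_ops' cmt_ops'' kap_lin kap_ops lam_lin lam_ops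
      osc_0 osc_minus lin_simps cE_cE trc_cE sc_zero ops_sc ops_0 add_osc ops_minus diff_osc osc_1 ops_add cmt_0)
    show "cmt (Phi cE) (cmt (Phi cE) (Psi c)) = osc (- (2 * kap (Psi c))) (Phi cE) \<and> lam (cmt (Phi cE) (Psi c)) = 0" for c
      by (simp add: cmt_add cmt_diff cmt_osc cmt_minus blin_ops cmt_id cmt_ops cmt_ops' cmt_ops'' kap_lin kap_ops lam_lin lam_ops
      osc_0 osc_minus lin_simps cE_cE trc_cE sc_zero ops_sc ops_0 add_osc ops_minus diff_osc osc_1 ops_add cmt_0)
      (simp add: fun_eq_iff algebra_simps)
    show "cmt (Phi cE) (cmt (Phi cE) (Dop a b)) = osc (- (2 * kap (Dop a b))) (Phi cE) \<and> lam (cmt (Phi cE) (Dop a b)) = 0" for a b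
      by (simp add: cmt_add cmt_diff cmt_osc cmt_minus blin_ops cmt_id cmt_ops cmt_ops' cmt_ops'' kap_lin kap_ops lam_lin lam_ops
      osc_0 osc_minus lin_simps cE_cE trc_cE sc_zero ops_sc ops_0 add_osc ops_minus diff_osc osc_1 ops_add cmt_0)
  qed
  then show "cmt (Phi cE) (cmt (Phi cE) g) = osc (- (2 * kap g)) (Phi cE)" "lam (cmt (Phi cE) g) = 0" by auto
qed

lemma psi_diff: "psi p (q - r) = psi p q - psi p r"
  using psi_lin(2)[of p "q - r" r] by simp



text \<open>The scalar pairs the components of \<open>vp\<close>, of degrees 2, 1 and 0, with
  \<open>a\<close>, \<open>w\<close> and \<open>g\<close> of opposite degrees; \<open>v\<close> and
  \<open>b\<close> lie too high to contribute.\<close>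

lemma vp_extremal:
  assumes m: "u10 m" and q: "x * y - mu m = z * (1 - z)" and g: "g \<in> L0T"
  shows "lbr (vp z x y m (1 - z)) (lbr (vp z x y m (1 - z)) (a, w, g, v, b)) =
    lsc (- 2 * (z * a + lam (Vq (bmk x (y \<cdot> cE) m 0) w) + (1 - z) * kap g)) (vp z x y m (1 - z))"
proof -
  define u where "u = bmk x (y \<cdot> cE) m 0"
  have bg: "blin g" using g by (rule L0T_blin)
  have b\<Phi>: "blin (Phi cE)" by (rule blin_ops)
  define f where "f = osc (1 - z) (Phi cE)"
  have bf: "blin f" unfolding f_def by (intro blin_osc blin_ops)
  have fu: "f u = 0" using m by (simp add: f_def u_def Phi_X sc_zero)
  have ef: "eps f = - f" by (simp add: f_def eps_lin eps_ops osc_minus)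
  have lf: "lam f = 0" by (simp add: f_def lam_lin lam_ops)
  have fju: "f (jm u) = 0" using m by (simp add: f_def u_def Phi_jm Phi_X jm_lin sc_minus sc_zero)
  have ff: "f (f p) = 0" for p by (simp add: f_def blinD[OF b\<Phi>] Phi_Phi sc_zero)
  have fj: "f (jm p) = - jm (f p)" for p by (simp add: f_def Phi_jm jm_lin sc_minus)
  have psj: "psi u (jm w) = - lam (Vq u w)" by (simp add: psi_def lam_Vq jm_def lin_simps u_def)
  have psf: "psi u (f v) = 0" for v 
  proof -
    have "psi u (Phi cE v) = 0"
      using m by (simp add: psi_def u_def Phi_def lin_simps trc_cE_crs u10_rules)
    then show ?thesis by (simp add: f_def psi_lin)
  qed
  have in1: "lbr (vp z x y m (1 - z)) (a, w, g, v, b) =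
    (0, - f w - a \<cdot> jm u, cmt f g + Vq u w + osc (z * a) id, f v - g u + z \<cdot> jm w, psi u v - lam g * z)"
    if "blin g" for a w g v b
    using that by (simp add: vp_def f_def[symmetric] u_def[symmetric] ef lf lam_lin psi_lin Vq_0 eps_lin jm_lin sc_zero
       zero_fun_def[symmetric] eps_def[of g] blinD)
  define g' where "g' = cmt f g + Vq u w + osc (z * a) id"
  have bg': "blin g'" unfolding g'_def cmt_def by (intro blin_add blin_diff blin_comp blin_osc blin_ops Vq_blin bf bg)
  have gu: "f (g u) = (1 - z) \<cdot> kap g \<cdot> u" using kap_X(1)[OF m g] by (simp add: f_def u_def)
  have pgu: "psi u (g u) = 2 * (x * y - mu m) * kap g" using kap_X(2)[OF m g] by (simp add: u_def)
  have Vu: "Vq u w u = (2 * lam (Vq u w)) \<cdot> u - (2 * (x * y - mu m)) \<cdot> jm (Phi cE w)"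
    using Vq_X(1)[OF m u_def] by (simp add: eq_diff_eq)
  have Vju: "Vq u (jm u) = osc (2 * (x * y - mu m)) (Phi cE)" using Vq_X_jX[OF m] by (simp add: u_def)
  have lg': "lam g' = lam (Vq u w) + 2 * (z * a)"
    using cmt_Phi_Phi(2)[OF g] by (simp add: g'_def f_def lam_lin lam_ops cmt_osc bg)
  have bc: "blin (cmt (Phi cE) g)" unfolding cmt_def by (intro blin_diff blin_comp bg b\<Phi>)
  have cg': "cmt f g' = osc ((1 - z) * (1 - z) * (- 2 * kap g)) (Phi cE) + osc (1 - z) (Vq u (Phi cE w) - osc (2 * lam (Vq u w)) (Phi cE))"
    using cmt_Phi_Phi(1)[OF g] Vq_X(2)[OF m u_def, of w]
    by (simp add: g'_def f_def cmt_add cmt_osc bg b\<Phi> bc Vq_blin blin_osc blin_ops cmt_id osc_0 osc_osc)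
       (simp add: fun_eq_iff algebra_simps)
  show ?thesis
    unfolding in1[OF bg] g'_def[symmetric] in1[OF bg']
    apply (simp add: vp_def u_def[symmetric] cg' lg')
    apply (intro conjI)
    subgoal by (simp add: blinD[OF bf] ff fju sc_zero)
    subgoal by (simp add: f_def Vq_diff Vq_minus Vq_sc Vju q) (simp add: fun_eq_iff algebra_simps)
    subgoal by (simp add: blinD[OF bf] ff gu fu fj g'_def cmt_apply Vu q jm_lin sc_zero blinD[OF bg])
       (simp add: f_def fun_eq_iff jm_lin algebra_simps)
    subgoal by (simp add: psi_lin psi_diff psj psf pgu q) (simp add: algebra_simps)
    done
qed


text \<open>\<open>lam\<close> is a character of \<open>L0T\<close>. Hence the scalar shift in
  \<open>eps\<close> respects commutators, which gives \<open>eps_cmt\<close>.\<close>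

lemma lam_cmt: "f \<in> L0T \<Longrightarrow> g \<in> L0T \<Longrightarrow> lam (cmt f g) = 0"
proof -
  note bl = blin_ops L0T_blin
  have Phi: "lam (cmt g (Phi c)) = 0" if "g \<in> L0T" for g and c :: "'a alb"
    using that by (rule L0T_gen)
      (auto simp del: fun_applies simp: bl cmt_add cmt_osc cmt_id cmt_ops cmt_ops' cmt_Dop lam_lin lam_ops trc_comm)
  have Psi: "lam (cmt g (Psi c)) = 0" if "g \<in> L0T" for g and c :: "'a alb"
    using that by (rule L0T_gen)
      (auto simp del: fun_applies simp: bl cmt_add cmt_osc cmt_id cmt_ops cmt_ops' cmt_Dop lam_lin lam_ops)
  have Gop: "lam (cmt g Gop) = 0" if "g \<in> L0T" for g :: "'a brown \<Rightarrow> 'a brown"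
    using that by (rule L0T_gen)
      (auto simp del: fun_applies simp: bl cmt_add cmt_osc cmt_id cmt_ops' osc_0 lam_lin lam_ops)
  have Dop: "lam (cmt g (Dop c d)) = 0" if "g \<in> L0T" for g and c d :: "'a alb"
  proof -
    have 1: "Dop c d = cmt (Phi c) (Psi d) + (osc (trc c d) id - osc (trc c d) Gop)"
      by (simp add: cmt_ops)
    have "lam (cmt (cmt g (Phi c)) (Psi d)) = 0" by (intro Psi cmt_L0T ops_L0T that)
    moreover have "lam (cmt (cmt g (Psi d)) (Phi c)) = 0" by (intro Phi cmt_L0T ops_L0T that)
    ultimately show ?thesis using that Gop[OF that]
      unfolding 1 by (simp add: bl cmt_add cmt_diff cmt_osc cmt_id cmt_jacobi lam_lin
        cmt_swap[of "Phi c" "cmt g (Psi d)"])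
  qed
  show "g \<in> L0T \<Longrightarrow> lam (cmt f g) = 0" if "f \<in> L0T"
    by (erule L0T_gen) (auto simp del: fun_applies simp: bl that cmt_add cmt_osc cmt_id osc_0 lam_lin Phi Psi Gop Dop)
qed

section \<open>Reversal of the grading\<close>

definition sw :: "'a brown \<Rightarrow> 'a brown" where
  "sw x = bmk (x R2) (x \<circ> A2) (x \<circ> A1) (x R1)"

lemma sw_bmk: "sw (bmk r a b s) = bmk s b a r"
  by (simp add: sw_def)

lemma sw_sw [simp]: "sw (sw x) = x"
  by (simp add: sw_def)

lemma blin_sw: "blin sw"
  by (simp add: blin_def sw_def comp_add comp_sc bmk_add bmk_sc)

text \<open>\<open>sw\<close> is an automorphism of the Brown algebra that commutes with the
  involution and sends \<open>j\<close> to its negative; the signs in \<open>tau\<close> and in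
  \<open>psi_sw\<close> come from this.\<close>

lemma sw_jm: "jm (sw x) = - sw (jm x)"
  by (simp add: sw_def jm_def bmk_minus)

lemma sw_star: "star (sw x) = sw (star x)"
  by (rule bmk_cases[of x]) (simp add: sw_bmk star_bmk)

lemma sw_bml: "bml (sw x) (sw y) = sw (bml x y)"
  by (rule bmk_cases[of x], rule bmk_cases[of y]) (simp add: sw_bmk bml_bmk)

definition swo :: "('a::comm_ring_1 brown \<Rightarrow> 'a brown) \<Rightarrow> 'a brown \<Rightarrow> 'a brown" where
  "swo f z = sw (f (sw z))"

lemma swo_sw: "swo f (sw z) = sw (f z)"
  by (simp add: swo_def)

lemma swo_lin: "swo (f + g) = swo f + swo g" "swo (f - g) = swo f - swo g" "swo (- f) = - swo f"
   "swo (osc r f) = osc r (swo f)" "swo 0 = 0" "swo id = id" "swo (swo f) = f"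
  by (simp_all add: swo_def fun_eq_iff[of "swo _"] blinD[OF blin_sw])

lemma swo_ops: "swo (Phi c) = Psi c" "swo (Psi c) = Phi c"
  by (simp_all add: swo_def fun_eq_iff[of "swo _"] Phi_def Psi_def sw_bmk) (simp_all add: sw_def)

lemma swo_Vq: "swo (Vq x y) = Vq (sw x) (sw y)"
proof
  fix z
  have "Vq (sw x) (sw y) (sw (sw z)) = sw (Vq x y (sw z))"
    unfolding Vq_def sw_star sw_bml by (simp add: blinD[OF blin_sw])
  then show "swo (Vq x y) z = Vq (sw x) (sw y) z" by (simp add: swo_def)
qed

lemma swo_L0T: "f \<in> L0T \<Longrightarrow> swo f \<in> L0T"
  by (erule L0T_induct) (auto simp del: fun_applies simp: swo_lin swo_Vq intro: L0T_0 L0T_Vq)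

lemma lam_swo: "lam (swo f) = lam f"
  by (simp add: lam_def swo_def sw_bmk) (simp add: sw_def)

lemma eps_swo: "blin f \<Longrightarrow> eps (swo f) = swo (eps f)"
  by (rule ext) (simp add: eps_def lam_swo swo_def sw_jm blinD blinD[OF blin_sw] jm_lin del: fun_applies)

lemma lam_eps: "blin f \<Longrightarrow> lam (eps f) = - lam f"
proof -
  assume f: "blin f"
  have "bmk 0 0 0 (- 1 :: 'a) = - bmk 0 0 0 1" by (simp add: bmk_minus)
  then show ?thesis by (simp add: lam_def eps_def jm_bmk blinD[OF f]) (simp add: jm_def algebra_simps)
qed

lemma eps_eps: "blin f \<Longrightarrow> eps (eps f) = f"
  by (rule ext) (simp add: lam_eps eps_def[of "eps f"] sc_minus, simp add: eps_def jm_lin blinD)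

lemma eps_cmt: "f \<in> L0T \<Longrightarrow> g \<in> L0T \<Longrightarrow> eps (cmt f g) = cmt (eps f) (eps g)"
  by (rule ext) (simp add: lam_cmt eps_def cmt_apply jm_lin blinD L0T_blin sc_zero del: fun_applies,
    simp add: fun_eq_iff algebra_simps)

lemma swo_cmt: "swo (cmt f g) = cmt (swo f) (swo g)"
  by (simp add: fun_eq_iff[of "swo _"] swo_def cmt_apply blinD[OF blin_sw])

lemma psi_sw: "psi (sw x) (sw y) = - psi x y"
  by (simp add: psi_def sw_def)

text \<open>An automorphism reversing the grading; it reduces statements on \<open>vm\<close> to statements on \<open>vp\<close>.\<close>

fun tau :: "'a::comm_ring_1 lie \<Rightarrow> 'a lie" where
  "tau (a, x, f, y, b) = (- b, sw y, swo (eps f), sw x, - a)"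

lemma tau_LT: "p \<in> LT \<Longrightarrow> tau p \<in> LT"
  by (cases p) (simp add: swo_L0T eps_L0T)

lemma tau_tau: "p \<in> LT \<Longrightarrow> tau (tau p) = p"
  by (cases p) (simp add: eps_swo eps_eps L0T_blin L0T_eps_blin swo_lin)

lemma tau_lin: "tau (- p) = - tau p" "tau (lsc r p) = lsc r (tau p)"
  by (cases p; simp add: blinD[OF blin_sw] eps_lin swo_lin)+

lemma tau_lbr: "p \<in> LT \<Longrightarrow> q \<in> LT \<Longrightarrow> lbr (tau p) (tau q) = tau (lbr p q)"
  by (cases p; cases q)
    (simp add: eps_swo eps_eps L0T_blin L0T_eps_blin swo_lin lam_swo psi_sw blinD[OF blin_sw] eps_lin eps_ops
      swo_cmt eps_cmt eps_Vq swo_Vq sw_jm sc_minus swo_sw, simp add: fun_eq_iff algebra_simps)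

lemma lbr_minus: "p \<in> LT \<Longrightarrow> q \<in> LT \<Longrightarrow> lbr (- p) q = - lbr p q" "p \<in> LT \<Longrightarrow> q \<in> LT \<Longrightarrow> lbr p (- q) = - lbr p q"
  using lbr_lsc[of p q "- 1"] lbr_lsc2[of q p "- 1"] by (simp_all add: lsc_minus lsc_1)

text \<open>Replacing \<open>x\<close>, \<open>y\<close>, \<open>m\<close> by \<open>- y\<close>,
  \<open>- x\<close>, \<open>crs cE m\<close> preserves \<open>x * y - mu m\<close> and the polar
  form, so every identity for one member of the pair carries over to the other.\<close>

lemma tau_vp: "u10 m \<Longrightarrow> vm t x y m s = - tau (vp t (- y) (- x) (crs cE m) s)"
  by (simp add: vp_def vm_def sw_bmk eps_lin eps_ops swo_lin swo_ops bmk_minus sc_minus osc_minus blinD(5)[OF blin_sw])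

lemma tau_vm: "u10 m \<Longrightarrow> vp t x y m s = - tau (vm t (- y) (- x) (crs cE m) s)"
  by (simp add: vp_def vm_def sw_bmk eps_lin eps_ops swo_lin swo_ops bmk_minus sc_minus osc_minus blinD(5)[OF blin_sw] cE_cE_u10)

lemma mu_cE: "u10 m \<Longrightarrow> mu (crs cE m) = mu m"
  by (simp add: mu_def crs_cE onrm_def algebra_simps)

lemma bmu_cE: "u10 m \<Longrightarrow> u10 n \<Longrightarrow> bmu (crs cE m) (crs cE n) = bmu m n"
  by (simp add: bmu_def) (simp add: crs_cE crs_Dg opol_def)

lemma vm_vp_vm:
  assumes m: "u10 m" and m': "u10 m'" and q: "x * y - mu m = z * (1 - z)"
    and b_def: "b = x * y' + x' * y - bmu m m'"
    and P_def: "P = z * t + (1 - z) * s + b" and B_def: "B = z * s + (1 - z) * t - b"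
  shows "lbr (vm z x y m (1 - z)) (lbr (vp z x y m (1 - z)) (vm t x' y' m' s)) =
    vm (t + P * z - B * (1 - z)) (x' + (P + B) * x) (y' + (P + B) * y) (m' + (P + B) \<cdot> m) (s + P * (1 - z) - B * z)"
proof -
  have n: "u10 (crs cE m)" "u10 (crs cE m')" by (rule u10_cE)+
  have q': "(- y) * (- x) - mu (crs cE m) = z * (1 - z)" using q by (simp add: mu_cE[OF m] mult.commute)
  have b': "b = (- y) * (- x') + (- y') * (- x) - bmu (crs cE m) (crs cE m')"
    by (simp add: b_def bmu_cE m m' algebra_simps)
  have u: "u10 (m' + (P + B) \<cdot> m)" using m m' by (intro u10_lin)
  show ?thesis
    unfolding tau_vp[OF m] tau_vp[OF m'] tau_vp[OF u] tau_vm[OF m]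
    by (simp add: lbr_minus tau_LT vpm_LT LT_lbr LT_minus tau_lbr tau_lin)
      (simp add: vp_vm_vp[OF n q' b' P_def B_def] lin_simps)
qed

lemma vm_extremal:
  assumes m: "u10 m" and q: "x * y - mu m = z * (1 - z)" and u: "u \<in> LT"
  shows "\<exists>s. lbr (vm z x y m (1 - z)) (lbr (vm z x y m (1 - z)) u) = lsc s (vm z x y m (1 - z))"
proof -
  obtain a w g v b where t: "tau u = (a, w, g, v, b)" by (cases "tau u")
  then have g: "g \<in> L0T" using tau_LT[OF u] by simp
  have q': "(- y) * (- x) - mu (crs cE m) = z * (1 - z)" using q by (simp add: mu_cE[OF m] mult.commute)
  let ?p = "vp z (- y) (- x) (crs cE m) (1 - z)"
  have 1: "lbr (- tau ?p) (lbr (- tau ?p) (tau (tau u))) = tau (lbr ?p (lbr ?p (tau u)))"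
    by (simp add: lbr_minus tau_LT vpm_LT LT_lbr LT_minus tau_lbr u)
  obtain s where "lbr ?p (lbr ?p (tau u)) = lsc s ?p"
    unfolding t using vp_extremal[OF u10_cE q' g] by blast
  then have "lbr (- tau ?p) (lbr (- tau ?p) u) = lsc (- s) (- tau ?p)"
    using 1 by (simp add: tau_tau u tau_lin lsc_minus lsc_minus2)
  then show ?thesis unfolding tau_vp[OF m] by blast
qed

subsection \<open>The spinor part\<close>

lemma ops_diff: "Phi (a - b) = Phi a - Phi b" "Psi (a - b) = Psi a - Psi b"
    "Dop (a - b) c = Dop a c - Dop b c" "Dop c (a - b) = Dop c a - Dop c b"
  using ops_add[of a "- b"] by (simp_all add: ops_minus ops_add(4)[of c a "- b", simplified])

text \<open>With all arguments in the 16-dimensional \<open>a23\<close> this has 64 parameters: the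
  half-spin module, of degree 1 in the grading for which \<open>vp\<close> has degree 2.\<close>

definition wp :: "'a::comm_ring_1 alb \<Rightarrow> 'a alb \<Rightarrow> 'a alb \<Rightarrow> 'a alb \<Rightarrow> 'a lie" where
  "wp a1 a2 b1 b2 = (0, 0, Phi b1 - Dop cE b2, bmk 0 a1 a2 0, 0)"

lemma wp_LT: "wp a1 a2 b1 b2 \<in> LT"
  by (simp add: wp_def L0T_diff ops_L0T)

lemma a23_rules:
  assumes m: "u10 m" and a: "a23 a"
  shows "crs cE a = 0" "crs a cE = 0" "trc cE a = 0" "trc a cE = 0" "trc m a = 0" "trc a m = 0"
    "trc (crs cE m) a = 0" "trc a (crs cE m) = 0"
    "crs a m = crs m a" "crs a (crs cE m) = crs (crs cE m) a"
    "crs m (crs (crs cE m) a) = mu m \<cdot> a" "crs (crs cE m) (crs m a) = mu m \<cdot> a"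
    "Dop (crs cE m) a = - Dop (crs m a) cE" "Dop a m = - Dop cE (crs (crs cE m) a)"
    "a23 (crs m a)" "a23 (crs (crs cE m) a)" "a (Dg I1) = 0"
  using a23_cE[OF a] a23_u10[OF a m] a23_u10[OF a u10_cE, of m] a23_sandwich[OF m a] Dop_a23[OF m a]
  by (simp_all add: crs_comm[of a] trc_comm[of a cE])

lemma vm_wp:
  assumes m: "u10 m" and a: "a23 a1" "a23 a2" "a23 b1" "a23 b2"
  shows "lbr (vm z x y m (1 - z)) (wp a1 a2 b1 b2) =
   (0, bmk 0 (y \<cdot> b1 + crs m b2 + z \<cdot> a1) (- (crs (crs cE m) b1 + x \<cdot> b2 + z \<cdot> a2)) 0,
    - Dop ((1 - z) \<cdot> b1 + x \<cdot> a1 - crs m a2) cE - Psi ((1 - z) \<cdot> b2 + y \<cdot> a2 - crs (crs cE m) a1), 0, 0)"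
proof -
  note R = a23_rules[OF m a(1)] a23_rules[OF m a(2)] a23_rules[OF m a(3)] a23_rules[OF m a(4)]
    u10_rules[OF m m] trc_cE_crs cE_cE
  have V: "Vq (bmk 0 a1 a2 0) (bmk 0 (- crs cE m) (x \<cdot> cE) y) =
     Psi (y \<cdot> a2 - crs (crs cE m) a1) + osc x (Dop a1 cE) - Dop (crs m a2) cE"
    unfolding Vq_bmk by (simp add: lin_simps R sc_zero osc_0 ops_0 ops_sc ops_minus ops_add ops_diff)
  show ?thesis
    unfolding vm_def wp_def lbr.simps V
    by (simp add: lam_lin eps_lin lam_ops eps_ops psi_lin Vq_0 osc_0 jm_lin jm_bmk cmt_osc cmt_diff blin_ops blin_osc blin_diff
        cmt_ops' cmt_ops'' R ops_bmk lin_simps bmk_sc bmk_add bmk_minus bmk_diff bmk_0[symmetric] sc_zero osc_minus osc_diff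
        ops_add ops_sc ops_minus ops_diff blinD(5) sc_one ops_0)
      (simp add: fun_eq_iff all_brown algebra_simps)
qed

lemma vp_vm_wp:
  assumes m: "u10 m" and a: "a23 a1" "a23 a2" "a23 b1" "a23 b2" and q: "x * y - mu m = z * (1 - z)"
  shows "lbr (vp z x y m (1 - z)) (lbr (vm z x y m (1 - z)) (wp a1 a2 b1 b2)) =
    wp (z \<cdot> a1 + y \<cdot> b1 + crs m b2) (z \<cdot> a2 + x \<cdot> b2 + crs (crs cE m) b1)
       ((1 - z) \<cdot> b1 + x \<cdot> a1 - crs m a2) ((1 - z) \<cdot> b2 + y \<cdot> a2 - crs (crs cE m) a1)"
proof -
  define p where "p = y \<cdot> b1 + crs m b2 + z \<cdot> a1"
  define r where "r = crs (crs cE m) b1 + x \<cdot> b2 + z \<cdot> a2"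
  define \<beta>1 where "\<beta>1 = (1 - z) \<cdot> b1 + x \<cdot> a1 - crs m a2"
  define \<beta>2 where "\<beta>2 = (1 - z) \<cdot> b2 + y \<cdot> a2 - crs (crs cE m) a1"
  note R0 = a23_rules[OF m a(1)] a23_rules[OF m a(2)] a23_rules[OF m a(3)] a23_rules[OF m a(4)]
  have c: "a23 p" "a23 r" "a23 \<beta>1" "a23 \<beta>2"
    unfolding p_def r_def \<beta>1_def \<beta>2_def by (intro a23_lin a R0)+
  note R = a23_rules[OF m c(1)] a23_rules[OF m c(2)] a23_rules[OF m c(3)] a23_rules[OF m c(4)]
    u10_rules[OF m m] trc_cE_crs cE_cE
  have V: "Vq (bmk x (y \<cdot> cE) m 0) (bmk 0 p (- r) 0) = Phi (x \<cdot> p - crs m r) - Dop cE (y \<cdot> r - crs (crs cE m) p)"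
    unfolding Vq_bmk by (simp add: lin_simps R sc_zero osc_0 ops_0 ops_sc ops_minus ops_add ops_diff)
  have mq: "mu m = x * y - z * (1 - z)" using q by (simp add: algebra_simps)
  \<comment> \<open>The equations \<open>e1\<close> to \<open>e4\<close> say that the matrix with
    rows \<open>p\<close>, \<open>r\<close>, \<open>\<beta>1\<close>, \<open>\<beta>2\<close> is
    idempotent. In blocks it is \<open>[[z, Q], [Q', 1 - z]]\<close>, and the Clifford relations
    give \<open>Q Q' = Q' Q = x y - mu m = z (1 - z)\<close>.\<close>
  have e1: "(1 - z) \<cdot> \<beta>1 + (x \<cdot> p - crs m r) = \<beta>1"
    unfolding p_def r_def \<beta>1_def by (simp add: lin_simps R0)
     (simp add: fun_eq_iff mq algebra_simps)
  have e2: "(1 - z) \<cdot> \<beta>2 + (y \<cdot> r - crs (crs cE m) p) = \<beta>2"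
    unfolding p_def r_def \<beta>2_def by (simp add: lin_simps R0)
     (simp add: fun_eq_iff mq algebra_simps)
  have e3: "crs m \<beta>2 + y \<cdot> \<beta>1 + z \<cdot> p = z \<cdot> a1 + y \<cdot> b1 + crs m b2"
    unfolding p_def \<beta>1_def \<beta>2_def by (simp add: lin_simps R0)
     (simp add: fun_eq_iff mq algebra_simps)
  have e4: "crs (crs cE m) \<beta>1 + x \<cdot> \<beta>2 + z \<cdot> r = z \<cdot> a2 + x \<cdot> b2 + crs (crs cE m) b1"
    unfolding r_def \<beta>1_def \<beta>2_def by (simp add: lin_simps R0)
     (simp add: fun_eq_iff mq algebra_simps)
  show ?thesis
    unfolding vm_wp[OF m a] p_def[symmetric] r_def[symmetric] \<beta>1_def[symmetric] \<beta>2_def[symmetric]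
    unfolding vp_def lbr.simps V
    apply (simp add: wp_def lam_lin eps_lin lam_ops eps_ops psi_lin Vq_0 osc_0 jm_lin jm_bmk cmt_osc cmt_diff cmt_minus blin_ops blin_osc blin_diff
        blin_minus cmt_ops cmt_ops' cmt_ops'' R ops_bmk lin_simps bmk_sc bmk_add bmk_minus bmk_diff bmk_0[symmetric] sc_zero osc_minus osc_diff
        ops_add ops_sc ops_minus ops_diff blinD(5) sc_one ops_0)
    apply (intro conjI)
    subgoal
    proof -
      have "osc (1 - z) (Phi \<beta>1) - osc (1 - z) (Dop cE \<beta>2) + (osc x (Phi p) - Phi (crs m r) - (osc y (Dop cE r) - Dop cE (crs (crs cE m) p)))
        = Phi ((1 - z) \<cdot> \<beta>1 + (x \<cdot> p - crs m r)) - Dop cE ((1 - z) \<cdot> \<beta>2 + (y \<cdot> r - crs (crs cE m) p))"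
        by (simp add: ops_add ops_diff ops_sc)
      then show ?thesis by (simp only: e1 e2)
    qed
    subgoal by (simp add: e3[symmetric] e4[symmetric] zero_fun_def[symmetric] sc_zero bmk_add bmk_minus bmk_diff)
    done
qed


section \<open>The idempotent matrix\<close>

text \<open>The space \<open>{u. [y\<^sub>1, [y\<^sub>2, u]] = u}\<close> of an extremal pair \<open>(y\<^sub>1, y\<^sub>2) = (vpv p, vmv p)\<close> is parametrized by 64 coordinates in the
  range of \<open>wpv\<close> and by 14 coordinates each in the ranges of \<open>vpv\<close> and \<open>[y\<^sub>1, vmv _]\<close>. In the last two families only the
  complement \<open>trp p\<close> of the span of \<open>p\<close> and \<open>ptil p\<close> is used; the four scalars lost in this way are the summand
  \<open>bool \<times> bool\<close> of \<open>jix\<close>.\<close>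

datatype blk = Ka1 | Ka2 | Kb1 | Kb2
datatype v14 = Vt | Vs | Vx | Vy | Vd bool | Vo oct_ix

type_synonym k64 = "blk \<times> bool \<times> oct_ix"
type_synonym kix = "k64 + v14 + v14"
type_synonym jix = "brown_ix + bool \<times> bool"

definition alb23 :: "(bool \<times> oct_ix \<Rightarrow> 'a::comm_ring_1) \<Rightarrow> 'a alb" where
  "alb23 g = (\<lambda>m. case m of Dg i \<Rightarrow> 0 | Of i k \<Rightarrow> (case i of I1 \<Rightarrow> 0 | I2 \<Rightarrow> g (True, k) | I3 \<Rightarrow> g (False, k)))"

definition alb10 :: "(v14 \<Rightarrow> 'a::comm_ring_1) \<Rightarrow> 'a alb" where
  "alb10 g = (\<lambda>m. case m of Dg i \<Rightarrow> (case i of I1 \<Rightarrow> 0 | I2 \<Rightarrow> g (Vd True) | I3 \<Rightarrow> g (Vd False))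
     | Of i k \<Rightarrow> (case i of I1 \<Rightarrow> g (Vo k) | I2 \<Rightarrow> 0 | I3 \<Rightarrow> 0))"

lemma alb_simps: "alb23 g (Dg i) = 0" "alb23 g (Of I1 k) = 0" "alb23 g (Of I2 k) = g (True, k)" "alb23 g (Of I3 k) = g (False, k)"
  "alb10 f (Dg I1) = 0" "alb10 f (Dg I2) = f (Vd True)" "alb10 f (Dg I3) = f (Vd False)"
  "alb10 f (Of I1 k) = f (Vo k)" "alb10 f (Of I2 k) = 0" "alb10 f (Of I3 k) = 0"
  by (simp_all add: alb23_def alb10_def)

lemma a23_alb23: "a23 (alb23 g)" and u10_alb10: "u10 (alb10 f)"
  by (simp_all add: a23_def u10_def alb_simps)

lemma alb_lin: "alb23 (g + g') = alb23 g + alb23 g'" "alb23 (r \<cdot> g) = r \<cdot> alb23 g"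
  "alb10 (f + f') = alb10 f + alb10 f'" "alb10 (r \<cdot> f) = r \<cdot> alb10 f" "alb10 (f - f') = alb10 f - alb10 f'"
  by (simp_all add: fun_eq_iff all_alb all_three alb_simps)

definition mlin :: "(('i \<Rightarrow> 'a::comm_ring_1) \<Rightarrow> ('k \<Rightarrow> 'a)) \<Rightarrow> bool" where
  "mlin A \<longleftrightarrow> (\<forall>x y. A (x + y) = A x + A y) \<and> (\<forall>r x. A (r \<cdot> x) = r \<cdot> A x)"

definition vpv :: "(v14 \<Rightarrow> 'a::comm_ring_1) \<Rightarrow> 'a lie" where "vpv g = vp (g Vt) (g Vx) (g Vy) (alb10 g) (g Vs)"
definition vmv :: "(v14 \<Rightarrow> 'a::comm_ring_1) \<Rightarrow> 'a lie" where "vmv g = vm (g Vt) (g Vx) (g Vy) (alb10 g) (g Vs)"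
definition wpv :: "(k64 \<Rightarrow> 'a::comm_ring_1) \<Rightarrow> 'a lie" where
  "wpv v = wp (alb23 (\<lambda>p. v (Ka1, p))) (alb23 (\<lambda>p. v (Ka2, p))) (alb23 (\<lambda>p. v (Kb1, p))) (alb23 (\<lambda>p. v (Kb2, p)))"

lemma vw_LT: "vpv g \<in> LT" "vmv g \<in> LT" "wpv v \<in> LT"
  by (simp_all add: vpv_def vmv_def wpv_def vpm_LT wp_LT)

lemma vw_lin: "vpv (g + g') = vpv g + vpv g'" "vpv (r \<cdot> g) = lsc r (vpv g)"
  "vmv (g + g') = vmv g + vmv g'" "vmv (r \<cdot> g) = lsc r (vmv g)"
  "wpv (v + v') = wpv v + wpv v'" "wpv (r \<cdot> v) = lsc r (wpv v)"
proof -
  show "vpv (g + g') = vpv g + vpv g'" "vpv (r \<cdot> g) = lsc r (vpv g)"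
    "vmv (g + g') = vmv g + vmv g'" "vmv (r \<cdot> g) = lsc r (vmv g)"
    by (simp_all add: vpv_def vmv_def vp_def vm_def alb_lin bmk_add bmk_sc add_osc add_sc osc_osc sc_sc lin_simps sc_minus sc_zero)
  have 1: "(\<lambda>p. (v + v') (k, p)) = (\<lambda>p. v (k, p)) + (\<lambda>p. v' (k, p))" "(\<lambda>p. (r \<cdot> v) (k, p)) = r \<cdot> (\<lambda>p. v (k, p))" for k
    by (simp_all add: fun_eq_iff)
  show "wpv (v + v') = wpv v + wpv v'" "wpv (r \<cdot> v) = lsc r (wpv v)"
    unfolding wpv_def 1 alb_lin by (simp_all add: wp_def bmk_add bmk_sc ops_add ops_sc osc_diff sc_zero)
qed

text \<open>A left inverse of \<open>wpv\<close>. Evaluating \<open>Phi b1 - Dop cE b2\<close> at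
  the corner \<open>bmk 0 0 0 1\<close> exposes \<open>b1\<close>, evaluating it at
  \<open>bmk 0 0 cE 0\<close> exposes \<open>b2\<close>.\<close>

fun to64 :: "'a::comm_ring_1 lie \<Rightarrow> k64 \<Rightarrow> 'a" where
  "to64 (a, x, f, y, b) (B, t, k) = (let i = (if t then I2 else I3) in
     case B of Ka1 \<Rightarrow> y (A1 (Of i k)) | Ka2 \<Rightarrow> y (A2 (Of i k))
       | Kb1 \<Rightarrow> f (bmk 0 0 0 1) (A1 (Of i k)) | Kb2 \<Rightarrow> f (bmk 0 0 cE 0) (A2 (Of i k)))"

fun to14p :: "'a::comm_ring_1 lie \<Rightarrow> v14 \<Rightarrow> 'a" where
  "to14p (a, x, f, y, b) k = (case k of Vt \<Rightarrow> b | Vs \<Rightarrow> f (bmk 0 0 0 1) (A1 (Dg I1)) | Vx \<Rightarrow> y R1 | Vy \<Rightarrow> y (A1 (Dg I1))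
     | Vd c \<Rightarrow> y (A2 (Dg (if c then I2 else I3))) | Vo k \<Rightarrow> y (A2 (Of I1 k)))"

text \<open>The diagonal coordinates are exchanged and negated because \<open>vm\<close> stores
  \<open>- crs cE m\<close> in place of \<open>m\<close>.\<close>

fun to14m :: "'a::comm_ring_1 lie \<Rightarrow> v14 \<Rightarrow> 'a" where
  "to14m (a, x, f, y, b) k = (case k of Vt \<Rightarrow> a | Vs \<Rightarrow> f (bmk 1 0 0 0) (A2 (Dg I1)) | Vx \<Rightarrow> x (A2 (Dg I1)) | Vy \<Rightarrow> x R2
     | Vd c \<Rightarrow> - x (A1 (Dg (if c then I3 else I2))) | Vo k \<Rightarrow> x (A1 (Of I1 k)))"

lemma to_lin:
  "to64 (p + q) = to64 p + to64 q" "to64 (lsc r p) = r \<cdot> to64 p"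
  "to14p (p + q) = to14p p + to14p q" "to14p (lsc r p) = r \<cdot> to14p p"
  "to14m (p + q) = to14m p + to14m q" "to14m (lsc r p) = r \<cdot> to14m p"
  by (cases p; cases q; auto simp: fun_eq_iff Let_def split: blk.split v14.split)+

lemma to_vw: "to64 (wpv v) = v" "to14p (vpv g) = g" "to14m (vmv g) = g" "to64 (vpv g) = 0" "to14p (wpv v) = 0"
proof -
  have c: "crs cE (alb23 f) = 0" "crs (alb23 f) cE = 0" "trc cE (alb23 f) = 0" "trc (alb23 f) cE = 0" for f :: "bool \<times> oct_ix \<Rightarrow> 'a"
    using a23_rules(1-4)[OF u10_alb10 a23_alb23] by auto
  show "to64 (wpv v) = v" "to14p (vpv g) = g" "to14m (vmv g) = g" "to64 (vpv g) = 0" "to14p (wpv v) = 0"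
    by (auto simp: fun_eq_iff Let_def wpv_def wp_def vpv_def vp_def vmv_def vm_def ops_bmk alb_simps c lin_simps sc_zero
      trc_cE crs_cE split: blk.split v14.split)
qed

text \<open>These separate the three families inside a sum: \<open>to64\<close> and
  \<open>to14p\<close> do not see the third family, and after bracketing with \<open>vmv p\<close>
  the form \<open>to14m\<close> does not see the first two.\<close>

lemma to_cross:
  assumes p: "p Vs = 1 - p Vt"
  shows "to14m (lbr (vmv p) (wpv v)) = 0" "to14m (lbr (vmv p) (vpv g)) = 0"
  "to64 (lbr (vpv p) (vmv g)) = 0" "to14p (lbr (vpv p) (vmv g)) = 0"
proof -
  have c: "crs cE (alb23 f) = 0" "crs (alb23 f) cE = 0" "trc cE (alb23 f) = 0" "trc (alb23 f) cE = 0" for f :: "bool \<times> oct_ix \<Rightarrow> 'a"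
    using a23_rules(1-4)[OF u10_alb10 a23_alb23] by auto
  have c2: "crs (alb10 f) (alb23 f') (Dg i) = 0" "crs (alb10 f) (alb23 f') (Of I1 k) = 0"
    "crs (crs cE (alb10 f)) (alb23 f') (Dg i) = 0" "crs (crs cE (alb10 f)) (alb23 f') (Of I1 k) = 0"
     for f :: "v14 \<Rightarrow> 'a" and f' i k
    using a23_u10(3)[OF a23_alb23[of f'] u10_alb10[of f]] a23_u10(3)[OF a23_alb23[of f'] u10_cE[of "alb10 f"]] by (auto simp: a23_def)
  show "to14m (lbr (vmv p) (wpv v)) = 0"
    unfolding vmv_def wpv_def p vm_wp[OF u10_alb10 a23_alb23 a23_alb23 a23_alb23 a23_alb23]
    by (auto simp: fun_eq_iff ops_bmk alb_simps c c2 lin_simps trc_cE split: v14.split)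
  note R = u10_rules[OF u10_alb10 u10_alb10] 
  show "to14m (lbr (vmv p) (vpv g)) = 0"
    unfolding vmv_def vpv_def p vm_vp[OF u10_alb10 u10_alb10]
    by (auto simp: fun_eq_iff ops_bmk alb_simps R lin_simps trc_cE crs_cE split: v14.split)
  have d: "crs (crs cE (alb10 f)) (crs cE (alb10 f')) = bmu (alb10 f) (alb10 f') \<cdot> cE" for f f' :: "v14 \<Rightarrow> 'a"
    using u10_rules(2)[OF u10_cE u10_cE] bmu_cE[OF u10_alb10 u10_alb10] by metis
  have e: "crs cE y (Dg I1) = 0" "crs cE y (Of I2 k) = 0" "crs cE y (Of I3 k) = 0" for y :: "'a alb" and k
    by (simp_all add: crs_cE)
  have d2: "crs (crs cE (alb10 f)) cE = alb10 f" for f :: "v14 \<Rightarrow> 'a" by (rule u10_rules[OF u10_alb10 u10_alb10])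
  show "to64 (lbr (vpv p) (vmv g)) = 0" "to14p (lbr (vpv p) (vmv g)) = 0"
    unfolding lbr_anti[of "vpv p"]
    unfolding vmv_def vpv_def p vm_vp[OF u10_alb10 u10_alb10]
    by (auto simp: fun_eq_iff ops_bmk alb_simps R d d2 lin_simps trc_cE_crs trc_cE e cE_cE Let_def bmk_add bmk_diff bmk_minus bmk_sc bmk_0
       split: v14.split blk.split)
qed

section \<open>The quadratic space of dimension 14 and the complement of a hyperbolic plane\<close>

definition ipr :: "(v14 \<Rightarrow> 'a::comm_ring_1) \<Rightarrow> (v14 \<Rightarrow> 'a) \<Rightarrow> 'a" where
  "ipr p g = p Vt * g Vt + p Vs * g Vs + (p Vx * g Vy + g Vx * p Vy - bmu (alb10 p) (alb10 g))"

definition bfm :: "(v14 \<Rightarrow> 'a::comm_ring_1) \<Rightarrow> (v14 \<Rightarrow> 'a) \<Rightarrow> 'a" where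
  "bfm p g = p Vt * g Vs + p Vs * g Vt - (p Vx * g Vy + g Vx * p Vy - bmu (alb10 p) (alb10 g))"

text \<open>\<open>bfm\<close> is the polar form of \<open>t s - x y + mu m\<close>, a base point is
  an isotropic vector, and \<open>ipr p\<close> is \<open>bfm (ptil p)\<close>. For a base point,
  \<open>p\<close> and \<open>ptil p\<close> form a hyperbolic pair, and \<open>trp p\<close>
  projects onto its orthogonal complement.\<close>

definition ptil :: "(v14 \<Rightarrow> 'a::comm_ring_1) \<Rightarrow> v14 \<Rightarrow> 'a" where
  "ptil p k = (case k of Vt \<Rightarrow> p Vs | Vs \<Rightarrow> p Vt | _ \<Rightarrow> - p k)"

definition trp :: "(v14 \<Rightarrow> 'a::comm_ring_1) \<Rightarrow> (v14 \<Rightarrow> 'a) \<Rightarrow> v14 \<Rightarrow> 'a" where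
  "trp p g = g - ipr p g \<cdot> p - bfm p g \<cdot> ptil p"

lemma ipr_lin: "ipr p (g + g') = ipr p g + ipr p g'" "ipr p (r \<cdot> g) = r * ipr p g" "ipr p (g - g') = ipr p g - ipr p g'"
  "bfm p (g + g') = bfm p g + bfm p g'" "bfm p (r \<cdot> g) = r * bfm p g" "bfm p (g - g') = bfm p g - bfm p g'"
  by (simp_all add: ipr_def bfm_def alb_lin bmu_lin algebra_simps)

lemma trp_lin: "trp p (g + g') = trp p g + trp p g'" "trp p (r \<cdot> g) = r \<cdot> trp p g"
  by (simp_all add: trp_def ipr_lin fun_eq_iff algebra_simps)

definition base_point :: "(v14 \<Rightarrow> 'a::comm_ring_1) \<Rightarrow> bool" where
  "base_point p \<longleftrightarrow> p Vs = 1 - p Vt \<and> p Vx * p Vy - mu (alb10 p) = p Vt * (1 - p Vt)"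

lemma alb10_ptil: "alb10 (ptil p) = - alb10 p"
  by (simp add: fun_eq_iff all_alb all_three alb_simps ptil_def)

lemma trp_0:
  assumes "base_point p"
  shows "ipr p (trp p g) = 0" "bfm p (trp p g) = 0"
proof -
  have b: "bmu (alb10 p) (alb10 p) = 2 * (p Vx * p Vy - p Vt * (1 - p Vt))"
    using u10_sq[OF u10_alb10, of p] assms by (simp add: bmu_def base_point_def algebra_simps)
  have s: "p Vs = 1 - p Vt" using assms by (simp add: base_point_def)
  have "ipr p p = 1" "ipr p (ptil p) = 0" "bfm p p = 0" "bfm p (ptil p) = 1"
    unfolding ipr_def bfm_def alb10_ptil bmu_lin b by (simp_all add: ptil_def s algebra_simps)
  then show "ipr p (trp p g) = 0" "bfm p (trp p g) = 0"
    by (simp_all add: trp_def ipr_lin)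
qed

text \<open>The eigenvalue 1 case \<open>P = B = 0\<close> of \<open>vp_vm_vp\<close> and
  \<open>vm_vp_vm\<close>; by \<open>trp_0\<close> it covers the range of
  \<open>trp p\<close>.\<close>

lemma vv:
  assumes "base_point p" "ipr p g = 0" "bfm p g = 0"
  shows "lbr (vpv p) (lbr (vmv p) (vpv g)) = vpv g" "lbr (vmv p) (lbr (vpv p) (vmv g)) = vmv g"
  using assms vp_vm_vp[OF u10_alb10 u10_alb10, of "p Vx" "p Vy" p "p Vt" _ "g Vy" "g Vx" g 0 "g Vt" "g Vs" 0]
    vm_vp_vm[OF u10_alb10 u10_alb10, of "p Vx" "p Vy" p "p Vt" _ "g Vy" "g Vx" g 0 "g Vt" "g Vs" 0]
  by (simp_all add: base_point_def ipr_def bfm_def vpv_def vmv_def sc_zero)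

definition rd :: "'a alb \<Rightarrow> bool \<times> oct_ix \<Rightarrow> 'a" where
  "rd a tk = a (Of (if fst tk then I2 else I3) (snd tk))"

lemma alb23_rd: "a23 a \<Longrightarrow> alb23 (rd a) = a"
  by (auto simp: fun_eq_iff all_alb all_three alb_simps a23_def rd_def)

text \<open>The idempotent \<open>e\<close> as a linear map: by \<open>vpm_wpv\<close> it describes
  the double bracket with the pair on the coordinates of \<open>wpv\<close>.\<close>

definition emap :: "(v14 \<Rightarrow> 'a::comm_ring_1) \<Rightarrow> (k64 \<Rightarrow> 'a) \<Rightarrow> k64 \<Rightarrow> 'a" where
  "emap p v = (let a1 = alb23 (\<lambda>i. v (Ka1, i)); a2 = alb23 (\<lambda>i. v (Ka2, i)); b1 = alb23 (\<lambda>i. v (Kb1, i)); b2 = alb23 (\<lambda>i. v (Kb2, i));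
      m = alb10 p; n = crs cE m; z = p Vt; x = p Vx; y = p Vy in
    (\<lambda>(B, tk). case B of Ka1 \<Rightarrow> rd (z \<cdot> a1 + y \<cdot> b1 + crs m b2) tk | Ka2 \<Rightarrow> rd (z \<cdot> a2 + x \<cdot> b2 + crs n b1) tk
      | Kb1 \<Rightarrow> rd ((1 - z) \<cdot> b1 + x \<cdot> a1 - crs m a2) tk | Kb2 \<Rightarrow> rd ((1 - z) \<cdot> b2 + y \<cdot> a2 - crs n a1) tk))"

lemma vpm_wpv:
  assumes p: "base_point p"
  shows "lbr (vpv p) (lbr (vmv p) (wpv v)) = wpv (emap p v)"
    and "emap p (emap p v) = emap p v"
proof -
  note c = a23_u10(3)[OF a23_alb23 u10_alb10] a23_u10(3)[OF a23_alb23 u10_cE]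
  have s: "p Vs = 1 - p Vt" and q: "p Vx * p Vy - mu (alb10 p) = p Vt * (1 - p Vt)" using p by (auto simp: base_point_def)
  note st = vp_vm_wp[OF u10_alb10 a23_alb23 a23_alb23 a23_alb23 a23_alb23 q]
  show 1: "lbr (vpv p) (lbr (vmv p) (wpv v)) = wpv (emap p v)" for v
    unfolding vpv_def vmv_def wpv_def[of v] s st
    unfolding wpv_def emap_def Let_def
    by (simp add: alb23_rd a23_lin a23_alb23 c)
  show "emap p (emap p v) = emap p v"
  proof -
    define a1 a2 b1 b2 m where d: "a1 = alb23 (\<lambda>i. v (Ka1, i))" "a2 = alb23 (\<lambda>i. v (Ka2, i))" "b1 = alb23 (\<lambda>i. v (Kb1, i))"
      "b2 = alb23 (\<lambda>i. v (Kb2, i))" "m = alb10 p"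
    have a: "a23 a1" "a23 a2" "a23 b1" "a23 b2" by (simp_all add: d a23_alb23)
    have m: "u10 m" by (simp add: d u10_alb10)
    note R = a23_rules[OF m a(1)] a23_rules[OF m a(2)] a23_rules[OF m a(3)] a23_rules[OF m a(4)]
    have mq: "mu m = p Vx * p Vy - p Vt * (1 - p Vt)" using q by (simp add: d algebra_simps)
    show ?thesis
      unfolding emap_def Let_def
      by (simp add: d[symmetric] alb23_rd a23_lin a R fun_eq_iff[of "case_prod _"] split_paired_all lin_simps split: blk.split)
        (simp add: rd_def mq algebra_simps)
  qed
qed

lemma emap_lin: "emap p (v + v') = emap p v + emap p v'" "emap p (r \<cdot> v) = r \<cdot> emap p v"
proof -
  have 1: "(\<lambda>p. (v + v') (k, p)) = (\<lambda>p. v (k, p)) + (\<lambda>p. v' (k, p))" "(\<lambda>p. (r \<cdot> v) (k, p)) = r \<cdot> (\<lambda>p. v (k, p))" for k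
    by (simp_all add: fun_eq_iff)
  show "emap p (v + v') = emap p v + emap p v'" "emap p (r \<cdot> v) = r \<cdot> emap p v"
    unfolding emap_def Let_def 1 alb_lin
    by (auto simp: fun_eq_iff lin_simps rd_def algebra_simps split: blk.split)
qed

definition tmap :: "(v14 \<Rightarrow> 'a::comm_ring_1) \<Rightarrow> (kix \<Rightarrow> 'a) \<Rightarrow> kix \<Rightarrow> 'a" where
  "tmap p v = case_sum (emap p (v \<circ> Inl)) (v \<circ> Inr)"

theorem brown_factor:
  fixes p :: "v14 \<Rightarrow> 'a::comm_ring_1"
  assumes p: "base_point p" and F: "bij_betw F LT LT"
    "\<And>p q. p \<in> LT \<Longrightarrow> q \<in> LT \<Longrightarrow> F (p + q) = F p + F q" "\<And>r p. p \<in> LT \<Longrightarrow> F (lsc r p) = lsc r (F p)"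
    "\<And>p q. p \<in> LT \<Longrightarrow> q \<in> LT \<Longrightarrow> F (lbr p q) = lbr (F p) (F q)"
    and F1: "F (0, 0, 0, 0, 1) = vpv p" "F (1, 0, 0, 0, 0) = vmv p"
  shows "\<exists>(A :: (kix \<Rightarrow> 'a) \<Rightarrow> (jix \<Rightarrow> 'a)) B. mlin A \<and> mlin B \<and> (\<forall>v. B (A v) = tmap p v)"
proof -
  define E where "E = {u \<in> LT. lbr (vpv p) (lbr (vmv p) u) = u}"
  have L1: "(0, 0, 0, 0, 1) \<in> (LT :: 'a lie set)" "(1, 0, 0, 0, 0) \<in> (LT :: 'a lie set)" "(0, 0, 0, w, 0) \<in> (LT :: 'a lie set)" for w :: "'a brown"
    by (simp_all add: L0T_0)
  have "\<exists>w. u = F (0, 0, 0, w, 0)" if u: "u \<in> E" for u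
  proof -
    have "u \<in> F ` LT" using u F(1) by (simp add: E_def bij_betw_def)
    then obtain v where v: "v \<in> LT" "u = F v" by blast
    have "F (lbr (0, 0, 0, 0, 1) (lbr (1, 0, 0, 0, 0) v)) = F v"
      using u v by (simp add: F(4) F1 L0T_0 LT_lbr E_def)
    then have "lbr (0, 0, 0, 0, 1) (lbr (1, 0, 0, 0, 0) v) = v"
      using F(1) v L1 by (auto simp: bij_betw_def inj_on_def intro!: LT_lbr)
    then show ?thesis using E1_eq v by blast
  qed
  then obtain H where H: "\<And>u. u \<in> E \<Longrightarrow> u = F (0, 0, 0, H u, 0)" by metis
  have inj: "w = w'" if "F (0, 0, 0, w, 0) = F (0, 0, 0, w', 0)" for w w'
    using inj_onD[OF bij_betw_imp_inj_on[OF F(1)] that L1(3) L1(3)] by simp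
  have E_add: "u + u' \<in> E" "lsc r u \<in> E" if "u \<in> E" "u' \<in> E" for u u' r
    using that by (auto simp: E_def LT_add LT_lsc lbr_add2 lbr_lsc2 LT_lbr vw_LT)
  have H_lin: "H (u + u') = H u + H u'" "H (lsc r u) = r \<cdot> H u" if "u \<in> E" "u' \<in> E" for u u' r
  proof -
    have "F (0, 0, 0, H (u + u'), 0) = F ((0, 0, 0, H u, 0) + (0, 0, 0, H u', 0))"
      unfolding F(2)[OF L1(3) L1(3)] using H that E_add by metis
    then show "H (u + u') = H u + H u'" by (intro inj) simp
    have "F (0, 0, 0, H (lsc r u), 0) = F (lsc r (0, 0, 0, H u, 0))"
      unfolding F(3)[OF L1(3)] using H that E_add by metis
    then show "H (lsc r u) = r \<cdot> H u" by (intro inj) (simp add: sc_zero osc_0)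
  qed
  define U where "U v = wpv (emap p (v \<circ> Inl)) + (vpv (trp p (v \<circ> Inr \<circ> Inl)) + lbr (vpv p) (vmv (trp p (v \<circ> Inr \<circ> Inr))))"
    for v :: "kix \<Rightarrow> 'a"
  have UE: "wpv (emap p w) \<in> E" "vpv (trp p g) \<in> E" "lbr (vpv p) (vmv (trp p g)) \<in> E" for w g
    using p by (simp_all add: E_def vw_LT LT_lbr vpm_wpv vv trp_0)
  have U_in: "U v \<in> E" for v unfolding U_def by (intro E_add UE)
  have U_lin: "U (v + v') = U v + U v'" "U (r \<cdot> v) = lsc r (U v)" for v v' r
    unfolding U_def by (simp_all add: comp_add comp_sc emap_lin trp_lin vw_lin lbr_add2 lbr_lsc2 vw_LT lsc_add)
  define A where "A v = case_sum (H (U v)) (\<lambda>(s, t). (if t then ipr p else bfm p) (v \<circ> Inr \<circ> (if s then Inl else Inr)))" for v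
  \<comment> \<open>The third family becomes visible only after bracketing with
    \<open>vmv p\<close>, which by \<open>vv\<close> undoes the bracket with \<open>vpv p\<close> on
    the range of \<open>trp p\<close>.\<close>
  define B where "B w = (let u = F (0, 0, 0, w \<circ> Inl, 0) in case_sum (to64 u) (case_sum
      (to14p u + w (Inr (True, True)) \<cdot> p + w (Inr (True, False)) \<cdot> ptil p)
      (to14m (lbr (vmv p) u) + w (Inr (False, True)) \<cdot> p + w (Inr (False, False)) \<cdot> ptil p)))" for w :: "jix \<Rightarrow> 'a"
  have "mlin A"
    unfolding mlin_def A_def
    by (auto simp: fun_eq_iff U_lin H_lin[OF U_in U_in] comp_add comp_sc ipr_lin split: sum.split)
  moreover have "mlin B"
  proof -
    have 1: "F (0, 0, 0, (w + w') \<circ> Inl, 0) = F (0, 0, 0, w \<circ> Inl, 0) + F (0, 0, 0, w' \<circ> Inl, 0)" for w w' :: "jix \<Rightarrow> 'a"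
      by (simp add: F(2)[OF L1(3) L1(3), symmetric] comp_add)
    have 2: "F (0, 0, 0, (r \<cdot> w) \<circ> Inl, 0) = lsc r (F (0, 0, 0, w \<circ> Inl, 0))" for r and w :: "jix \<Rightarrow> 'a"
      by (simp add: F(3)[OF L1(3), symmetric] comp_sc sc_zero osc_0)
    have 3: "F (0, 0, 0, w, 0) \<in> LT" for w
      using F(1) L1(3) by (auto simp: bij_betw_def)
    show ?thesis
      unfolding mlin_def B_def Let_def 1 2
      by (auto simp: fun_eq_iff to_lin lbr_add2 lbr_lsc2 3 vw_LT algebra_simps split: sum.split)
  qed
  moreover have "B (A v) = tmap p v" for v
  proof -
    have FU: "F (0, 0, 0, A v \<circ> Inl, 0) = U v"
      using H[OF U_in, of v] by (simp add: A_def comp_def)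
    have s: "p Vs = 1 - p Vt" using p by (simp add: base_point_def)
    define g1 g2 where g: "g1 = v \<circ> Inr \<circ> Inl" "g2 = v \<circ> Inr \<circ> Inr"
    have t64: "to64 (U v) = emap p (v \<circ> Inl)" and t14p: "to14p (U v) = trp p g1"
      unfolding U_def by (simp_all add: to_lin to_vw to_cross[OF s] g)
    have t14m: "to14m (lbr (vmv p) (U v)) = trp p g2"
      unfolding U_def
      by (simp add: lbr_add2 LT_add vw_LT LT_lbr to_lin to_cross[OF s] vv[OF p] trp_0[OF p] to_vw g)
    show ?thesis
      unfolding B_def Let_def FU t64 t14p t14m tmap_def
      by (auto simp: fun_eq_iff A_def trp_def g comp_def split: sum.split)
  qed
  ultimately show ?thesis by blast
qed

section \<open>Asymptotically commuting operators\<close>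

text \<open>One index per hyperbolic pair of coordinates of the quadratic space: \<open>Ha\<close>
  for \<open>Vx\<close>, \<open>Vy\<close>, \<open>Hb\<close> for the two \<open>Vd\<close>,
  \<open>Hc\<close> for \<open>OE\<close>, \<open>OF\<close>, and \<open>Hd k\<close> for
  \<open>OU k\<close>, \<open>OV k\<close>.\<close>

datatype hix = Ha | Hb | Hc | Hd three

type_synonym mi = "hix \<Rightarrow> nat"
type_synonym opr = "(mi \<Rightarrow> complex) \<Rightarrow> mi \<Rightarrow> complex"

definition deg :: "mi \<Rightarrow> nat" where
  "deg a = a Ha + a Hb + a Hc + a (Hd I1) + a (Hd I2) + a (Hd I3)"

lemma hix_UNIV: "(UNIV :: hix set) = {Ha, Hb, Hc, Hd I1, Hd I2, Hd I3}"
proof -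
  have "i \<in> {Ha, Hb, Hc, Hd I1, Hd I2, Hd I3}" for i
    by (cases i) (simp_all, metis three.exhaust)
  then show ?thesis by blast
qed

instance hix :: finite
  by standard (simp add: hix_UNIV)

lemma deg_sum: "deg a = sum a UNIV"
  by (simp add: hix_UNIV deg_def)

lemma deg_upd: "deg (a(i := Suc (a i))) = Suc (deg a)" "0 < a i \<Longrightarrow> Suc (deg (a(i := a i - 1))) = deg a"
proof -
  have "deg (a(i := Suc (a i))) = Suc (deg a) \<and> (0 < a i \<longrightarrow> Suc (deg (a(i := a i - 1))) = deg a)"
    by (cases i) (auto simp: deg_def, (rename_tac t, case_tac t; simp)+)
  then show "deg (a(i := Suc (a i))) = Suc (deg a)" "0 < a i \<Longrightarrow> Suc (deg (a(i := a i - 1))) = deg a" by auto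
qed

lemma deg_ge: "a i \<le> deg a"
  by (cases i) (auto simp: deg_def, (rename_tac t, case_tac t; simp)+)

text \<open>On functions on \<open>{a. deg a \<le> k}\<close> these operators have norm at most 1 (apart from the scalars \<open>opC\<close>), commute up to
  \<open>O(1/k)\<close>, and satisfy \<open>\<Sum> X\<^sub>i Y\<^sub>i = Z (1 - Z) + O(1/k)\<close>. The coefficient of \<open>opY\<close> vanishes for \<open>deg a = k\<close>, so values outside
  the simplex never matter.\<close>

definition opC :: "complex \<Rightarrow> nat \<Rightarrow> opr" where "opC c k f a = c * f a"
definition opX :: "hix \<Rightarrow> nat \<Rightarrow> opr" where "opX i k f a = (if 0 < a i then f (a(i := a i - 1)) else 0)"
definition opY :: "hix \<Rightarrow> nat \<Rightarrow> opr" where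
  "opY i k f a = of_real ((1 - deg a / k) * (Suc (a i) / k)) * f (a(i := Suc (a i)))"
definition opZ :: "nat \<Rightarrow> opr" where "opZ k f a = of_real (1 - deg a / k) * f a"
definition opS :: "(nat \<Rightarrow> opr) \<Rightarrow> (nat \<Rightarrow> opr) \<Rightarrow> nat \<Rightarrow> opr" where "opS A B k f a = A k f a + B k f a"
definition opM :: "(nat \<Rightarrow> opr) \<Rightarrow> (nat \<Rightarrow> opr) \<Rightarrow> nat \<Rightarrow> opr" where "opM A B k f = A k (B k f)"
abbreviation opN :: "(nat \<Rightarrow> opr) \<Rightarrow> nat \<Rightarrow> opr" where "opN A \<equiv> opM (opC (- 1)) A"
abbreviation opD :: "(nat \<Rightarrow> opr) \<Rightarrow> (nat \<Rightarrow> opr) \<Rightarrow> nat \<Rightarrow> opr" where "opD A B \<equiv> opS A (opN B)"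

inductive gen :: "(nat \<Rightarrow> opr) \<Rightarrow> bool" where
  gen_C: "gen (opC c)"
| gen_X: "gen (opX i)"
| gen_Y: "gen (opY i)"
| gen_Z: "gen opZ"
| gen_S: "gen A \<Longrightarrow> gen B \<Longrightarrow> gen (opS A B)"
| gen_M: "gen A \<Longrightarrow> gen B \<Longrightarrow> gen (opM A B)"

definition op_linear :: "opr \<Rightarrow> bool" where
  "op_linear A \<longleftrightarrow> (\<forall>f g a. A (\<lambda>b. f b + g b) a = A f a + A g a) \<and> (\<forall>c f a. A (\<lambda>b. c * f b) a = c * A f a)"

text \<open>A bound for the operator norm with respect to the sup norm on the simplex. For linear
  \<open>A\<close> the case \<open>r = 0\<close> also says that values outside the simplex do not
  influence the result inside.\<close>

definition bnd :: "real \<Rightarrow> nat \<Rightarrow> opr \<Rightarrow> bool" where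
  "bnd C k A \<longleftrightarrow> (\<forall>f r. (\<forall>a. deg a \<le> k \<longrightarrow> cmod (f a) \<le> r) \<longrightarrow> (\<forall>a. deg a \<le> k \<longrightarrow> cmod (A f a) \<le> C * r))"

definition null :: "(nat \<Rightarrow> opr) \<Rightarrow> bool" where
  "null A \<longleftrightarrow> (\<forall>e>0. \<exists>K. \<forall>k\<ge>K. bnd e k (A k))"

lemma bndD: "bnd C k A \<Longrightarrow> (\<And>a. deg a \<le> k \<Longrightarrow> cmod (f a) \<le> r) \<Longrightarrow> deg a \<le> k \<Longrightarrow> cmod (A f a) \<le> C * r"
  unfolding bnd_def by blast

lemma bndI: "(\<And>f r a. 0 \<le> r \<Longrightarrow> (\<And>a. deg a \<le> k \<Longrightarrow> cmod (f a) \<le> r) \<Longrightarrow> deg a \<le> k \<Longrightarrow> cmod (A f a) \<le> C * r) \<Longrightarrow> bnd C k A"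
proof -
  assume *: "\<And>f r a. 0 \<le> r \<Longrightarrow> (\<And>a. deg a \<le> k \<Longrightarrow> cmod (f a) \<le> r) \<Longrightarrow> deg a \<le> k \<Longrightarrow> cmod (A f a) \<le> C * r"
  have "0 \<le> r" if "\<forall>a. deg a \<le> k \<longrightarrow> cmod (f a) \<le> r" for f :: "mi \<Rightarrow> complex" and r
  proof -
    have "deg (\<lambda>_. 0) \<le> k" by (simp add: deg_def)
    then have "cmod (f (\<lambda>_. 0)) \<le> r" using that by blast
    then show ?thesis using norm_ge_zero order_trans by blast
  qed
  then show ?thesis unfolding bnd_def using * by blast
qed

lemma bnd_S: "bnd C k (A k) \<Longrightarrow> bnd D k (B k) \<Longrightarrow> bnd (C + D) k (opS A B k)"
proof (rule bndI)
  fix f r a assume 1: "bnd C k (A k)" "bnd D k (B k)" and 2: "\<And>a. deg a \<le> k \<Longrightarrow> cmod (f a) \<le> r" "deg a \<le> k"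
  have "cmod (A k f a) \<le> C * r" "cmod (B k f a) \<le> D * r" using bndD[OF 1(1) 2] bndD[OF 1(2) 2] by auto
  then show "cmod (opS A B k f a) \<le> (C + D) * r"
    unfolding opS_def distrib_right by (intro order_trans[OF norm_triangle_ineq] add_mono)
qed

lemma bnd_M: "bnd C k (A k) \<Longrightarrow> bnd D k (B k) \<Longrightarrow> bnd (C * D) k (opM A B k)"
proof (rule bndI)
  fix f r a assume 1: "bnd C k (A k)" "bnd D k (B k)" and 2: "\<And>a. deg a \<le> k \<Longrightarrow> cmod (f a) \<le> r" "deg a \<le> k"
  have "cmod (B k f b) \<le> D * r" if "deg b \<le> k" for b using bndD[OF 1(2) 2(1) that] by auto
  then show "cmod (opM A B k f a) \<le> C * D * r"
    unfolding opM_def using bndD[OF 1(1) _ 2(2), of "B k f" "D * r"] by (simp add: mult.assoc)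
qed

lemma bnd_C: "bnd (cmod c) k (opC c k)"
  by (rule bndI) (simp add: opC_def norm_mult mult_left_mono)

lemma bnd_mono: "bnd C k A \<Longrightarrow> C \<le> D \<Longrightarrow> bnd D k A"
  by (rule bndI) (meson bndD mult_right_mono order_trans)

lemma bnd_X: "bnd 1 k (opX i k)"
proof (rule bndI)
  fix f r a assume r: "(0::real) \<le> r" and f: "\<And>a. deg a \<le> k \<Longrightarrow> cmod (f a) \<le> r" and a: "deg a \<le> k"
  show "cmod (opX i k f a) \<le> 1 * r"
  proof (cases "0 < a i")
    case True
    then have "deg (a(i := a i - 1)) \<le> k" using deg_upd(2)[of a i] a by linarith
    then show ?thesis using f True by (simp add: opX_def)
  qed (use r in \<open>simp add: opX_def\<close>)
qed

lemma deg_frac: "deg a \<le> k \<Longrightarrow> 0 \<le> 1 - real (deg a) / real k \<and> 1 - real (deg a) / real k \<le> 1"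
  by (cases "k = 0") (simp_all add: divide_le_eq_1)

lemma bnd_Z: "bnd 1 k (opZ k)"
proof (rule bndI)
  fix f r a assume r: "(0::real) \<le> r" and f: "\<And>a. deg a \<le> k \<Longrightarrow> cmod (f a) \<le> r" and a: "deg a \<le> k"
  have "\<bar>1 - real (deg a) / real k\<bar> * cmod (f a) \<le> 1 * r"
    using deg_frac[OF a] by (intro mult_mono f a) auto
  then show "cmod (opZ k f a) \<le> 1 * r" by (simp add: opZ_def norm_mult del: of_real_diff of_real_divide)
qed

lemma bnd_Y: "bnd 1 k (opY i k)"
proof (rule bndI)
  fix f r a assume r: "(0::real) \<le> r" and f: "\<And>a. deg a \<le> k \<Longrightarrow> cmod (f a) \<le> r" and a: "deg a \<le> k"
  have e: "cmod (opY i k f a) = \<bar>(1 - real (deg a) / real k) * (real (Suc (a i)) / real k)\<bar> * cmod (f (a(i := Suc (a i))))"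
    unfolding opY_def norm_mult norm_of_real ..
  show "cmod (opY i k f a) \<le> 1 * r"
  proof (cases "deg a = k")
    case True
    then show ?thesis using r unfolding e by (cases "k = 0") simp_all
  next
    case False
    then have k: "deg a < k" using a by simp
    have "real (Suc (a i)) / real k \<le> 1" using k deg_ge[of a i] by (simp add: divide_le_eq_1)
    then have "\<bar>(1 - real (deg a) / real k) * (real (Suc (a i)) / real k)\<bar> \<le> 1"
      using deg_frac[OF a] unfolding abs_mult by (intro mult_le_one) auto
    moreover have "cmod (f (a(i := Suc (a i)))) \<le> r" using f k by (simp add: deg_upd)
    ultimately show ?thesis unfolding e by (intro mult_mono) auto
  qed
qed

lemma gen_bnd: "gen A \<Longrightarrow> \<exists>C\<ge>0. \<forall>k. bnd C k (A k)"
proof (induction rule: gen.induct)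
  case (gen_S A B)
  then obtain C D where "C \<ge> 0" "\<forall>k. bnd C k (A k)" "D \<ge> 0" "\<forall>k. bnd D k (B k)" by auto
  then have "0 \<le> C + D" "\<forall>k. bnd (C + D) k (opS A B k)" by (auto intro: bnd_S)
  then show ?case by blast
next
  case (gen_M A B)
  then obtain C D where "C \<ge> 0" "\<forall>k. bnd C k (A k)" "D \<ge> 0" "\<forall>k. bnd D k (B k)" by auto
  then have "0 \<le> C * D" "\<forall>k. bnd (C * D) k (opM A B k)" by (auto intro: bnd_M)
  then show ?case by blast
qed (metis bnd_C norm_ge_zero, metis bnd_X zero_le_one, metis bnd_Y zero_le_one, metis bnd_Z zero_le_one)

lemma op_linearD: "op_linear A \<Longrightarrow> A (\<lambda>b. f b + g b) = (\<lambda>a. A f a + A g a)" "op_linear A \<Longrightarrow> A (\<lambda>b. c * f b) = (\<lambda>a. c * A f a)"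
  by (auto simp: op_linear_def fun_eq_iff)

lemma gen_op_linear: "gen A \<Longrightarrow> op_linear (A k)"
proof (induction rule: gen.induct)
  case (gen_S A B)
  have "opS A B k = (\<lambda>f a. A k f a + B k f a)" by (simp add: fun_eq_iff opS_def)
  with gen_S show ?case by (simp add: op_linear_def algebra_simps)
next
  case (gen_M A B)
  have "opM A B k = (\<lambda>f. A k (B k f))" by (simp add: fun_eq_iff opM_def)
  with gen_M show ?case by (simp add: op_linear_def[of "\<lambda>f. A k (B k f)"] op_linearD[of "A k"] op_linearD[of "B k"])
qed (auto simp: op_linear_def opC_def opX_def opY_def opZ_def distrib_left add_divide_distrib)

lemma null_S: "null A \<Longrightarrow> null B \<Longrightarrow> null (opS A B)"
  unfolding null_def
proof (intro allI impI)
  fix e :: real assume e: "0 < e" and n: "\<forall>e>0. \<exists>K. \<forall>k\<ge>K. bnd e k (A k)" "\<forall>e>0. \<exists>K. \<forall>k\<ge>K. bnd e k (B k)"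
  from n e obtain K L where K: "\<forall>k\<ge>K. bnd (e/2) k (A k)" "\<forall>k\<ge>L. bnd (e/2) k (B k)" by (meson half_gt_zero)
  then have "\<forall>k\<ge>max K L. bnd e k (opS A B k)" using bnd_S[of "e/2" _ A "e/2" B] by simp
  then show "\<exists>K. \<forall>k\<ge>K. bnd e k (opS A B k)" ..
qed

text \<open>Null sequences form an ideal because every generated sequence is uniformly bounded in
  \<open>k\<close>.\<close>

lemma null_M: "null A \<Longrightarrow> gen B \<Longrightarrow> null (opM A B)" "null A \<Longrightarrow> gen B \<Longrightarrow> null (opM B A)"
proof -
  assume n: "null A" and B: "gen B"
  obtain C where C: "C \<ge> 0" "\<forall>k. bnd C k (B k)" using gen_bnd[OF B] by blast
  have "\<exists>K. \<forall>k\<ge>K. bnd e k (opM A B k) \<and> bnd e k (opM B A k)" if e: "e > 0" for e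
  proof -
    have "0 < e / (C + 1)" using e C by simp
    then obtain K where K: "\<forall>k\<ge>K. bnd (e / (C + 1)) k (A k)" using n unfolding null_def by blast
    have "e / (C + 1) * C \<le> e" using e C(1) by (simp add: divide_le_eq mult_left_mono)
    then have "\<forall>k\<ge>K. bnd e k (opM A B k) \<and> bnd e k (opM B A k)"
      using K C(2) bnd_M[of "e / (C + 1)" _ A C B] bnd_M[of C _ B "e / (C + 1)" A] by (metis bnd_mono mult.commute)
    then show ?thesis by blast
  qed
  then show "null (opM A B)" "null (opM B A)" unfolding null_def by meson+
qed

lemma nullI:
  assumes "\<And>k f r a. 0 < k \<Longrightarrow> 0 \<le> r \<Longrightarrow> (\<And>a. deg a \<le> k \<Longrightarrow> cmod (f a) \<le> r) \<Longrightarrow> deg a \<le> k \<Longrightarrow> cmod (A k f a) \<le> 1 / real k * r"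
  shows "null A"
  unfolding null_def
proof (intro allI impI)
  fix e :: real assume e: "0 < e"
  obtain K where K: "inverse (real (Suc K)) < e" using reals_Archimedean[OF e] by blast
  have "bnd e k (A k)" if k: "k \<ge> Suc K" for k
  proof (rule bnd_mono)
    show "bnd (1 / k) k (A k)" using assms k by (intro bndI) auto
    have "1 / real k \<le> 1 / real (Suc K)" using k by (intro divide_left_mono) auto
    then show "1 / real k \<le> e" using K by (simp add: inverse_eq_divide)
  qed
  then show "\<exists>K. \<forall>k\<ge>K. bnd e k (A k)" by blast
qed

lemma null_0: "null (opC 0)"
  by (rule nullI) (simp add: opC_def)

definition opcom :: "(nat \<Rightarrow> opr) \<Rightarrow> (nat \<Rightarrow> opr) \<Rightarrow> nat \<Rightarrow> opr" where
  "opcom A B = opD (opM A B) (opM B A)"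

lemma op_fun: "opC c k f = (\<lambda>a. c * f a)" "opS A B k f = (\<lambda>a. A k f a + B k f a)"
  by (simp_all add: fun_eq_iff opC_def opS_def)

lemmas op_defs = op_fun opX_def opY_def opZ_def opM_def

lemma null_opcom_commute: "null (opcom A B) \<Longrightarrow> null (opcom B A)"
proof -
  assume "null (opcom A B)"
  then have "null (opN (opcom A B))" by (intro null_M gen_C)
  moreover have "opN (opcom A B) = opcom B A"
    by (auto simp: opcom_def op_defs fun_eq_iff)
  ultimately show ?thesis by simp
qed

lemma null_com_C: "gen B \<Longrightarrow> null (opcom (opC c) B)"
proof -
  assume B: "gen B"
  have "opcom (opC c) B = opC 0"
    by (auto simp: opcom_def op_defs fun_eq_iff op_linearD[OF gen_op_linear[OF B]])
  then show ?thesis by (simp add: null_0)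
qed

lemma null_com_ZX: "null (opcom opZ (opX i))"
proof (rule nullI)
  fix k :: nat and f r a assume k: "0 < k" and r: "(0::real) \<le> r" and f: "\<And>a. deg a \<le> k \<Longrightarrow> cmod (f a) \<le> r" and a: "deg a \<le> k"
  show "cmod (opcom opZ (opX i) k f a) \<le> 1 / real k * r"
  proof (cases "0 < a i")
    case True
    let ?b = "a(i := a i - 1)"
    have d: "deg a = Suc (deg (a(i := a i - Suc 0)))" using deg_upd(2)[of a i] True by simp
    have "opcom opZ (opX i) k f a = of_real (- (1 / k)) * f ?b"
      using k True by (simp add: opcom_def op_defs d field_simps)
    moreover have "cmod (f ?b) \<le> r" using f a d by auto
    ultimately show ?thesis using k by (simp add: norm_mult norm_divide divide_right_mono)
  qed (use k r in \<open>simp add: opcom_def op_defs\<close>)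
qed

lemma null_com_ZY: "null (opcom opZ (opY i))"
proof (rule nullI)
  fix k :: nat and f r a assume k: "0 < k" and r: "(0::real) \<le> r" and f: "\<And>a. deg a \<le> k \<Longrightarrow> cmod (f a) \<le> r" and a: "deg a \<le> k"
  have "opcom opZ (opY i) k f a = of_real (1 / k) * opY i k f a"
    using k by (simp add: opcom_def op_defs deg_upd field_simps)
  moreover have "cmod (opY i k f a) \<le> r" using bndD[OF bnd_Y f a] by simp
  ultimately show "cmod (opcom opZ (opY i) k f a) \<le> 1 / real k * r"
    using k by (simp add: norm_mult norm_divide divide_right_mono)
qed

lemma null_com_XX: "null (opcom (opX i) (opX j))"
proof -
  have "opcom (opX i) (opX j) = opC 0"
    by (cases "i = j") (auto simp: opcom_def op_defs fun_eq_iff fun_upd_twist)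
  then show ?thesis by (simp add: null_0)
qed

lemma null_com_YY: "null (opcom (opY i) (opY j))"
proof -
  have "opcom (opY i) (opY j) = opC 0"
    by (cases "i = j") (auto simp: opcom_def op_defs fun_eq_iff fun_upd_twist deg_upd)
  then show ?thesis by (simp add: null_0)
qed

lemma deg_ge2: "i \<noteq> j \<Longrightarrow> a i + a j \<le> deg a"
  using sum_mono2[of UNIV "{i, j}" a] by (simp add: deg_sum)

text \<open>Both orders of the shifts end at the same point, with weights taken one step apart, so
  the coefficients differ by at most \<open>1/k\<close>. If \<open>a i = 0\<close>, at most the
  order applying \<open>opX\<close> first survives, and its coefficient is itself bounded by
  \<open>1/k\<close>.\<close>

lemma null_com_XY: "null (opcom (opX i) (opY j))"
proof (rule nullI)
  fix k :: nat and f r a assume k: "0 < k" and r: "(0::real) \<le> r" and f: "\<And>a. deg a \<le> k \<Longrightarrow> cmod (f a) \<le> r" and a: "deg a \<le> k"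
  have *: "cmod (of_real c * f b) \<le> 1 / real k * r" if "\<bar>c\<bar> \<le> 1 / real k" "deg b \<le> k" for c b
    unfolding norm_mult norm_of_real using that f[OF that(2)] by (intro mult_mono) auto
  have h: "\<bar>1 / k * t\<bar> \<le> 1 / k" if "\<bar>t\<bar> \<le> 1" for t :: real
    using that by (simp add: abs_mult divide_right_mono)
  have dk: "real (deg a) / k \<le> 1" using a k by simp
  show "cmod (opcom (opX i) (opY j) k f a) \<le> 1 / real k * r"
  proof (cases "0 < a i")
    case True
    then have d: "deg a = Suc (deg (a(i := a i - Suc 0)))" using deg_upd(2)[of a i] True by simp
    show ?thesis
    proof (cases "i = j")
      case False
      let ?b = "a(i := a i - 1, j := Suc (a j))"
      have d2: "deg ?b = deg a"
        using deg_upd(1)[of "a(i := a i - 1)" j] deg_upd(2)[of a i] True False by simp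
      have e: "opcom (opX i) (opY j) k f a = of_real (1 / k * (real (Suc (a j)) / k)) * f ?b"
        using k True False by (simp add: opcom_def op_defs d fun_upd_twist field_simps)
      have "real (Suc (a j)) / k \<le> 1" using deg_ge2[OF False, of a] True a k by simp
      then have h1: "\<bar>1 / k * (real (Suc (a j)) / k)\<bar> \<le> 1 / k" using h[of "real (Suc (a j)) / k"] by simp
      show ?thesis unfolding e by (rule *[OF h1]) (use d2 a in simp)
    next
      case True
      have e: "opcom (opX i) (opY j) k f a = of_real (1 / k * (a i / k - (1 - deg a / k))) * f a"
        using k \<open>0 < a i\<close> True by (simp add: opcom_def op_defs d field_simps)
      have "0 \<le> a i / k" "a i / k \<le> 1" "0 \<le> deg a / k" using deg_ge[of a i] a k by simp_all
      then have "\<bar>a i / k - (1 - deg a / k)\<bar> \<le> 1" using dk by linarith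
      then have h1: "\<bar>1 / k * (a i / k - (1 - deg a / k))\<bar> \<le> 1 / k" using k by (simp add: abs_mult divide_right_mono)
      show ?thesis unfolding e by (rule *[OF h1 a])
    qed
  next
    case False
    then have ai: "a i = 0" by simp
    show ?thesis
    proof (cases "i = j")
      case True
      have e: "opcom (opX i) (opY j) k f a = of_real (- (1 / k * (1 - deg a / k))) * f a"
        using k ai True by (simp add: opcom_def op_defs field_simps fun_upd_idem)
      have h1: "\<bar>- (1 / k * (1 - deg a / k))\<bar> \<le> 1 / k" using deg_frac[OF a] k by (simp add: abs_mult divide_right_mono)
      show ?thesis unfolding e by (rule *[OF h1 a])
    next
      case False
      then show ?thesis using k r ai by (simp add: opcom_def op_defs)
    qed
  qed
qed

lemma null_com_S: "gen A \<Longrightarrow> null (opcom A B) \<Longrightarrow> null (opcom A D) \<Longrightarrow> null (opcom A (opS B D))"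
proof -
  assume A: "gen A" and n: "null (opcom A B)" "null (opcom A D)"
  have "opcom A (opS B D) = opS (opcom A B) (opcom A D)"
    by (auto simp: opcom_def op_defs fun_eq_iff op_linearD[OF gen_op_linear[OF A]])
  then show ?thesis using n by (simp add: null_S)
qed

lemma null_com_M: "gen A \<Longrightarrow> gen B \<Longrightarrow> gen D \<Longrightarrow> null (opcom A B) \<Longrightarrow> null (opcom A D) \<Longrightarrow> null (opcom A (opM B D))"
proof -
  assume A: "gen A" and B: "gen B" and D: "gen D" and n: "null (opcom A B)" "null (opcom A D)"
  have "B k (\<lambda>a. f a - g a) = (\<lambda>a. B k f a - B k g a)" for k f g
    using op_linearD(1)[OF gen_op_linear[OF B], of k f "\<lambda>a. -1 * g a"] unfolding op_linearD(2)[OF gen_op_linear[OF B]] by simp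
  then have "opcom A (opM B D) = opS (opM (opcom A B) D) (opM B (opcom A D))"
    by (auto simp: opcom_def op_defs fun_eq_iff)
  then show ?thesis using n B D by (simp add: null_S null_M)
qed

text \<open>Induction on both sequences: products are handled by the Leibniz rule in
  \<open>null_com_M\<close>, and the base cases are the commutators of the generators.\<close>

lemma null_com: "gen B \<Longrightarrow> gen A \<Longrightarrow> null (opcom A B)"
proof (induction arbitrary: A rule: gen.induct)
  case (gen_X i)
  then show ?case
  proof (induction rule: gen.induct)
    case (gen_S A B) then show ?case by (meson null_opcom_commute null_com_S gen.gen_X)
  next case (gen_M A B) then show ?case by (meson null_opcom_commute null_com_M gen.gen_X)
  qed (auto intro: null_com_C null_com_XX null_com_ZX null_com_XY null_opcom_commute[OF null_com_XY] gen.gen_X)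
next
  case (gen_Y i)
  then show ?case
  proof (induction rule: gen.induct)
    case (gen_S A B) then show ?case by (meson null_opcom_commute null_com_S gen.gen_Y)
  next case (gen_M A B) then show ?case by (meson null_opcom_commute null_com_M gen.gen_Y)
  qed (auto intro: null_com_C null_com_YY null_com_ZY null_com_XY gen.gen_Y)
next
  case gen_Z
  then show ?case
  proof (induction rule: gen.induct)
    case gen_Z
    have "opcom opZ opZ = opC 0" by (auto simp: opcom_def op_defs fun_eq_iff)
    then show ?case by (simp add: null_0)
  next
    case (gen_S A B) then show ?case by (meson null_opcom_commute null_com_S gen.gen_Z)
  next case (gen_M A B) then show ?case by (meson null_opcom_commute null_com_M gen.gen_Z)
  qed (auto intro: null_com_C null_opcom_commute[OF null_com_ZX] null_opcom_commute[OF null_com_ZY] gen.gen_Z)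
qed (auto intro: null_opcom_commute[OF null_com_C] null_com_S null_com_M)

abbreviation opP :: "hix \<Rightarrow> nat \<Rightarrow> opr" where "opP i \<equiv> opM (opX i) (opY i)"

lemma opP_eq: "0 < k \<Longrightarrow> opP i k f a = of_real ((1 - (real (deg a) - 1) / k) * (a i / k)) * f a"
proof (cases "0 < a i")
  case True
  then have d: "deg a = Suc (deg (a(i := a i - Suc 0)))" using deg_upd(2)[of a i] True by simp
  then show ?thesis using True by (simp add: op_defs)
qed (simp add: op_defs)

text \<open>In \<open>opP i\<close> the weight is taken one step lower, at degree
  \<open>deg a - 1\<close>, so the sum of the six diagonal operators exceeds
  \<open>Z (1 - Z)\<close> by exactly \<open>1/k * (deg a / k)\<close>.\<close>

lemma null_rel: "null (opD (opS (opP Ha) (opS (opP Hb) (opS (opP Hc) (opS (opP (Hd I1)) (opS (opP (Hd I2)) (opP (Hd I3)))))))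
   (opM opZ (opD (opC 1) opZ)))" (is "null ?A")
proof (rule nullI)
  fix k :: nat and f r a assume k: "0 < k" and r: "(0::real) \<le> r" and f: "\<And>a. deg a \<le> k \<Longrightarrow> cmod (f a) \<le> r" and a: "deg a \<le> k"
  have e: "?A k f a = of_real (1 / k * (deg a / k)) * f a"
  proof -
    have "?A k f a = opP Ha k f a + opP Hb k f a + opP Hc k f a + opP (Hd I1) k f a + opP (Hd I2) k f a + opP (Hd I3) k f a
        - of_real ((1 - deg a / k) * (deg a / k)) * f a"
      by (simp add: opS_def opM_def[of "opC (-1)"] opM_def[of opZ] opZ_def opC_def algebra_simps add_divide_distrib diff_divide_distrib)
    also have "\<dots> = of_real ((1 - (real (deg a) - 1) / k) * (deg a / k) - (1 - deg a / k) * (deg a / k)) * f a"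
    proof -
      have *: "of_real (c * t1) * w + of_real (c * t2) * w + of_real (c * t3) * w + of_real (c * t4) * w + of_real (c * t5) * w
          + of_real (c * t6) * w - of_real d * w = of_real (c * (t1 + t2 + t3 + t4 + t5 + t6) - d) * w"
        for c d t1 t2 t3 t4 t5 t6 and w :: complex
        by (simp add: algebra_simps)
      have "deg a / k = a Ha / k + a Hb / k + a Hc / k + a (Hd I1) / k + a (Hd I2) / k + a (Hd I3) / k"
        by (simp add: deg_def add_divide_distrib)
      then show ?thesis unfolding opP_eq[OF k] * by simp
    qed
    also have "of_real ((1 - (real (deg a) - 1) / k) * (deg a / k) - (1 - deg a / k) * (deg a / k)) * f a = of_real (1 / k * (deg a / k)) * f a"
      by (simp add: algebra_simps add_divide_distrib diff_divide_distrib)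
    finally show ?thesis .
  qed
  have h: "\<bar>1 / k * t\<bar> \<le> 1 / k" if "0 \<le> t" "t \<le> 1" for t :: real
    using that by (simp add: abs_mult divide_right_mono)
  have "\<bar>1 / k * (deg a / k)\<bar> \<le> 1 / k" by (rule h) (use a k in simp_all)
  then show "cmod (?A k f a) \<le> 1 / real k * r"
    unfolding e norm_mult norm_of_real using f[OF a] by (intro mult_mono) auto
qed

section \<open>The quotient ring\<close>

definition gen_eq :: "(nat \<Rightarrow> opr) \<Rightarrow> (nat \<Rightarrow> opr) \<Rightarrow> bool" where
  "gen_eq A B \<longleftrightarrow> gen A \<and> gen B \<and> null (opD A B)"

lemma gen_eq_refl: "gen A \<Longrightarrow> gen_eq A A"
proof -
  have "opD A A = opC 0" by (simp add: fun_eq_iff op_defs)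
  then show "gen A \<Longrightarrow> gen_eq A A" by (simp add: gen_eq_def null_0)
qed

lemma gen_eq_sym: "gen_eq A B \<Longrightarrow> gen_eq B A"
proof -
  have "opD B A = opN (opD A B)" by (simp add: fun_eq_iff op_defs)
  then show "gen_eq A B \<Longrightarrow> gen_eq B A" using null_M(2)[OF _ gen_C[of "- 1"], of "opD A B"] by (simp add: gen_eq_def)
qed

lemma gen_eq_trans: "gen_eq A B \<Longrightarrow> gen_eq B D \<Longrightarrow> gen_eq A D"
proof -
  have "opD A D = opS (opD A B) (opD B D)" by (simp add: fun_eq_iff op_defs)
  then show "gen_eq A B \<Longrightarrow> gen_eq B D \<Longrightarrow> gen_eq A D" using null_S[of "opD A B" "opD B D"] by (simp add: gen_eq_def)
qed

lemma gen_eq_S: "gen_eq A B \<Longrightarrow> gen_eq D E \<Longrightarrow> gen_eq (opS A D) (opS B E)"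
proof -
  have "opD (opS A D) (opS B E) = opS (opD A B) (opD D E)" by (simp add: fun_eq_iff op_defs)
  then show "gen_eq A B \<Longrightarrow> gen_eq D E \<Longrightarrow> gen_eq (opS A D) (opS B E)"
    using null_S[of "opD A B" "opD D E"] by (simp add: gen_eq_def gen_S)
qed

lemma gen_eq_M: "gen_eq A B \<Longrightarrow> gen_eq D E \<Longrightarrow> gen_eq (opM A D) (opM B E)"
proof -
  assume g: "gen_eq A B" "gen_eq D E"
  then have B: "gen B" by (simp add: gen_eq_def)
  have "B k (\<lambda>a. f a - g a) = (\<lambda>a. B k f a - B k g a)" for k f g
    using op_linearD(1)[OF gen_op_linear[OF B], of k f "\<lambda>a. -1 * g a"] unfolding op_linearD(2)[OF gen_op_linear[OF B]] by simp
  then have "opD (opM A D) (opM B E) = opS (opM (opD A B) D) (opM B (opD D E))"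
    by (simp add: fun_eq_iff op_defs)
  then show ?thesis using g by (simp add: gen_eq_def gen_M null_S null_M)
qed

text \<open>The ring of all sequences generated by these operators, modulo null sequences.\<close>

quotient_type oring = "nat \<Rightarrow> opr" / partial: gen_eq
proof (rule part_equivpI)
  show "\<exists>x. gen_eq x x" using gen_eq_refl gen_Z by blast
  show "symp gen_eq" by (simp add: sympI gen_eq_sym)
  show "transp gen_eq" by (auto intro: transpI gen_eq_trans)
qed

instantiation oring :: comm_ring_1
begin
lift_definition zero_oring :: oring is "opC 0" by (intro gen_eq_refl gen.intros)
lift_definition one_oring :: oring is "opC 1" by (intro gen_eq_refl gen.intros)
lift_definition plus_oring :: "oring \<Rightarrow> oring \<Rightarrow> oring" is opS by (rule gen_eq_S)
lift_definition times_oring :: "oring \<Rightarrow> oring \<Rightarrow> oring" is opM by (rule gen_eq_M)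
lift_definition uminus_oring :: "oring \<Rightarrow> oring" is opN by (intro gen_eq_M gen_eq_refl gen_C)
lift_definition minus_oring :: "oring \<Rightarrow> oring \<Rightarrow> oring" is opD by (intro gen_eq_S gen_eq_M gen_eq_refl gen_C)

instance
proof
  have eq: "A = B \<Longrightarrow> gen A \<Longrightarrow> gen_eq A B" for A B using gen_eq_refl by blast
  have gg: "gen A" if "gen_eq A A" for A using that by (simp add: gen_eq_def)
  fix a b c :: oring
  show "a + b + c = a + (b + c)"
    by transfer (rule eq, simp add: fun_eq_iff op_defs algebra_simps, blast intro: gen.intros gg)
  show "a + b = b + a"
    by transfer (rule eq, simp add: fun_eq_iff op_defs algebra_simps, blast intro: gen.intros gg)
  show "0 + a = a"
    by transfer (rule eq, simp add: fun_eq_iff op_defs algebra_simps, blast intro: gen.intros gg)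
  show "- a + a = 0"
    by transfer (rule eq, simp add: fun_eq_iff op_defs algebra_simps, blast intro: gen.intros gg)
  show "a - b = a + - b"
    by transfer (rule eq, simp add: fun_eq_iff op_defs algebra_simps, blast intro: gen.intros gg)
  show "a * b * c = a * (b * c)"
    by transfer (rule eq, simp add: fun_eq_iff op_defs algebra_simps, blast intro: gen.intros gg)
  \<comment> \<open>The one ring law that holds only modulo null sequences; the others are
    identities between the sequences themselves.\<close>
  show "a * b = b * a"
  proof transfer
    fix A B assume "gen_eq A A" "gen_eq B B"
    then show "gen_eq (opM A B) (opM B A)" using null_com[of B A] by (simp add: gen_eq_def gen_M opcom_def)
  qed
  show "1 * a = a"
    by transfer (rule eq, simp add: fun_eq_iff op_defs algebra_simps, blast intro: gen.intros gg)
  show "(a + b) * c = a * c + b * c"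
    by transfer (rule eq, simp add: fun_eq_iff op_defs algebra_simps, blast intro: gen.intros gg)
  show "(0::oring) \<noteq> 1"
  proof transfer
    have "\<not> bnd (1/2) k (opD (opC 0) (opC 1) k)" for k
    proof
      assume "bnd (1/2) k (opD (opC 0) (opC 1) k)"
      from bndD[OF this, of "\<lambda>_. 1" 1 "\<lambda>_. 0"] show False by (simp add: op_defs deg_def)
    qed
    then have "\<not> null (opD (opC 0) (opC 1))" unfolding null_def by (metis half_gt_zero order_refl zero_less_one)
    then show "\<not> gen_eq (opC 0) (opC 1)" by (simp add: gen_eq_def)
  qed
qed
end

lift_definition oC :: "complex \<Rightarrow> oring" is opC by (intro gen_eq_refl gen.intros)
lift_definition oX :: "hix \<Rightarrow> oring" is opX by (intro gen_eq_refl gen.intros)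
lift_definition oY :: "hix \<Rightarrow> oring" is opY by (intro gen_eq_refl gen.intros)
lift_definition oZ :: oring is opZ by (intro gen_eq_refl gen.intros)

lemma oC_hom: "oC (c + d) = oC c + oC d" "oC (c * d) = oC c * oC d" "oC 1 = 1"
proof -
  have eq: "A = B \<Longrightarrow> gen A \<Longrightarrow> gen_eq A B" for A B using gen_eq_refl by blast
  show "oC (c + d) = oC c + oC d" by transfer (rule eq, auto simp: fun_eq_iff op_defs algebra_simps intro!: gen.intros)
  show "oC (c * d) = oC c * oC d" by transfer (rule eq, auto simp: fun_eq_iff op_defs intro!: gen.intros)
  show "oC 1 = 1" by transfer (intro gen_eq_refl gen.intros)
qed

lemma oring_rel: "oX Ha * oY Ha + (oX Hb * oY Hb + (oX Hc * oY Hc + (oX (Hd I1) * oY (Hd I1) + (oX (Hd I2) * oY (Hd I2) + oX (Hd I3) * oY (Hd I3))))) = oZ * (1 - oZ)"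
proof transfer
  show "gen_eq (opS (opP Ha) (opS (opP Hb) (opS (opP Hc) (opS (opP (Hd I1)) (opS (opP (Hd I2)) (opP (Hd I3)))))))
   (opM opZ (opD (opC 1) opZ))"
    unfolding gen_eq_def using null_rel by (auto intro!: gen.intros)
qed

lemma oring_rep: "\<exists>A. gen A \<and> abs_oring A = t"
  using Quotient_abs_rep[OF Quotient_oring] Quotient_rep_reflp[OF Quotient_oring] unfolding gen_eq_def by blast

section \<open>Cardinality of the ring\<close>

primrec gen_level :: "nat \<Rightarrow> (nat \<Rightarrow> opr) set" where
  "gen_level 0 = range opC \<union> range opX \<union> range opY \<union> {opZ}"
| "gen_level (Suc n) = gen_level n \<union> (case_prod opS ` (gen_level n \<times> gen_level n) \<union> case_prod opM ` (gen_level n \<times> gen_level n))"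

lemma gen_level_mono: "m \<le> n \<Longrightarrow> gen_level m \<subseteq> gen_level n"
  by (rule lift_Suc_mono_le) auto

lemma gen_gen_level: "gen A \<Longrightarrow> \<exists>n. A \<in> gen_level n"
proof (induction rule: gen.induct)
  case (gen_S A B)
  then obtain m n where "A \<in> gen_level m" "B \<in> gen_level n" by blast
  then have "A \<in> gen_level (max m n)" "B \<in> gen_level (max m n)" using gen_level_mono[of m "max m n"] gen_level_mono[of n "max m n"] by auto
  then have "opS A B \<in> gen_level (Suc (max m n))" by force
  then show ?case by blast
next
  case (gen_M A B)
  then obtain m n where "A \<in> gen_level m" "B \<in> gen_level n" by blast
  then have "A \<in> gen_level (max m n)" "B \<in> gen_level (max m n)" using gen_level_mono[of m "max m n"] gen_level_mono[of n "max m n"] by auto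
  then have "opM A B \<in> gen_level (Suc (max m n))" by force
  then show ?case by blast
qed (auto intro: exI[of _ 0])

text \<open>Level 0 consists of a family indexed by \<complex> and finite sets, each further level
  arises by products and finite unions, and countably many levels exhaust the generated
  sequences.\<close>

lemma oring_embed: "\<exists>f :: oring \<Rightarrow> complex. inj f"
proof -
  let ?B = "UNIV :: complex set"
  have inf: "infinite ?B" by (rule infinite_UNIV_char_0)
  have fin: "(card_of (M), card_of (?B)) \<in> ordLeq" if "finite M" for M :: "(nat \<Rightarrow> opr) set"
    using finite_ordLess_infinite[OF card_of_Well_order[of M] card_of_Well_order[of ?B]] that inf
    by (simp add: Field_card_of ordLess_imp_ordLeq)
  have un: "(card_of (M \<union> N), card_of ?B) \<in> ordLeq" if "(card_of M, card_of ?B) \<in> ordLeq" "(card_of N, card_of ?B) \<in> ordLeq"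
    for M N :: "(nat \<Rightarrow> opr) set"
    using that inf by (intro card_of_Un_ordLeq_infinite_Field) (simp_all add: Field_card_of card_of_card_order_on)
  have lev: "(card_of (gen_level n), card_of (?B)) \<in> ordLeq" for n
  proof (induction n)
    case 0
    show ?case unfolding gen_level.simps by (intro un card_of_image fin) simp_all
  next
    case (Suc n)
    have "(card_of (gen_level n \<times> gen_level n), card_of ?B) \<in> ordLeq"
      using inf Suc by (intro card_of_Times_ordLeq_infinite_Field) (simp_all add: Field_card_of card_of_card_order_on)
    then show ?case unfolding gen_level.simps by (intro un Suc.IH ordLeq_transitive[OF card_of_image])
  qed
  have "(card_of (UNIV :: nat set), card_of (?B)) \<in> ordLeq" using inf by (simp add: infinite_iff_card_of_nat)
  then have "(card_of (\<Union>n. gen_level n), card_of (?B)) \<in> ordLeq" using inf lev by (intro card_of_UNION_ordLeq_infinite) auto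
  moreover have "(UNIV :: oring set) \<subseteq> abs_oring ` (\<Union>n. gen_level n)"
  proof
    fix t :: oring
    obtain A where "gen A" "abs_oring A = t" using oring_rep by blast
    then show "t \<in> abs_oring ` (\<Union>n. gen_level n)" using gen_gen_level[of A] by blast
  qed
  then have "(card_of (UNIV :: oring set), card_of (\<Union>n. gen_level n)) \<in> ordLeq" by (rule surj_imp_ordLeq)
  ultimately have "(card_of (UNIV :: oring set), card_of (?B)) \<in> ordLeq" by (meson ordLeq_transitive)
  then show ?thesis by (auto simp: card_of_ordLeq[symmetric])
qed


section \<open>The compression argument\<close>

text \<open>Gaussian elimination for homogeneous systems with more unknowns than equations; the
  unknowns are the values of \<open>f\<close> on \<open>P\<close>, and one equation is removed in
  each step of the induction.\<close>

lemma linear_kernel: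
  fixes L :: "'q \<Rightarrow> ('p \<Rightarrow> complex) \<Rightarrow> complex"
  assumes "finite Q" "finite P" "card Q < card P"
    and "\<And>q f g. q \<in> Q \<Longrightarrow> L q (\<lambda>x. f x + g x) = L q f + L q g" "\<And>q c f. q \<in> Q \<Longrightarrow> L q (\<lambda>x. c * f x) = c * L q f"
  shows "\<exists>f. (\<forall>x. x \<notin> P \<longrightarrow> f x = 0) \<and> (\<exists>x. f x \<noteq> 0) \<and> (\<forall>q\<in>Q. L q f = 0)"
  using assms
proof (induction Q arbitrary: P L rule: finite_induct)
  case empty
  then obtain p where "p \<in> P" by fastforce
  then show ?case by (intro exI[of _ "\<lambda>x. if x = p then 1 else 0"]) auto
next
  case (insert q Q)
  define d :: "'p \<Rightarrow> 'p \<Rightarrow> complex" where "d p = (\<lambda>x. if x = p then 1 else 0)" for p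
  have add: "L r (\<lambda>x. f x + g x) = L r f + L r g" and sc: "L r (\<lambda>x. c * f x) = c * L r f" if "r \<in> insert q Q" for r f g c
    using insert.prems that by auto
  show ?case
  proof (cases "\<forall>p\<in>P. L q (d p) = 0")
    case True
    have "\<exists>f. (\<forall>x. x \<notin> P \<longrightarrow> f x = 0) \<and> (\<exists>x. f x \<noteq> 0) \<and> (\<forall>r\<in>Q. L r f = 0)"
      using insert.prems insert.hyps by (intro insert.IH) auto
    then obtain f where f: "\<And>x. x \<notin> P \<Longrightarrow> f x = 0" "\<exists>x. f x \<noteq> 0" "\<forall>r\<in>Q. L r f = 0" by blast
    have "L q (\<lambda>x. if x \<in> R then f x else 0) = 0" if "finite R" "R \<subseteq> P" for R
      using that
    proof (induction R rule: finite_induct)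
      case empty
      show ?case using sc[of q 0 "\<lambda>_. 0"] by simp
    next
      case (insert p R)
      have "(\<lambda>x. if x \<in> insert p R then f x else 0) = (\<lambda>x. (if x \<in> R then f x else 0) + f p * d p x)"
        using insert.hyps by (auto simp: fun_eq_iff d_def)
      then show ?case using insert True by (simp add: add sc)
    qed
    from this[of P] have "L q (\<lambda>x. if x \<in> P then f x else 0) = 0" using insert.prems by simp
    moreover have "(\<lambda>x. if x \<in> P then f x else 0) = f" using f(1) by auto
    ultimately show ?thesis using f by auto
  next
    case False
    then obtain p where p: "p \<in> P" "L q (d p) \<noteq> 0" by blast
    \<comment> \<open>The equation \<open>q\<close> is solved for the unknown at \<open>p\<close>,
      and the solution is substituted into the other equations.\<close>
    define L' where "L' r f = L r f + (- (L r (d p) / L q (d p))) * L q f" for r f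
    have "\<exists>f. (\<forall>x. x \<notin> P - {p} \<longrightarrow> f x = 0) \<and> (\<exists>x. f x \<noteq> 0) \<and> (\<forall>r\<in>Q. L' r f = 0)"
      using insert.prems insert.hyps p(1) by (intro insert.IH) (auto simp: L'_def add sc algebra_simps add_divide_distrib)
    then obtain f where f: "\<And>x. x \<notin> P - {p} \<Longrightarrow> f x = 0" "\<exists>x. f x \<noteq> 0" "\<And>r. r \<in> Q \<Longrightarrow> L' r f = 0" by blast
    define g where "g = (\<lambda>x. f x + (- (L q f / L q (d p))) * d p x)"
    have g: "L r g = L r f + (- (L q f / L q (d p))) * L r (d p)" if "r \<in> insert q Q" for r
      unfolding g_def using that by (simp only: add sc)
    obtain x where x: "f x \<noteq> 0" using f(2) by blast
    with f(1) have "x \<noteq> p" by auto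
    then have "g x \<noteq> 0" using x by (simp add: g_def d_def)
    moreover have "g y = 0" if "y \<notin> P" for y using that f(1)[of y] p(1) by (auto simp: g_def d_def)
    moreover have "L q g = 0" using g[of q] p(2) by simp
    moreover have "L r g = 0" if "r \<in> Q" for r using g[of r] f(3)[OF that] that p(2) by (simp add: L'_def field_simps)
    ultimately show ?thesis by blast
  qed
qed

text \<open>The vanishing and lower bounds used later concern actual operators, so representatives
  must be chosen; by \<open>reps_null\<close> two choices differ by a null sequence.\<close>

definition reps :: "(nat \<Rightarrow> opr) \<Rightarrow> oring \<Rightarrow> bool" where
  "reps A t \<longleftrightarrow> gen A \<and> abs_oring A = t"

lemma reps_exists: "\<exists>A. reps A t"
  using oring_rep by (simp add: reps_def)

lemma reps_S: "reps A s \<Longrightarrow> reps B t \<Longrightarrow> reps (opS A B) (s + t)"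
  and reps_M: "reps A s \<Longrightarrow> reps B t \<Longrightarrow> reps (opM A B) (s * t)"
  and reps_D: "reps A s \<Longrightarrow> reps B t \<Longrightarrow> reps (opD A B) (s - t)"
  and reps_N: "reps A s \<Longrightarrow> reps (opN A) (- s)"
  by (auto simp: reps_def gen.intros plus_oring.abs_eq times_oring.abs_eq minus_oring.abs_eq uminus_oring.abs_eq gen_eq_refl)

lemma reps_C: "reps (opC 0) 0" "reps (opC 1) 1"
  and reps_XYZ: "reps (opX i) (oX i)" "reps (opY i) (oY i)" "reps opZ oZ"
  by (simp_all add: reps_def gen.intros zero_oring.abs_eq one_oring.abs_eq oX.abs_eq oY.abs_eq oZ.abs_eq)

lemma reps_null: "reps A t \<Longrightarrow> reps B t \<Longrightarrow> null (opD A B)"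
  using Quotient_rel[OF Quotient_oring, of A B] gen_eq_refl by (auto simp: reps_def gen_eq_def)

lemma reps_sum: "finite J \<Longrightarrow> (\<And>j. j \<in> J \<Longrightarrow> reps (A j) (t j)) \<Longrightarrow> reps (\<lambda>k f a. \<Sum>j\<in>J. A j k f a) (\<Sum>j\<in>J. t j)"
proof (induction J rule: finite_induct)
  case empty
  have "(\<lambda>k f a. 0) = opC 0" by (simp add: fun_eq_iff opC_def)
  then show ?case using reps_C(1) by simp
next
  case (insert j J)
  have "(\<lambda>k f a. \<Sum>j\<in>insert j J. A j k f a) = opS (A j) (\<lambda>k f a. \<Sum>j\<in>J. A j k f a)"
    using insert.hyps by (simp add: fun_eq_iff opS_def)
  then show ?case using insert by (simp add: reps_S)
qed

lemma op_linear_sum: "finite I \<Longrightarrow> op_linear R \<Longrightarrow> R (\<lambda>b. \<Sum>i\<in>I. f i b) a = (\<Sum>i\<in>I. R (f i) a)"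
proof (induction I rule: finite_induct)
  case empty
  then show ?case using op_linearD(2)[of R 0 "\<lambda>_. 0"] by (simp add: fun_eq_iff)
next
  case (insert i I)
  then show ?case using op_linearD(1)[of R "f i" "\<lambda>b. \<Sum>i\<in>I. f i b"] by simp
qed

definition unit_vec :: "'i \<Rightarrow> 'i \<Rightarrow> 'a::comm_ring_1" where
  "unit_vec i j = (if j = i then 1 else 0)"

lemma mlin_expand:
  fixes A :: "('i::finite \<Rightarrow> 'a::comm_ring_1) \<Rightarrow> 'k \<Rightarrow> 'a"
  assumes A: "mlin A"
  shows "A v j = (\<Sum>i\<in>UNIV. A (unit_vec i) j * v i)"
proof -
  have "A (\<lambda>i. if i \<in> I then v i else 0) j = (\<Sum>i\<in>I. A (unit_vec i) j * v i)" if "finite I" for I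
    using that
  proof (induction I rule: finite_induct)
    case empty
    have "A (0 \<cdot> v) = 0 \<cdot> A v" using A by (simp add: mlin_def)
    moreover have "0 \<cdot> v = (\<lambda>i. 0)" by (simp add: fun_eq_iff)
    ultimately show ?case by (simp add: fun_eq_iff)
  next
    case (insert i I)
    have "(\<lambda>x. if x \<in> insert i I then v x else 0) = v i \<cdot> unit_vec i + (\<lambda>x. if x \<in> I then v x else 0)"
      using insert.hyps by (auto simp: fun_eq_iff unit_vec_def)
    then have "A (\<lambda>x. if x \<in> insert i I then v x else 0) = v i \<cdot> A (unit_vec i) + A (\<lambda>x. if x \<in> I then v x else 0)"
      using A by (simp add: mlin_def)
    then show ?case using insert by (simp add: mult.commute)
  qed
  from this[of UNIV] show ?thesis by simp
qed

section \<open>Counting points of simplices\<close>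

lemma finite_deg: "finite {a. deg a \<le> m}"
proof (rule finite_subset)
  show "{a. deg a \<le> m} \<subseteq> PiE UNIV (\<lambda>_. {..m})" using deg_ge order_trans by fastforce
qed (simp add: finite_PiE)

text \<open>The slack \<open>m - deg a\<close> becomes a seventh entry, so that the points
  correspond to lists of length 7 with sum \<open>m\<close>.\<close>

lemma card_deg: "card {a. deg a \<le> m} = (m + 6) choose 6"
proof -
  define F where "F a = [a Ha, a Hb, a Hc, a (Hd I1), a (Hd I2), a (Hd I3), m - deg a]" for a
  define G :: "nat list \<Rightarrow> mi" where
    "G l = (\<lambda>h. case h of Ha \<Rightarrow> l ! 0 | Hb \<Rightarrow> l ! 1 | Hc \<Rightarrow> l ! 2 | Hd t \<Rightarrow> (case t of I1 \<Rightarrow> l ! 3 | I2 \<Rightarrow> l ! 4 | I3 \<Rightarrow> l ! 5))" for l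
  have "bij_betw F {a. deg a \<le> m} {l. length l = 7 \<and> sum_list l = m}"
  proof (rule bij_betw_byWitness[where f' = G])
    show "\<forall>a\<in>{a. deg a \<le> m}. G (F a) = a"
      by (auto simp: F_def G_def fun_eq_iff split: hix.split three.split)
    show "\<forall>l\<in>{l. length l = 7 \<and> sum_list l = m}. F (G l) = l"
      by (auto simp: F_def G_def deg_def numeral_eq_Suc length_Suc_conv)
    show "F ` {a. deg a \<le> m} \<subseteq> {l. length l = 7 \<and> sum_list l = m}" by (auto simp: F_def deg_def)
    show "G ` {l. length l = 7 \<and> sum_list l = m} \<subseteq> {a. deg a \<le> m}"
      by (auto simp: G_def deg_def numeral_eq_Suc length_Suc_conv)
  qed
  then have "card {a. deg a \<le> m} = card {l::nat list. length l = 7 \<and> sum_list l = m}" by (rule bij_betw_same_card)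
  also have "\<dots> = (m + 6) choose m" by (simp add: card_length_sum_list add.commute)
  also have "\<dots> = (m + 6) choose 6" by (simp add: binomial_symmetric[of m "m + 6"])
  finally show ?thesis .
qed

lemma choose_6th_difference:
  "int ((h + 6) choose 6) - 6 * int ((h + 5) choose 6) + 15 * int ((h + 4) choose 6) - 20 * int ((h + 3) choose 6)
    + 15 * int ((h + 2) choose 6) - 6 * int ((h + 1) choose 6) + int (h choose 6) = 1"
  by (simp add: numeral_eq_Suc)

lemma UNIV_three: "(UNIV :: three set) = {I1, I2, I3}"
  using three.exhaust by blast

lemma UNIV_oct: "(UNIV :: oct_ix set) = {OE, OF, OU I1, OU I2, OU I3, OV I1, OV I2, OV I3}"
proof -
  have "i \<in> {OE, OF, OU I1, OU I2, OU I3, OV I1, OV I2, OV I3}" for i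
    by (cases i) (simp_all, (metis three.exhaust)+)
  then show ?thesis by blast
qed

lemma UNIV_blk: "(UNIV :: blk set) = {Ka1, Ka2, Kb1, Kb2}"
  using blk.exhaust by blast

lemma UNIV_alb: "(UNIV :: alb_ix set) = range Dg \<union> case_prod Of ` (UNIV \<times> UNIV)"
proof -
  have "i \<in> range Dg \<union> case_prod Of ` (UNIV \<times> UNIV)" for i by (cases i) auto
  then show ?thesis by blast
qed

lemma UNIV_brown: "(UNIV :: brown_ix set) = {R1, R2} \<union> (range A1 \<union> range A2)"
proof -
  have "i \<in> {R1, R2} \<union> (range A1 \<union> range A2)" for i by (cases i) auto
  then show ?thesis by blast
qed

lemma UNIV_v14: "(UNIV :: v14 set) = {Vt, Vs, Vx, Vy, Vd True, Vd False} \<union> range Vo"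
proof -
  have "i \<in> {Vt, Vs, Vx, Vy, Vd True, Vd False} \<union> range Vo" for i by (cases i) auto
  then show ?thesis by blast
qed

instance oct_ix :: finite by standard (simp add: UNIV_oct)
instance blk :: finite by standard (simp add: UNIV_blk)
instance alb_ix :: finite by standard (simp add: UNIV_alb)
instance brown_ix :: finite by standard (simp add: UNIV_brown)
instance v14 :: finite by standard (simp add: UNIV_v14)

lemma card_ix: "card (UNIV :: oct_ix set) = 8" "card (UNIV :: alb_ix set) = 27"
  "card (UNIV :: brown_ix set) = 56" "card (UNIV :: v14 set) = 14"
proof -
  show o: "card (UNIV :: oct_ix set) = 8" by (simp add: UNIV_oct)
  have t: "card (UNIV :: three set) = 3" by (simp add: UNIV_three)
  have "card (UNIV :: alb_ix set) = card (range Dg) + card (case_prod Of ` (UNIV \<times> UNIV))"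
    unfolding UNIV_alb by (rule card_Un_disjoint) auto
  also have "\<dots> = card (UNIV :: three set) + card (UNIV :: (three \<times> oct_ix) set)"
    by (subst (1 2) card_image) (auto simp: inj_on_def)
  also have "card (UNIV :: (three \<times> oct_ix) set) = 3 * 8"
    unfolding UNIV_Times_UNIV[symmetric] card_cartesian_product o t ..
  finally show a: "card (UNIV :: alb_ix set) = 27" by (simp add: t)
  have "card (UNIV :: brown_ix set) = card {R1, R2} + card (range A1 \<union> range A2)"
    unfolding UNIV_brown by (rule card_Un_disjoint) auto
  also have "card (range A1 \<union> range A2) = card (range A1) + card (range A2)"
    by (rule card_Un_disjoint) auto
  also have "\<dots> = card (UNIV :: alb_ix set) + card (UNIV :: alb_ix set)"
    by (subst (1 2) card_image) (auto simp: inj_on_def)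
  finally show "card (UNIV :: brown_ix set) = 56" by (simp add: a)
  have "card (UNIV :: v14 set) = card {Vt, Vs, Vx, Vy, Vd True, Vd False} + card (range Vo)"
    unfolding UNIV_v14 by (rule card_Un_disjoint) auto
  also have "card (range Vo) = card (UNIV :: oct_ix set)"
    by (rule card_image) (auto simp: inj_on_def)
  finally show "card (UNIV :: v14 set) = 14" by (simp add: o)
qed

text \<open>By weight the 64 coordinates correspond to a basis of the exterior algebra of \<open>\<complex>\<^sup>6\<close>: in the idempotent matrix, \<open>x\<^sub>i\<close> occurs
  only where the weight of the column exceeds that of the row by one, and \<open>y\<^sub>i\<close> only in the opposite case.\<close>

fun oct_weight :: "bool \<Rightarrow> oct_ix \<Rightarrow> nat" where
  "oct_weight True OE = 0" | "oct_weight True OF = 2" | "oct_weight True (OU k) = 2" | "oct_weight True (OV k) = 0"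
| "oct_weight False OE = 4" | "oct_weight False OF = 0" | "oct_weight False (OU k) = 2" | "oct_weight False (OV k) = 2"

fun weight :: "k64 \<Rightarrow> nat" where
  "weight (Ka1, t, o') = 2 + oct_weight t o'"
| "weight (Ka2, t, o') = (if t then 2 else 0) + oct_weight t o'"
| "weight (Kb1, t, o') = 1 + oct_weight t o'"
| "weight (Kb2, t, o') = (if t then 3 else 1) + oct_weight t o'"

lemma sum_weight: "(\<Sum>c\<in>UNIV. G (weight c)) = G 0 + 6 * G 1 + 15 * G 2 + 20 * G 3 + 15 * G 4 + 6 * G 5 + (G 6 :: int)"
  unfolding UNIV_Times_UNIV[symmetric] sum.cartesian_product[symmetric] UNIV_blk UNIV_bool UNIV_oct
  by (simp add: numeral_eq_Suc)

lemma weight_le: "weight c \<le> 6" and weight_parity: "even (weight c) \<longleftrightarrow> fst c \<in> {Ka1, Ka2}"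
proof -
  have "weight c \<le> 6 \<and> (even (weight c) \<longleftrightarrow> fst c \<in> {Ka1, Ka2})"
    by (cases c rule: weight.cases; rename_tac t o'; case_tac t; case_tac o') auto
  then show "weight c \<le> 6" "even (weight c) \<longleftrightarrow> fst c \<in> {Ka1, Ka2}" by auto
qed

text \<open>\<open>X\<^sub>i\<close> and \<open>Y\<^sub>i\<close> change the degree of \<open>a\<close> against the weight, so \<open>deg a + weight c\<close> is constant along off-diagonal entries.
  As these join coordinates of different parity, they vanish on the windows below.\<close>

fun window :: "nat \<Rightarrow> kix \<Rightarrow> mi set" where
  "window h (Inl c) = (if even (weight c) then {a. deg a + weight c \<le> h} else {a. h < deg a + weight c \<and> deg a \<le> 2 * h})"
| "window h (Inr r) = {a. deg a \<le> 2 * h}"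

lemma window_deg: "a \<in> window h i \<Longrightarrow> deg a \<le> 2 * h"
  by (cases i) (auto split: if_splits)

lemma card_window:
  assumes h: "6 \<le> h"
  shows "finite (Sigma UNIV (window h))" "card (Sigma UNIV (window h)) = 60 * card {a. deg a \<le> 2 * h} + 1"
proof -
  have fin: "finite (window h i)" for i
    by (rule finite_subset[OF _ finite_deg[of "2 * h"]]) (auto dest: window_deg)
  then show "finite (Sigma UNIV (window h))" by auto
  let ?d = "card {a. deg a \<le> 2 * h}"
  \<comment> \<open>An even weight contributes a small simplex, an odd one its complement in the
    full simplex. Half of the 64 coordinates are odd, which gives 32 full simplices; the small ones
    remain with alternating binomial multiplicities and add up to 1. As weights are at most 6, the
    hypothesis on \<open>h\<close> keeps \<open>h - n\<close> from being truncated.\<close>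
  define G where "G n = (if even n then int (card {a. deg a \<le> h - n}) else int ?d - int (card {a. deg a \<le> h - n}))" for n
  have window: "int (card (window h (Inl c))) = G (weight c)" for c
  proof -
    have p: "weight c \<le> h" using weight_le[of c] h by simp
    show ?thesis
    proof (cases "even (weight c)")
      case True
      then have "window h (Inl c) = {a. deg a \<le> h - weight c}" using p by auto
      then show ?thesis using True by (simp add: G_def)
    next
      case False
      then have "window h (Inl c) = {a. deg a \<le> 2 * h} - {a. deg a \<le> h - weight c}" using p by auto
      moreover have "{a. deg a \<le> h - weight c} \<subseteq> {a. deg a \<le> 2 * h}" by auto
      ultimately show ?thesis using False finite_deg card_mono[OF finite_deg[of "2 * h"], of "{a. deg a \<le> h - weight c}"]
        by (simp add: G_def card_Diff_subset of_nat_diff)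
    qed
  qed
  have "int (card (Sigma UNIV (window h))) = (\<Sum>i\<in>UNIV. int (card (window h i)))"
    using fin by (simp add: card_SigmaI)
  also have "\<dots> = (\<Sum>c\<in>UNIV. int (card (window h (Inl c)))) + (\<Sum>r\<in>UNIV. int (card (window h (Inr r))))"
    unfolding UNIV_Plus_UNIV[symmetric] by (subst sum.Plus) (simp_all add: comp_def del: window.simps)
  also have "(\<Sum>r\<in>UNIV. int (card (window h (Inr r)))) = 28 * int ?d"
  proof -
    have "card ((UNIV :: v14 set) <+> (UNIV :: v14 set)) = 28" by (subst card_Plus) (simp_all add: card_ix)
    then show ?thesis by simp
  qed
  also have "(\<Sum>c\<in>UNIV. int (card (window h (Inl c)))) = 32 * int ?d + 1"
    unfolding window sum_weight using choose_6th_difference[of h] h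
    by (simp add: G_def card_deg algebra_simps)
  finally show "card (Sigma UNIV (window h)) = 60 * ?d + 1" by linarith
qed


section \<open>The point of the base and the entries of its matrix\<close>

definition oring_point :: "v14 \<Rightarrow> oring" where
  "oring_point l = (case l of Vt \<Rightarrow> oZ | Vs \<Rightarrow> 1 - oZ | Vx \<Rightarrow> oX Ha | Vy \<Rightarrow> oY Ha | Vd t \<Rightarrow> (if t then oX Hb else - oY Hb)
     | Vo i \<Rightarrow> (case i of OE \<Rightarrow> oX Hc | OF \<Rightarrow> oY Hc | OU k \<Rightarrow> oX (Hd k) | OV k \<Rightarrow> - oY (Hd k)))"

lemma oring_point_simps [simp]: "oring_point Vt = oZ" "oring_point Vs = 1 - oZ" "oring_point Vx = oX Ha" "oring_point Vy = oY Ha" "oring_point (Vd True) = oX Hb" "oring_point (Vd False) = - oY Hb"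
  "oring_point (Vo OE) = oX Hc" "oring_point (Vo OF) = oY Hc" "oring_point (Vo (OU k)) = oX (Hd k)" "oring_point (Vo (OV k)) = - oY (Hd k)"
  by (simp_all add: oring_point_def)

text \<open>The minus signs at \<open>Vd False\<close> and \<open>OV k\<close> compensate those in
  \<open>mu\<close> and in the octonion norm, so that all six products enter
  \<open>x y - mu m\<close> with a plus sign.\<close>

lemma base_point_oring: "base_point oring_point"
  using oring_rel by (simp add: base_point_def mu_def onrm_def alb_simps algebra_simps)

text \<open>\<open>m\<close> is the weight of the row and \<open>n\<close> that of the column. Only
  their difference matters, by \<open>weight_entry_cong\<close>; this lets one octonion computation
  serve all blocks of the matrix.\<close>

definition weight_entry :: "nat \<Rightarrow> nat \<Rightarrow> oring \<Rightarrow> bool" where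
  "weight_entry m n t \<longleftrightarrow> t = 0 \<or> (\<exists>g. n = Suc m \<and> (t = oX g \<or> t = - oX g)) \<or> (\<exists>g. m = Suc n \<and> (t = oY g \<or> t = - oY g))"

lemma weight_entry_simps: "weight_entry m n 0" "n = Suc m \<Longrightarrow> weight_entry m n (oX g)" "m = Suc n \<Longrightarrow> weight_entry m n (oY g)" "weight_entry m n (- t) = weight_entry m n t"
proof -
  have "(- t = a) = (t = - a)" for a by auto
  then show "weight_entry m n (- t) = weight_entry m n t" by (auto simp: weight_entry_def)
qed (auto simp: weight_entry_def)

lemma weight_entry_cong: "m + n' = m' + n \<Longrightarrow> weight_entry m n t = weight_entry m' n' t"
  by (auto simp: weight_entry_def)

abbreviation oring_point_oct :: "oring oct" where "oring_point_oct \<equiv> \<lambda>k. oring_point (Vo k)"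

lemma weight_entry_otr: "weight_entry (oct_weight True i + 1) (oct_weight False j) ((unit_vec j \<bullet> oring_point_oct) i)" "weight_entry (oct_weight False i) (oct_weight True j + 1) ((oring_point_oct \<bullet> unit_vec j) i)"
proof -
  have "\<forall>i\<in>UNIV. \<forall>j\<in>UNIV. weight_entry (oct_weight True i + 1) (oct_weight False j) ((unit_vec j \<bullet> oring_point_oct) i) \<and> weight_entry (oct_weight False i) (oct_weight True j + 1) ((oring_point_oct \<bullet> unit_vec j) i)"
    unfolding UNIV_oct by (simp add: otr_def ocnj_def omul_def unit_vec_def weight_entry_simps)
  then show "weight_entry (oct_weight True i + 1) (oct_weight False j) ((unit_vec j \<bullet> oring_point_oct) i)" "weight_entry (oct_weight False i) (oct_weight True j + 1) ((oring_point_oct \<bullet> unit_vec j) i)" by auto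
qed

lemma weight_entry_otr': "m + oct_weight False j = oct_weight True i + 1 + n \<Longrightarrow> weight_entry m n ((unit_vec j \<bullet> oring_point_oct) i)"
  "m + (oct_weight True j + 1) = oct_weight False i + n \<Longrightarrow> weight_entry m n ((oring_point_oct \<bullet> unit_vec j) i)"
  using weight_entry_otr weight_entry_cong by blast+

lemma otr_const: "(a \<bullet> (\<lambda>k. - b k)) i = - ((a \<bullet> b) i)" "((\<lambda>k. - a k) \<bullet> b) i = - ((a \<bullet> b) i)"
  "(a \<bullet> (\<lambda>k. 0)) i = 0" "((\<lambda>k. 0) \<bullet> b) i = 0"
  by (simp_all add: otr_def ocnj_def omul_def algebra_simps split: oct_ix.split)

lemma rd_crs: "rd (crs (alb10 q) (alb23 w)) (True, k) = ((\<lambda>k. w (False, k)) \<bullet> (\<lambda>k. q (Vo k))) k - q (Vd True) * w (True, k)"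
  "rd (crs (alb10 q) (alb23 w)) (False, k) = ((\<lambda>k. q (Vo k)) \<bullet> (\<lambda>k. w (True, k))) k - q (Vd False) * w (False, k)"
  using crs_u10_a23[OF u10_alb10[of q] a23_alb23[of w], THEN fun_cong, of k]
  by (simp_all add: rd_def alb_simps comp_def)

lemma crs_cE_alb10: "crs cE (alb10 q) = alb10 (\<lambda>l. case l of Vd t \<Rightarrow> q (Vd (\<not> t)) | Vo k \<Rightarrow> - q (Vo k) | _ \<Rightarrow> 0)"
  by (simp add: crs_cE fun_eq_iff all_alb all_three alb_simps)

lemma emap_rows:
  "emap p v (Ka1, tk) = p Vt * v (Ka1, tk) + p Vy * v (Kb1, tk) + rd (crs (alb10 p) (alb23 (\<lambda>i. v (Kb2, i)))) tk"
  "emap p v (Ka2, tk) = p Vt * v (Ka2, tk) + p Vx * v (Kb2, tk) + rd (crs (crs cE (alb10 p)) (alb23 (\<lambda>i. v (Kb1, i)))) tk"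
  "emap p v (Kb1, tk) = (1 - p Vt) * v (Kb1, tk) + p Vx * v (Ka1, tk) - rd (crs (alb10 p) (alb23 (\<lambda>i. v (Ka2, i)))) tk"
  "emap p v (Kb2, tk) = (1 - p Vt) * v (Kb2, tk) + p Vy * v (Ka2, tk) - rd (crs (crs cE (alb10 p)) (alb23 (\<lambda>i. v (Ka1, i)))) tk"
  by (cases tk; simp add: emap_def Let_def rd_def alb_simps)+

lemma unit_vec_k64: "unit_vec (B, t, i) (B', t', i') = (if B = B' \<and> t = t' then unit_vec i i' else 0)"
  by (simp add: unit_vec_def)

lemma unit_vec_val: "unit_vec i i = 1" "i \<noteq> j \<Longrightarrow> unit_vec i j = 0"
  by (simp_all add: unit_vec_def)

lemma entry_unit_vec: "(i = j \<Longrightarrow> weight_entry m n t) \<Longrightarrow> weight_entry m n (t * unit_vec i j)"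
  by (auto simp: unit_vec_def weight_entry_def)

definition diag_entry :: "kix \<Rightarrow> oring" where
  "diag_entry i = (case i of Inl c \<Rightarrow> if fst c \<in> {Ka1, Ka2} then oZ else 1 - oZ | Inr _ \<Rightarrow> 1)"

lemma emap_entry: "c \<noteq> c' \<Longrightarrow> weight_entry (weight c') (weight c) (emap oring_point (unit_vec c) c')"
  and emap_diag: "emap oring_point (unit_vec c) c = diag_entry (Inl c)"
proof -
  obtain B t i B' t' i' where c: "c = (B, t, i)" "c' = (B', t', i')" by (metis prod.exhaust)
  note rows = emap_rows rd_crs crs_cE_alb10 otr_const unit_vec_k64 unit_vec_val weight_entry_simps
  show "weight_entry (weight c') (weight c) (emap oring_point (unit_vec c) c')" if "c \<noteq> c'"
    using that unfolding c
    by (cases B; cases B'; cases t; cases t') (auto simp: rows intro!: entry_unit_vec weight_entry_otr')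
  show "emap oring_point (unit_vec c) c = diag_entry (Inl c)"
    unfolding c by (cases B; cases t) (simp_all add: rows diag_entry_def)
qed

lemma tmap_entry: "i \<noteq> i' \<Longrightarrow> tmap oring_point (unit_vec i) i' = 0 \<or> (\<exists>c c'. i = Inl c \<and> i' = Inl c' \<and> weight_entry (weight c') (weight c) (tmap oring_point (unit_vec i) i'))"
  and tmap_diag: "tmap oring_point (unit_vec i) i = diag_entry i"
proof -
  have z: "(unit_vec (Inr r) :: kix \<Rightarrow> oring) \<circ> Inl = 0 \<cdot> 0" for r by (simp add: fun_eq_iff unit_vec_def)
  have c: "(unit_vec (Inl c) :: kix \<Rightarrow> oring) \<circ> Inl = unit_vec c" for c by (simp add: fun_eq_iff unit_vec_def)
  have e0: "emap oring_point (0 \<cdot> 0) = 0 \<cdot> emap oring_point 0" by (rule emap_lin)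
  show "tmap oring_point (unit_vec i) i = diag_entry i"
    by (cases i) (simp_all add: tmap_def c emap_diag, simp add: diag_entry_def unit_vec_def)
  show "i \<noteq> i' \<Longrightarrow> tmap oring_point (unit_vec i) i' = 0 \<or> (\<exists>c c'. i = Inl c \<and> i' = Inl c' \<and> weight_entry (weight c') (weight c) (tmap oring_point (unit_vec i) i'))"
    by (cases i; cases i') (auto simp: tmap_def c z e0 emap_entry, simp_all add: unit_vec_def)
qed

text \<open>Each entry has a representative for which the statements on windows hold exactly, not
  just up to null sequences: a signed single shift or zero off the diagonal, a multiplication
  operator on it.\<close>

lemma tmap_rep:
  "\<exists>\<tau>. reps \<tau> (tmap oring_point (unit_vec i) i') \<and> (\<forall>h f a. 12 \<le> h \<longrightarrow> (\<forall>b. b \<notin> window h i \<longrightarrow> f b = 0) \<longrightarrow> a \<in> window h i' \<longrightarrow>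
     (if i = i' then cmod (f a) / 4 \<le> cmod (\<tau> (2 * h) f a) else \<tau> (2 * h) f a = 0))"
proof (cases "i = i'")
  case True
  show ?thesis
  proof (cases i)
    case (Inr r)
    have "reps (opC 1) (tmap oring_point (unit_vec i) i)" using reps_C(2) by (simp add: tmap_diag Inr diag_entry_def)
    then show ?thesis unfolding True by (intro exI[of _ "opC 1"]) (simp add: opC_def True)
  next
    case (Inl c)
    show ?thesis
    proof (cases "fst c \<in> {Ka1, Ka2}")
      case a: True
      then have "reps opZ (tmap oring_point (unit_vec i) i)" using reps_XYZ(3) by (simp add: tmap_diag Inl diag_entry_def)
      moreover have "cmod (f a) / 4 \<le> cmod (opZ (2 * h) f a)" if "12 \<le> h" "a \<in> window h i" for h f a
      proof -
        \<comment> \<open>On an even window the degree is at most half of \<open>k = 2 h\<close>, so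
          \<open>Z\<close> is at least 1/2 there.\<close>
        have "deg a \<le> h" using that a weight_parity[of c] by (simp add: Inl)
        then have "real (deg a) / real (2 * h) \<le> 1 / 2" using that by (simp add: divide_le_eq)
        then have "1 / 4 \<le> \<bar>1 - real (deg a) / real (2 * h)\<bar>" by linarith
        then have "1 / 4 * cmod (f a) \<le> \<bar>1 - real (deg a) / real (2 * h)\<bar> * cmod (f a)" by (rule mult_right_mono) simp
        then show ?thesis unfolding opZ_def norm_mult norm_of_real by simp
      qed
      ultimately show ?thesis unfolding True[symmetric] by (intro exI[of _ opZ]) (simp del: window.simps)
    next
      case b: False
      then have "reps (opD (opC 1) opZ) (tmap oring_point (unit_vec i) i)" using reps_D[OF reps_C(2) reps_XYZ(3)] by (simp add: tmap_diag Inl diag_entry_def)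
      moreover have "cmod (f a) / 4 \<le> cmod (opD (opC 1) opZ (2 * h) f a)" if "12 \<le> h" "a \<in> window h i" for h f a
      proof -
        have "h < deg a + weight c" using that b weight_parity[of c] by (simp add: Inl split: if_splits)
        \<comment> \<open>On an odd window \<open>deg a\<close> exceeds \<open>h - 6\<close>; the
          assumption \<open>12 \<le> h\<close> makes this at least \<open>h/2\<close>, a quarter of
          \<open>k = 2 h\<close>. Both the 12 and the 1/4 originate here.\<close>
        then have "h \<le> 2 * deg a" using that weight_le[of c] by linarith
        then have "1 / 4 \<le> real (deg a) / real (2 * h)" using that by (simp add: le_divide_eq)
        then have "1 / 4 * cmod (f a) \<le> \<bar>real (deg a) / real (2 * h)\<bar> * cmod (f a)" by (intro mult_right_mono) simp_all
        moreover have "opD (opC 1) opZ (2 * h) f a = of_real (real (deg a) / real (2 * h)) * f a"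
          by (simp add: op_defs algebra_simps)
        ultimately show ?thesis by (simp only: norm_mult norm_of_real)
      qed
      ultimately show ?thesis unfolding True[symmetric] by (intro exI[of _ "opD (opC 1) opZ"]) (simp del: window.simps)
    qed
  qed
next
  case False
  have neg: ?thesis if "reps \<tau> (tmap oring_point (unit_vec i) i')" "\<And>h f a. (\<forall>b. b \<notin> window h i \<longrightarrow> f b = 0) \<Longrightarrow> a \<in> window h i' \<Longrightarrow> \<tau> (2 * h) f a = 0" for \<tau>
    using that False by auto
  consider "tmap oring_point (unit_vec i) i' = 0" | c c' where "i = Inl c" "i' = Inl c'" "weight_entry (weight c') (weight c) (tmap oring_point (unit_vec i) i')"
    using tmap_entry[OF False] by blast
  then show ?thesis
  proof cases
    case 1
    then show ?thesis using reps_C(1) by (intro neg[of "opC 0"]) (simp_all add: opC_def)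
  next
    case c: 2
    consider "tmap oring_point (unit_vec i) i' = 0"
      | g where "weight c = Suc (weight c')" "tmap oring_point (unit_vec i) i' = oX g \<or> tmap oring_point (unit_vec i) i' = - oX g"
      | g where "weight c' = Suc (weight c)" "tmap oring_point (unit_vec i) i' = oY g \<or> tmap oring_point (unit_vec i) i' = - oY g"
      using c(3) unfolding weight_entry_def by blast
    then show ?thesis
    proof cases
      case 1
      then show ?thesis using reps_C(1) by (intro neg[of "opC 0"]) (simp_all add: opC_def)
    next
      case g: 2
      have 0: "opX g (2 * h) f a = 0" if "\<forall>b. b \<notin> window h i \<longrightarrow> f b = 0" "a \<in> window h i'" for h f a
      proof (cases "0 < a g")
        case True
        have "a(g := a g - 1) \<notin> window h i"
          using that(2) deg_upd(2)[of a g] True g(1) by (auto simp: c split: if_splits)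
        then show ?thesis using that(1) by (simp add: opX_def)
      qed (simp add: opX_def)
      from g(2) show ?thesis
      proof
        assume "tmap oring_point (unit_vec i) i' = oX g"
        then show ?thesis using reps_XYZ(1)[of g] 0 by (intro neg[of "opX g"]) auto
      next
        assume "tmap oring_point (unit_vec i) i' = - oX g"
        then show ?thesis using reps_N[OF reps_XYZ(1)[of g]] 0 by (intro neg[of "opN (opX g)"]) (auto simp: opM_def opC_def)
      qed
    next
      case g: 3
      have 0: "opY g (2 * h) f a = 0" if "\<forall>b. b \<notin> window h i \<longrightarrow> f b = 0" "a \<in> window h i'" for h f a
      proof -
        have "a(g := Suc (a g)) \<notin> window h i"
          using that(2) deg_upd(1)[of a g] g(1) by (auto simp: c split: if_splits)
        then show ?thesis using that(1) by (simp add: opY_def)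
      qed
      from g(2) show ?thesis
      proof
        assume "tmap oring_point (unit_vec i) i' = oY g"
        then show ?thesis using reps_XYZ(2)[of g] 0 by (intro neg[of "opY g"]) auto
      next
        assume "tmap oring_point (unit_vec i) i' = - oY g"
        then show ?thesis using reps_N[OF reps_XYZ(2)[of g]] 0 by (intro neg[of "opN (opY g)"]) (auto simp: opM_def opC_def)
      qed
    qed
  qed
qed


section \<open>Non-existence of a section\<close>

theorem no_factor:
  fixes A :: "(kix \<Rightarrow> oring) \<Rightarrow> jix \<Rightarrow> oring"
  assumes A: "mlin A" and B: "mlin B" and BA: "\<And>v. B (A v) = tmap oring_point v"
  shows False
proof -
  obtain ra where ra: "\<And>j i. reps (ra j i) (A (unit_vec i) j)"
    by (rule that[of "\<lambda>j i. SOME R. reps R (A (unit_vec i) j)"]) (rule someI_ex[OF reps_exists])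
  obtain rb where rb: "\<And>i j. reps (rb i j) (B (unit_vec j) i)"
    by (rule that[of "\<lambda>i j. SOME R. reps R (B (unit_vec j) i)"]) (rule someI_ex[OF reps_exists])
  obtain \<tau> where \<tau>: "\<And>i i'. reps (\<tau> i' i) (tmap oring_point (unit_vec i) i')"
    and diag: "\<And>i h f a. 12 \<le> h \<Longrightarrow> (\<forall>b. b \<notin> window h i \<longrightarrow> f b = 0) \<Longrightarrow> a \<in> window h i \<Longrightarrow> cmod (f a) / 4 \<le> cmod (\<tau> i i (2 * h) f a)"
    and off: "\<And>i i' h f a. i \<noteq> i' \<Longrightarrow> 12 \<le> h \<Longrightarrow> (\<forall>b. b \<notin> window h i \<longrightarrow> f b = 0) \<Longrightarrow> a \<in> window h i' \<Longrightarrow> \<tau> i' i (2 * h) f a = 0"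
  proof -
    define \<tau> where "\<tau> i' i = (SOME \<tau>. reps \<tau> (tmap oring_point (unit_vec i) i') \<and>
      (\<forall>h f a. 12 \<le> h \<longrightarrow> (\<forall>b. b \<notin> window h i \<longrightarrow> f b = 0) \<longrightarrow> a \<in> window h i' \<longrightarrow>
        (if i = i' then cmod (f a) / 4 \<le> cmod (\<tau> (2 * h) f a) else \<tau> (2 * h) f a = 0)))" for i' i
    note t = someI_ex[OF tmap_rep, folded \<tau>_def]
    have t1: "reps (\<tau> i' i) (tmap oring_point (unit_vec i) i')" for i i' using t[of i' i] by (rule conjunct1)
    have t2: "12 \<le> h \<Longrightarrow> (\<forall>b. b \<notin> window h i \<longrightarrow> f b = 0) \<Longrightarrow> a \<in> window h i' \<Longrightarrow>
      (if i = i' then cmod (f a) / 4 \<le> cmod (\<tau> i' i (2 * h) f a) else \<tau> i' i (2 * h) f a = 0)" for i i' h f a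
      using t[of i' i, THEN conjunct2, rule_format] by blast
    show thesis
    proof (rule that[of \<tau>, OF t1])
      show "cmod (f a) / 4 \<le> cmod (\<tau> i i (2 * h) f a)" if "12 \<le> h" "\<forall>b. b \<notin> window h i \<longrightarrow> f b = 0" "a \<in> window h i" for i h f a
        using t2[OF that] by simp
      show "\<tau> i' i (2 * h) f a = 0" if "i \<noteq> i'" "12 \<le> h" "\<forall>b. b \<notin> window h i \<longrightarrow> f b = 0" "a \<in> window h i'" for i i' h f a
        using t2[OF that(2-4)] that(1) by simp
    qed
  qed
  have lin: "op_linear (ra j i k)" "op_linear (rb i j k)" for i j k
    using ra rb gen_op_linear unfolding reps_def by blast+
  define D where "D i' i = opD (\<lambda>k f a. \<Sum>j\<in>UNIV. opM (rb i' j) (ra j i) k f a) (\<tau> i' i)" for i' i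
  have "null (D i' i)" for i' i
  proof -
    have "tmap oring_point (unit_vec i) i' = (\<Sum>j\<in>UNIV. B (unit_vec j) i' * A (unit_vec i) j)"
      using mlin_expand[OF B, of "A (unit_vec i)" i'] by (simp add: BA)
    then have "reps (\<lambda>k f a. \<Sum>j\<in>UNIV. opM (rb i' j) (ra j i) k f a) (tmap oring_point (unit_vec i) i')"
      by (simp add: reps_sum reps_M ra rb)
    then show ?thesis unfolding D_def using reps_null \<tau> by blast
  qed
  \<comment> \<open>Summed over all coordinates the errors stay below 1/8 of the maximum, half of
    what the diagonal entries guarantee.\<close>
  define e where "e = 1 / (8 * real (card (UNIV :: kix set)))"
  have n: "0 < card (UNIV :: kix set)" by (simp add: card_gt_0_iff)
  have e: "0 < e" "real (card (UNIV :: kix set)) * e = 1 / 8" using n by (auto simp: e_def)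
  have "\<forall>\<^sub>F k in sequentially. \<forall>x. bnd e k (D (fst x) (snd x) k)"
    using \<open>\<And>i' i. null (D i' i)\<close> e(1) unfolding null_def eventually_sequentially[symmetric]
    by (intro eventually_all_finite) blast
  then obtain K where K: "\<And>k i' i. k \<ge> K \<Longrightarrow> bnd e k (D i' i k)" unfolding eventually_sequentially by auto
  define h where "h = max K 12"
  define k where "k = 2 * h"
  have h: "12 \<le> h" "6 \<le> h" "K \<le> k" by (auto simp: h_def k_def)
  define P where "P = Sigma UNIV (window h)"
  define Q where "Q = (UNIV :: jix set) \<times> {a. deg a \<le> k}"
  have P: "finite P" "card P = 60 * card {a. deg a \<le> k} + 1" unfolding P_def k_def by (rule card_window[OF h(2)])+
  have "card (UNIV :: jix set) = 60"
  proof -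
    have "card ((UNIV :: brown_ix set) <+> (UNIV :: (bool \<times> bool) set)) = 60"
      by (subst card_Plus) (simp_all add: card_ix UNIV_Times_UNIV[symmetric] card_cartesian_product del: UNIV_Times_UNIV)
    then show ?thesis by simp
  qed
  then have Q: "finite Q" "card Q < card P" unfolding Q_def P(2) by (simp_all add: finite_deg card_cartesian_product)
  \<comment> \<open>The unknowns are vectors supported on the windows; the equations require that
    the operators representing \<open>A\<close> send them to 0 at every point of all 60 copies of
    the simplex.\<close>
  define L where "L q f = (\<Sum>i\<in>UNIV. ra (fst q) i k (\<lambda>b. f (i, b)) (snd q))" for q f
  have "\<exists>f. (\<forall>x. x \<notin> P \<longrightarrow> f x = 0) \<and> (\<exists>x. f x \<noteq> 0) \<and> (\<forall>q\<in>Q. L q f = 0)"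
    by (rule linear_kernel[OF Q(1) P(1) Q(2)]) (simp_all add: L_def op_linearD[OF lin(1)] sum.distrib sum_distrib_left)
  then obtain f where f: "\<And>x. x \<notin> P \<Longrightarrow> f x = 0" "\<exists>x. f x \<noteq> 0" "\<And>q. q \<in> Q \<Longrightarrow> L q f = 0" by blast
  define M where "M = Max ((\<lambda>x. cmod (f x)) ` P)"
  obtain x0 where x0: "x0 \<in> P" "f x0 \<noteq> 0" using f by blast
  have M: "cmod (f x) \<le> M" if "x \<in> P" for x unfolding M_def using that P(1) by simp
  then have M0: "0 < M" using x0 by (metis less_le_trans zero_less_norm_iff)
  have M': "cmod (f x) \<le> M" for x using M[of x] f(1)[of x] M0 by (cases "x \<in> P") auto
  have "M \<in> (\<lambda>x. cmod (f x)) ` P" unfolding M_def using P(1) x0(1) by (intro Max_in) auto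
  \<comment> \<open>The row at a coordinate of maximal modulus is the one in which the diagonal term
    must dominate all errors.\<close>
  then obtain i' a where x: "(i', a) \<in> P" "cmod (f (i', a)) = M" by auto
  then have a: "a \<in> window h i'" "deg a \<le> k" using window_deg by (auto simp: P_def k_def)
  have supp: "\<forall>b. b \<notin> window h i \<longrightarrow> f (i, b) = 0" for i using f(1) by (auto simp: P_def)
  have zero: "rb i' j k (\<lambda>b. \<Sum>i\<in>UNIV. ra j i k (\<lambda>b. f (i, b)) b) a = 0" for j
  proof -
    obtain C where C: "bnd C k (rb i' j k)" using gen_bnd[of "rb i' j"] rb[of i' j] unfolding reps_def by blast
    \<comment> \<open>The inner sum vanishes on the simplex only; bounding it by 0 there is enough
      for \<open>rb\<close> to annihilate it at \<open>a\<close>.\<close>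
    have "cmod (\<Sum>i\<in>UNIV. ra j i k (\<lambda>b. f (i, b)) b) \<le> 0" if "deg b \<le> k" for b
      using f(3)[of "(j, b)"] that by (simp add: L_def Q_def)
    from bndD[OF C this a(2)] show ?thesis by simp
  qed
  have "(\<Sum>i\<in>UNIV. \<tau> i' i k (\<lambda>b. f (i, b)) a) = \<tau> i' i' k (\<lambda>b. f (i', b)) a"
  proof -
    have "\<tau> i' i k (\<lambda>b. f (i, b)) a = (if i = i' then \<tau> i' i' k (\<lambda>b. f (i', b)) a else 0)" for i
    proof (cases "i = i'")
      case False
      have "\<tau> i' i k (\<lambda>b. f (i, b)) a = 0" unfolding k_def by (rule off[OF False h(1) supp a(1)])
      then show ?thesis by (simp only: False if_False)
    qed simp
    then have "(\<Sum>i\<in>UNIV. \<tau> i' i k (\<lambda>b. f (i, b)) a) = (\<Sum>i\<in>UNIV. if i = i' then \<tau> i' i' k (\<lambda>b. f (i', b)) a else 0)"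
      by (rule sum.cong[OF refl])
    then show ?thesis by simp
  qed
  moreover have "(\<Sum>i\<in>UNIV. \<Sum>j\<in>UNIV. rb i' j k (ra j i k (\<lambda>b. f (i, b))) a) = 0"
  proof -
    have "(\<Sum>i\<in>UNIV. \<Sum>j\<in>UNIV. rb i' j k (ra j i k (\<lambda>b. f (i, b))) a) = (\<Sum>j\<in>UNIV. \<Sum>i\<in>UNIV. rb i' j k (ra j i k (\<lambda>b. f (i, b))) a)"
      by (rule sum.swap)
    also have "\<dots> = 0" using zero by (simp add: op_linear_sum[OF _ lin(2)])
    finally show ?thesis .
  qed
  ultimately have "(\<Sum>i\<in>UNIV. D i' i k (\<lambda>b. f (i, b)) a) = - \<tau> i' i' k (\<lambda>b. f (i', b)) a"
    by (simp add: D_def op_defs sum_subtractf sum_negf)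
  then have "cmod (\<tau> i' i' k (\<lambda>b. f (i', b)) a) \<le> (\<Sum>i\<in>UNIV. cmod (D i' i k (\<lambda>b. f (i, b)) a))"
    using norm_sum[of "\<lambda>i. D i' i k (\<lambda>b. f (i, b)) a" UNIV] by simp
  also have "\<dots> \<le> (\<Sum>i\<in>(UNIV :: kix set). e * M)"
    by (intro sum_mono bndD[OF K[OF h(3)] M' a(2)])
  also have "\<dots> = (real (card (UNIV :: kix set)) * e) * M" by simp
  also have "\<dots> = M / 8" unfolding e(2) by simp
  finally have "cmod (\<tau> i' i' k (\<lambda>b. f (i', b)) a) \<le> M / 8" .
  moreover have "M / 4 \<le> cmod (\<tau> i' i' k (\<lambda>b. f (i', b)) a)"
    using diag[OF h(1) supp a(1)] unfolding x(2) k_def .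
  ultimately show False using M0 by linarith
qed

lemma (in ring_copy) extremal_pair_el:
  assumes p: "base_point p"
  shows "(el (vpv p), el (vmv p)) \<in> extremal_pairs S (TKK S)"
proof -
  have s: "p Vs = 1 - p Vt" and q: "p Vx * p Vy - mu (alb10 p) = p Vt * (1 - p Vt)"
    using p by (simp_all add: base_point_def)
  define sp :: "'a lie \<Rightarrow> 'a" where "sp = (\<lambda>(a, w, g, v, b). - 2 * (p Vt * a + lam (Vq (bmk (p Vx) (p Vy \<cdot> cE) (alb10 p) 0) w) + (1 - p Vt) * kap g))"
  have ep: "lbr (vpv p) (lbr (vpv p) u) = lsc (sp u) (vpv p)" if "u \<in> LT" for u
    using that vp_extremal[OF u10_alb10 q] by (cases u) (simp add: vpv_def s sp_def)
  obtain sm where em: "lbr (vmv p) (lbr (vmv p) u) = lsc (sm u) (vmv p)" if "u \<in> LT" for u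
  proof -
    have "\<forall>u. \<exists>r. u \<in> LT \<longrightarrow> lbr (vmv p) (lbr (vmv p) u) = lsc r (vmv p)"
      using vm_extremal[OF u10_alb10 q] by (auto simp: vmv_def s)
    then show thesis using that by metis
  qed
  \<comment> \<open>At a base point the coordinates \<open>Vt\<close> and \<open>Vs\<close> add up
    to 1, so their sum is a linear form as required, even if neither of them is invertible.\<close>
  define fp :: "'a lie \<Rightarrow> 'a" where "fp = (\<lambda>(a, x, f, y, b). b + f (bmk 0 0 0 1) (A1 (Dg I1)))"
  define fm :: "'a lie \<Rightarrow> 'a" where "fm = (\<lambda>(a, x, f, y, b). a + f (bmk 1 0 0 0) (A2 (Dg I1)))"
  have ep': "extremal S (TKK S) (el (vpv p))"
    by (rule extremal_el(1)[of _ fp, OF vw_LT(1) _ _ _ ep]) (auto simp: fp_def vpv_def vp_def s osc_def Phi_def bmk_def algebra_simps)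
  have eform: "extremal_form S (TKK S) (el (vpv p)) (el (vmv p)) = emb (sp (vmv p))"
    by (rule extremal_el(2)[of _ fp, OF vw_LT(1) _ _ _ ep vw_LT(2)]) (auto simp: fp_def vpv_def vp_def s osc_def Phi_def bmk_def algebra_simps)
  have em': "extremal S (TKK S) (el (vmv p))"
    by (rule extremal_el(1)[of _ fm, OF vw_LT(2) _ _ _ em]) (auto simp: fm_def vmv_def vm_def s osc_def Psi_def bmk_def algebra_simps)
  have l: "lam (Vq (bmk (p Vx) (p Vy \<cdot> cE) (alb10 p) 0) (bmk 0 (- crs cE (alb10 p)) (p Vx \<cdot> cE) (p Vy))) = 2 * (p Vx * p Vy - mu (alb10 p))"
  proof -
    have "trc (alb10 p) (crs cE (alb10 p)) = 2 * mu (alb10 p)"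
      by (simp add: trc_def crs_cE opol_def mu_def onrm_def alb_simps algebra_simps)
    then show ?thesis by (simp add: lam_Vq trc_cE trc_sc trc_minus algebra_simps)
  qed
  have k: "kap (osc (1 - p Vt) (Psi cE)) = 1 - p Vt"
    by (simp add: kap_lin kap_ops)
  \<comment> \<open>The bracket in \<open>sp\<close> becomes
    \<open>z^2 + 2 * z * (1 - z) + (1 - z)^2\<close>, the square of \<open>z + (1 - z)\<close>; the
    middle term is the equation of the quadric.\<close>
  have "sp (vmv p) = - 2"
    by (simp add: sp_def vmv_def vm_def l k q s algebra_simps)
  then have "extremal_form S (TKK S) (el (vpv p)) (el (vmv p)) = \<ominus>\<^bsub>S\<^esub> (\<one>\<^bsub>S\<^esub> \<oplus>\<^bsub>S\<^esub> \<one>\<^bsub>S\<^esub>)"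
    unfolding eform by simp
  with ep' em' show ?thesis by (simp add: extremal_pairs_def)
qed

theorem proposition7p7:
  assumes universe: "\<exists>\<iota> :: complex \<Rightarrow> 'u. inj \<iota>"
  shows "\<not> trivial_torsor
    (Brown_torsor :: ('u, 'u tkk \<Rightarrow> 'u tkk, 'u tkk \<Rightarrow> 'u tkk, 'u tkk \<times> 'u tkk) torsor)"
proof
  assume "trivial_torsor (Brown_torsor :: ('u, 'u tkk \<Rightarrow> 'u tkk, 'u tkk \<Rightarrow> 'u tkk, 'u tkk \<times> 'u tkk) torsor)"
  then obtain \<sigma> where \<sigma>: "is_section (Brown_torsor :: ('u, 'u tkk \<Rightarrow> 'u tkk, 'u tkk \<Rightarrow> 'u tkk, 'u tkk \<times> 'u tkk) torsor) \<sigma>"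
    unfolding trivial_torsor_def by blast
  obtain \<iota> :: "complex \<Rightarrow> 'u" where \<iota>: "inj \<iota>" using universe by blast
  obtain g :: "oring \<Rightarrow> complex" where g: "inj g" using oring_embed by blast
  define emb where "emb = \<iota> \<circ> g"
  have emb: "inj emb" unfolding emb_def by (rule inj_compose[OF \<iota> g])
  define S :: "'u calg" where "S = \<lparr>carrier = range emb,
     monoid.mult = (\<lambda>x y. emb (inv_into UNIV emb x * inv_into UNIV emb y)), monoid.one = emb 1,
     ring.zero = emb 0, ring.add = (\<lambda>x y. emb (inv_into UNIV emb x + inv_into UNIV emb y)),
     module.smult = (\<lambda>c x. emb (oC c * inv_into UNIV emb x))\<rparr>"
  interpret ring_copy emb oC S
    by unfold_locales (auto simp: emb oC_hom S_def)
  let ?y = "(el (vpv oring_point), el (vmv oring_point))"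
  have y: "?y \<in> points Y_scheme S"
    using extremal_pair_el[OF base_point_oring] by (simp add: Y_scheme_def)
  then have "\<sigma> S ?y \<in> points G_scheme S" and pr: "(\<sigma> S ?y (one_plus S), \<sigma> S ?y (one_minus S)) = ?y"
    using \<sigma> C_ring_S unfolding is_section_def scheme_morphism_def Brown_torsor_def by auto
  then have "\<sigma> S ?y \<in> alg_Aut S (TKK S)" by (simp add: G_scheme_def)
  then obtain F where F: "\<And>p. p \<in> LT \<Longrightarrow> \<sigma> S ?y (el p) = el (F p)" "bij_betw F LT LT"
    "\<And>p q. p \<in> LT \<Longrightarrow> q \<in> LT \<Longrightarrow> F (p + q) = F p + F q" "\<And>r p. p \<in> LT \<Longrightarrow> F (lsc r p) = lsc r (F p)"
    "\<And>p q. p \<in> LT \<Longrightarrow> q \<in> LT \<Longrightarrow> F (lbr p q) = lbr (F p) (F q)"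
    by (rule Aut_el) blast
  have "F (0, 0, 0, 0, 1) = vpv oring_point" "F (1, 0, 0, 0, 0) = vmv oring_point"
    using pr F(1)[of "(0, 0, 0, 0, 1)"] F(1)[of "(1, 0, 0, 0, 0)"] by (simp_all add: one_pm L0T_0 el_eq)
  from brown_factor[OF base_point_oring F(2-5) this] obtain A :: "(kix \<Rightarrow> oring) \<Rightarrow> jix \<Rightarrow> oring" and B
    where "mlin A" "mlin B" "\<And>v. B (A v) = tmap oring_point v" by blast
  then show False by (rule no_factor)
qed

end
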